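(* Let $(X,d,\sigma)$ be a compatible metric-topological space with $(X,d)$ complete, let $\phi:X\to(-\infty,\infty]$ be proper and satisfy the LSCC assumptions with coercivity constant $\mathsf B$, and let $\varepsilon>0$ with $\frac1{16\varepsilon}\ge\mathsf B$. Let $T\in(0,\infty]$, $\bar u\in X$, and let $u\in\mathcal M_{\varepsilon,T}(\bar u)$. Then the map $t\mapsto\phi(u(t))-\frac\varepsilon2|u'|^2(t)$ belongs to $W^{1,1}(0,T)$ (to $W^{1,1}_{\rm loc}([0,\infty))$ when $T=\infty$) and it fulfills $$\frac{d}{dt}\Big(\phi(u(t))-\frac\varepsilon2|u'|^2(t)\Big)=-|u'|^2(t)\qquad\text{in }\mathcal D'(0,T).$$
   Context: **Setting.** $(X,d)$ is a complete metric space and $\sigma$ is a Hausdorff topology on $X$; $(X,d,\sigma)$ is called compatible if (MT1) $u_n\to u$ and $v_n\to v$ in $\sigma$ imply $\liminf_n d(u_n,v_n)\ge d(u,v)$; (MT2) for every $\sigma$-open set $U$ and $x\in U$ there exist a $\sigma$-open neighborhood $V$ of $x$ and $\delta>0$ such that $d(y,V)<\delta$ implies $y\in U$, where $d(y,V)=\inf_{v\in V}d(y,v)$. For an interval $I\subset\mathbb R$ and $p\in[1,\infty]$, $AC^p(I;X)$ is the set of curves $u:I\to X$ for which there is $m\in L^p(I)$ with $d(u(s),u(t))\le\int_s^t m(r)\,dr$ for all $s\le t$ in $I$; $AC^p_{\rm loc}(I;X)$ is the set of curves belonging to $AC^p(J;X)$ for every compact interval $J\subset I$. The metric derivative $|u'|(t)=\lim_{s\to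 t}\frac{d(u(s),u(t))}{|t-s|}$ exists for a.e. $t\in I$. **LSCC assumptions.** $\phi:X\to(-\infty,\infty]$ is proper, and: (Lower semicontinuity) if $\sup_{n,m}d(u_n,u_m)<\infty$ and $u_n\to u$ in $\sigma$, then $\liminf_n\phi(u_n)\ge\phi(u)$; (Compactness) every sequence with $\sup_n\phi(u_n)<\infty$ and $\sup_{n,m}d(u_n,u_m)<\infty$ has a $\sigma$-convergent subsequence; (Coercivity) there are $u_*\in X$ and constants $\mathsf A,\mathsf B\ge0$ such that $\phi(u)\ge-\mathsf B\,d^2(u,v)-\mathsf Q(v)$ for all $u,v\in X$, where $\mathsf Q(v)=\mathsf B\,d^2(v,u_* )+\mathsf A$. **WED functional.** $\mu_\varepsilon$ is the probability measure on $(0,\infty)$ with density $\frac1\varepsilon e^{-t/\varepsilon}$, and $\mathcal I_\varepsilon[u]=\int_0^\infty\big(\frac\varepsilon2|u'|^2+\phi(u)\big)\,d\mu_\varepsilon$. The admissible classes are $\mathscr C_{\varepsilon,\infty}(\bar u)=\mathscr C_\varepsilon(\bar u)=\{u\in AC^2_{\rm loc}([0,\infty);X): u(0)=\bar u,\ \int_0^\infty|u'|^2\,d\mu_\varepsilon<\infty\}$ and, for $T\in(0,\infty)$, $\mathscr C_{\varepsilon,T}(\bar u)=\{u\in AC^2_{\rm loc}([0,\infty);X): u(0)=\bar u,\ u(t)=u(T)\text{ for all }t\ge T\}$. For $T\in(0,\infty]$, $\mathcal M_{\varepsilon,T}(\bar u)$ is the set of minimizers of $\mathcal I_\varepsilon$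 in $\mathscr C_{\varepsilon,T}(\bar u)$, understood to be empty if the infimum is $+\infty$. $\mathcal D'(0,T)$ denotes distributions on $(0,T)$. *)

theory Defs
  imports "HOL-Analysis.Analysis"
begin

text \<open>The complete metric space \<open>(X,d)\<close> is a type of class \<^class>\<open>complete_space\<close> with
  its \<^const>\<open>dist\<close>; the second topology \<open>\<sigma>\<close> is an abstract topology on the same points.\<close>

definition compatible :: "'a::metric_space topology \<Rightarrow> bool" where
  "compatible \<sigma> \<longleftrightarrow>
     topspace \<sigma> = UNIV \<and> Hausdorff_space \<sigma> \<and>
     (\<forall>u v x y. limitin \<sigma> u x sequentially \<and> limitin \<sigma> v y sequentially \<longrightarrow>
        liminf (\<lambda>n. ereal (dist (u n) (v n))) \<ge> ereal (dist x y)) \<and>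
     (\<forall>U x. openin \<sigma> U \<and> x \<in> U \<longrightarrow>
        (\<exists>V \<delta>. openin \<sigma> V \<and> x \<in> V \<and> \<delta> > 0 \<and> (\<forall>y. infdist y V < \<delta> \<longrightarrow> y \<in> U)))"

definition proper_functional :: "('a \<Rightarrow> ereal) \<Rightarrow> bool" where
  "proper_functional \<phi> \<longleftrightarrow> (\<forall>x. \<phi> x \<noteq> -\<infinity>) \<and> (\<exists>x. \<phi> x \<noteq> \<infinity>)"

definition lower_semicont :: "'a::metric_space topology \<Rightarrow> ('a \<Rightarrow> ereal) \<Rightarrow> bool" where
  "lower_semicont \<sigma> \<phi> \<longleftrightarrow>
     (\<forall>u x. bounded (range u) \<and> limitin \<sigma> u x sequentially \<longrightarrow>
        liminf (\<lambda>n. \<phi> (u n)) \<ge> \<phi> x)"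

definition compact_sublevels :: "'a::metric_space topology \<Rightarrow> ('a \<Rightarrow> ereal) \<Rightarrow> bool" where
  "compact_sublevels \<sigma> \<phi> \<longleftrightarrow>
     (\<forall>u :: nat \<Rightarrow> 'a. (SUP n. \<phi> (u n)) < \<infinity> \<and> bounded (range u) \<longrightarrow>
        (\<exists>r x. strict_mono r \<and> limitin \<sigma> (u \<circ> r) x sequentially))"

definition coercive :: "('a::metric_space \<Rightarrow> ereal) \<Rightarrow> 'a \<Rightarrow> real \<Rightarrow> real \<Rightarrow> bool" where
  "coercive \<phi> ustar A B \<longleftrightarrow> A \<ge> 0 \<and> B \<ge> 0 \<and>
     (\<forall>u v. \<phi> u \<ge> ereal (- B * (dist u v)\<^sup>2 - (B * (dist v ustar)\<^sup>2 + A)))"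

definition LSCC :: "'a::metric_space topology \<Rightarrow> ('a \<Rightarrow> ereal) \<Rightarrow> 'a \<Rightarrow> real \<Rightarrow> real \<Rightarrow> bool" where
  "LSCC \<sigma> \<phi> ustar A B \<longleftrightarrow>
     lower_semicont \<sigma> \<phi> \<and> compact_sublevels \<sigma> \<phi> \<and> coercive \<phi> ustar A B"

text \<open>Curves on an interval \<open>I\<close> are functions on \<open>\<real>\<close>, of which only the values on \<open>I\<close> matter.
  Only finite exponents \<open>p\<close> are treated.\<close>

definition Lp_on :: "real \<Rightarrow> real set \<Rightarrow> (real \<Rightarrow> real) \<Rightarrow> bool" where
  "Lp_on p I m \<longleftrightarrow> set_borel_measurable lborel I m \<and>
     set_integrable lborel I (\<lambda>r. \<bar>m r\<bar> powr p)"

definition AC :: "real \<Rightarrow> real set \<Rightarrow> (real \<Rightarrow> 'a::metric_space) \<Rightarrow> bool" where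
  "AC p I u \<longleftrightarrow> (\<exists>m. Lp_on p I m \<and>
     (\<forall>s\<in>I. \<forall>t\<in>I. s \<le> t \<longrightarrow> dist (u s) (u t) \<le> (LINT r:{s..t}|lborel. m r)))"

definition AC_loc :: "real \<Rightarrow> real set \<Rightarrow> (real \<Rightarrow> 'a::metric_space) \<Rightarrow> bool" where
  "AC_loc p I u \<longleftrightarrow> (\<forall>a b. a \<le> b \<and> {a..b} \<subseteq> I \<longrightarrow> AC p {a..b} u)"

text \<open>For absolutely continuous \<open>u\<close> the limit exists almost everywhere; the unspecified value of
  \<^const>\<open>Lim\<close> on the exceptional null set never matters below. Only interior points \<open>t > 0\<close>
  are used.\<close>

definition metric_deriv :: "(real \<Rightarrow> 'a::metric_space) \<Rightarrow> real \<Rightarrow> real" where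
  "metric_deriv u t = Lim (at t) (\<lambda>s. dist (u s) (u t) / \<bar>t - s\<bar>)"

definition mu_weight :: "real \<Rightarrow> real measure" where
  "mu_weight \<epsilon> = density (restrict_space lborel {0<..}) (\<lambda>t. ennreal (1 / \<epsilon> * exp (- t / \<epsilon>)))"

text \<open>Integral of an extended-real function as positive minus negative part
  (\<^const>\<open>e2ennreal\<close> truncates negative values to \<open>0\<close>). Under coercivity with
  \<open>B \<le> 1 / (16 * \<epsilon>)\<close> the negative part is finite on the admissible classes.\<close>

definition ext_integral :: "'b measure \<Rightarrow> ('b \<Rightarrow> ereal) \<Rightarrow> ereal" where
  "ext_integral M f =
     enn2ereal (\<integral>\<^sup>+ x. e2ennreal (f x) \<partial>M) - enn2ereal (\<integral>\<^sup>+ x. e2ennreal (- f x) \<partial>M)"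

definition WED :: "('a::metric_space \<Rightarrow> ereal) \<Rightarrow> real \<Rightarrow> (real \<Rightarrow> 'a) \<Rightarrow> ereal" where
  "WED \<phi> \<epsilon> u = ext_integral (mu_weight \<epsilon>) (\<lambda>t. ereal (\<epsilon> / 2 * (metric_deriv u t)\<^sup>2) + \<phi> (u t))"

definition admissible :: "real \<Rightarrow> ereal \<Rightarrow> 'a::metric_space \<Rightarrow> (real \<Rightarrow> 'a) set" where
  "admissible \<epsilon> T ubar =
     (if T = \<infinity>
      then {u. AC_loc 2 {0..} u \<and> u 0 = ubar \<and>
               (\<integral>\<^sup>+ t. ennreal ((metric_deriv u t)\<^sup>2) \<partial>mu_weight \<epsilon>) < \<infinity>}
      else {u. AC_loc 2 {0..} u \<and> u 0 = ubar \<and>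
               (\<forall>t. ereal t \<ge> T \<longrightarrow> u t = u (real_of_ereal T))})"

definition WED_minimizers ::
  "('a::metric_space \<Rightarrow> ereal) \<Rightarrow> real \<Rightarrow> ereal \<Rightarrow> 'a \<Rightarrow> (real \<Rightarrow> 'a) set" where
  "WED_minimizers \<phi> \<epsilon> T ubar =
     {u \<in> admissible \<epsilon> T ubar. (\<forall>v\<in>admissible \<epsilon> T ubar. WED \<phi> \<epsilon> u \<le> WED \<phi> \<epsilon> v) \<and>
        (INF v\<in>admissible \<epsilon> T ubar. WED \<phi> \<epsilon> v) \<noteq> \<infinity>}"

definition test_function :: "real set \<Rightarrow> (real \<Rightarrow> real) \<Rightarrow> bool" where
  "test_function I \<eta> \<longleftrightarrow>
     (\<forall>n x. (deriv ^^ n) \<eta> field_differentiable at x) \<and>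
     (\<exists>K. compact K \<and> K \<subseteq> I \<and> (\<forall>x. x \<notin> K \<longrightarrow> \<eta> x = 0))"

definition loc_integrable :: "real set \<Rightarrow> (real \<Rightarrow> real) \<Rightarrow> bool" where
  "loc_integrable I f \<longleftrightarrow> (\<forall>a b. {a..b} \<subseteq> I \<longrightarrow> set_integrable lborel {a..b} f)"

text \<open>\<open>f' = g\<close> in \<open>\<D>'(I)\<close>, where locally integrable \<open>f\<close> and \<open>g\<close> on the open interval \<open>I\<close>
  are identified with the distributions they induce.\<close>

definition has_distr_deriv :: "real set \<Rightarrow> (real \<Rightarrow> real) \<Rightarrow> (real \<Rightarrow> real) \<Rightarrow> bool" where
  "has_distr_deriv I f g \<longleftrightarrow> loc_integrable I f \<and> loc_integrable I g \<and>
     (\<forall>\<eta>. test_function I \<eta> \<longrightarrow>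
        - (LINT t:I|lborel. f t * deriv \<eta> t) = (LINT t:I|lborel. g t * \<eta> t))"

definition W11 :: "real set \<Rightarrow> (real \<Rightarrow> real) \<Rightarrow> bool" where
  "W11 I f \<longleftrightarrow> set_integrable lborel I f \<and>
     (\<exists>g. set_integrable lborel I g \<and> has_distr_deriv I f g)"

text \<open>Local in \<open>[0,\<infinity>)\<close>: integrability is required up to the endpoint \<open>0\<close>.\<close>

definition W11_loc :: "(real \<Rightarrow> real) \<Rightarrow> bool" where
  "W11_loc f \<longleftrightarrow> (\<forall>R>0. W11 {0<..<R} f)"

definition energy :: "('a::metric_space \<Rightarrow> ereal) \<Rightarrow> real \<Rightarrow> (real \<Rightarrow> 'a) \<Rightarrow> real \<Rightarrow> ereal" where
  "energy \<phi> \<epsilon> u t = \<phi> (u t) - ereal (\<epsilon> / 2 * (metric_deriv u t)\<^sup>2)"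

end

theory Submission imports Defs begin

text \<open>
  The energy identity is the Euler--Lagrange equation of the WED functional for inner variations,
  that is, for competitors \<open>u \<circ> S\<close> that run along the same curve with a different clock. Such
  competitors need no linear structure on \<open>X\<close>, and \<open>\<phi>\<close> is never differentiated: it is only
  evaluated at points of the trajectory of \<open>u\<close>.

  Let \<open>D\<close> be the metric derivative of \<open>u\<close>, put \<open>E s = exp (- s / \<epsilon>)\<close> and let \<open>\<theta>\<close> be the inverse of
  \<open>S\<close>. The substitution \<open>t = \<theta> s\<close> gives
  \<open>\<epsilon> * WED (u \<circ> S) = \<integral> (\<epsilon>/2 * (D s)\<^sup>2 / \<theta>' s + \<phi> (u s) * \<theta>' s) * exp (- \<theta> s / \<epsilon>) ds\<close>.
  The clock is chosen to be affine in the variable \<open>E\<close>, in which the measure \<open>\<mu>\<^sub>\<epsilon>\<close> is uniform: for a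
  test function \<open>\<zeta>\<close> and small \<open>\<tau>\<close>, \<open>\<theta>\<close> is defined by \<open>exp (- \<theta> / \<epsilon>) = E - \<tau> * \<zeta> / \<epsilon>\<close>. Then
  \<open>exp (- \<theta> / \<epsilon>) * \<theta>' = E + \<tau> * \<zeta>'\<close> is affine in \<open>\<tau>\<close>, and with \<open>a = \<tau> * \<zeta> / \<epsilon>\<close>, \<open>b = \<tau> * \<zeta>'\<close> the
  factor of the kinetic part is
  \<open>(E - a)\<^sup>2 / (E + b) = E - 2 * a - b + (a + b)\<^sup>2 / (E + b)\<close>.
  Hence minimality reads \<open>0 \<le> \<tau> * L + \<tau>\<^sup>2 * K\<close> for all small \<open>\<tau>\<close> of both signs, where
  \<open>L = \<integral> \<epsilon>/2 * D\<^sup>2 * (- 2 * \<zeta> / \<epsilon> - \<zeta>') + \<phi>(u) * \<zeta>'\<close>, and no limit under the integral is needed to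
  conclude \<open>L = 0\<close> (lemma \<open>first_variation_vanishes\<close>). This is the claimed distributional equation.

  Three facts make the computation legitimate. First, an absolutely continuous curve has a metric
  derivative almost everywhere, which controls its increments (\<open>AC_loc_metric_speed\<close>). Second,
  coercivity and a weighted Hardy inequality make the negative part of \<open>\<phi>(u)\<close> integrable, so that
  the finite minimal value is an honest integral and \<open>D\<^sup>2\<close> and \<open>\<phi>(u)\<close> are both integrable for
  \<open>\<mu>\<^sub>\<epsilon>\<close> (\<open>weighted_hardy\<close>, \<open>negative_part_finite\<close>). Third, \<open>\<phi> \<circ> u\<close> and the metric derivative are
  Borel functions on \<open>(0,\<infinity>)\<close> (\<open>lower_semicont_along_curve_borel\<close>, \<open>metric_deriv_borel\<close>).
\<close>

section \<open>Differentiation of indefinite integrals on the line\<close>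

lemma lebesgue_differentiation_right:
  fixes g :: "real \<Rightarrow> real"
  assumes g: "integrable lborel g"
  shows "AE t in lborel. ((\<lambda>h. (LINT r:{t..t+h}|lborel. g r) / h) \<longlongrightarrow> g t) (at_right 0)"
proof -
  have si: "set_integrable lborel {a..b} g" for a b
    using integrable_mult_indicator[OF _ g, of "{a..b}"] by (simp add: set_integrable_def)
  have int: "g integrable_on cbox a b" for a b
    using set_borel_integral_eq_integral(1)[OF si] by simp
  obtain N where N: "negligible N" and lim: "\<And>x e. \<lbrakk>x \<notin> N; 0 < e\<rbrakk> \<Longrightarrow>
      \<exists>d>0. \<forall>h. 0 < h \<and> h < d \<longrightarrow> norm (integral (cbox x (x + h *\<^sub>R One)) g /\<^sub>R h ^ DIM(real) - g x) < e"
    using integrable_ccontinuous_explicit[OF int] by blast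
  have "AE t in lebesgue. t \<notin> N"
    using N negligible_iff_null_sets AE_not_in by blast
  hence "AE t in lborel. t \<notin> N"
    by (simp add: AE_completion_iff)
  then show ?thesis
  proof eventually_elim
    case (elim t)
    show ?case
    proof (rule tendstoI)
      fix e :: real assume "0 < e"
      obtain d where d: "d > 0" "\<forall>h. 0 < h \<and> h < d \<longrightarrow> norm (integral (cbox t (t + h *\<^sub>R One)) g /\<^sub>R h ^ DIM(real) - g t) < e"
        using lim[OF elim \<open>0 < e\<close>] by blast
      show "\<forall>\<^sub>F h in at_right 0. dist ((LINT r:{t..t+h}|lborel. g r) / h) (g t) < e"
        unfolding eventually_at_right_field
      proof (intro exI[of _ d] conjI allI impI)
        fix h :: real assume h: "0 < h" "h < d"
        have "norm (integral (cbox t (t + h *\<^sub>R One)) g /\<^sub>R h ^ DIM(real) - g t) < e" using d h by blast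
        then show "dist ((LINT r:{t..t+h}|lborel. g r) / h) (g t) < e"
          by (simp add: set_borel_integral_eq_integral(2)[OF si] dist_real_def divide_inverse_commute)
      qed (use d in auto)
    qed
  qed
qed

text \<open>The left-hand averages are the right-hand averages of the reflected function, and reflection
  preserves null sets.\<close>
lemma lebesgue_differentiation_left:
  fixes g :: "real \<Rightarrow> real"
  assumes g: "integrable lborel g"
  shows "AE t in lborel. ((\<lambda>h. (LINT r:{t-h..t}|lborel. g r) / h) \<longlongrightarrow> g t) (at_right 0)"
proof -
  have g': "integrable lborel (\<lambda>x. g (- x))"
    using lborel_integrable_real_affine[OF g, of "-1" 0] by simp
  have "AE t in distr lborel borel uminus. ((\<lambda>h. (LINT r:{t..t+h}|lborel. g (- r)) / h) \<longlongrightarrow> g (- t)) (at_right 0)"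
    unfolding lborel_distr_uminus by (rule lebesgue_differentiation_right[OF g'])
  from AE_distrD[OF _ this]
  have "AE t in lborel. ((\<lambda>h. (LINT r:{-t..-t+h}|lborel. g (- r)) / h) \<longlongrightarrow> g (- (-t))) (at_right 0)"
    by simp
  moreover have "(LINT r:{-t..-t+h}|lborel. g (- r)) = (LINT r:{t-h..t}|lborel. g r)" for t h
    unfolding set_lebesgue_integral_def
    by (subst lborel_integral_real_affine[where c="-1" and t=0])
      (auto intro!: Bochner_Integration.integral_cong simp: indicator_def)
  ultimately show ?thesis by simp
qed

lemma lebesgue_differentiation:
  fixes g :: "real \<Rightarrow> real"
  assumes g: "integrable lborel g"
  shows "AE t in lborel. ((\<lambda>s. (LINT r:{min s t..max s t}|lborel. g r) / \<bar>t - s\<bar>) \<longlongrightarrow> g t) (at t)"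
  using lebesgue_differentiation_right[OF g] lebesgue_differentiation_left[OF g]
proof eventually_elim
  case (elim t)
  have r: "((\<lambda>s. (LINT r:{min s t..max s t}|lborel. g r) / \<bar>t - s\<bar>) \<longlongrightarrow> g t) (at_right t)"
  proof -
    have "((\<lambda>s. (LINT r:{t..t+(s - t)}|lborel. g r) / (s - t)) \<longlongrightarrow> g t) (at_right t)"
      using elim(1) by (simp add: filterlim_at_right_to_0[of _ _ t] add.commute)
    then show ?thesis
      by (rule Lim_transform_eventually) (auto simp: eventually_at_right_field min_def max_def intro!: exI[of _ "t+1"])
  qed
  have l: "((\<lambda>s. (LINT r:{min s t..max s t}|lborel. g r) / \<bar>t - s\<bar>) \<longlongrightarrow> g t) (at_left t)"
  proof -
    have "((\<lambda>s. (LINT r:{t-(t - s)..t}|lborel. g r) / (t - s)) \<longlongrightarrow> g t) (at_left t)"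
      using elim(2) unfolding filterlim_at_left_to_right filterlim_at_right_to_0[of _ _ "-t"] by simp
    then show ?thesis
      by (rule Lim_transform_eventually) (auto simp: eventually_at_left_field min_def max_def intro!: exI[of _ "t-1"])
  qed
  show ?case using l r by (simp add: filterlim_at_split)
qed

lemma set_integral_Ioc_Icc:
  fixes g :: "real \<Rightarrow> real"
  assumes "set_integrable lborel {a..b} g"
  shows "(LINT r:{a<..b}|lborel. g r) = (LINT r:{a..b}|lborel. g r)"
proof -
  have "AE r in lborel. r \<noteq> a" by (rule AE_lborel_singleton)
  hence ae: "AE r in lborel. (r \<in> {a..b}) = (r \<in> {a<..b})" by eventually_elim auto
  have m: "set_borel_measurable lborel {a..b} g"
    using assms unfolding set_integrable_def set_borel_measurable_def by auto
  have "set_integrable lborel {a<..b} g" by (rule set_integrable_subset[OF assms]) auto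
  hence m': "set_borel_measurable lborel {a<..b} g"
    unfolding set_integrable_def set_borel_measurable_def by auto
  show ?thesis by (rule set_integral_cong_set[OF m m' ae]) 
qed

lemma set_integrable_of_integrable:
  fixes h :: "real \<Rightarrow> real"
  assumes "A \<in> sets borel" "integrable lborel h"
  shows "set_integrable lborel A h"
  using integrable_mult_indicator[OF _ assms(2), of A] assms(1) by (simp add: set_integrable_def)

lemma cumulative_integral_diff:
  fixes m :: "real \<Rightarrow> real"
  assumes m: "integrable lborel m" and "s \<le> t"
  shows "(LINT r:{..t}|lborel. m r) - (LINT r:{..s}|lborel. m r) = (LINT r:{s..t}|lborel. m r)"
proof -
  note si = set_integrable_of_integrable[OF _ m]
  have "{..t} = {..s} \<union> {s<..t}" using \<open>s \<le> t\<close> by auto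
  hence 1: "(LINT r:{..t}|lborel. m r) = (LINT r:{..s}|lborel. m r) + (LINT r:{s<..t}|lborel. m r)"
    by (simp, subst set_integral_Un) (auto intro!: si)
  show ?thesis using 1 set_integral_Ioc_Icc[OF si] by simp
qed

lemma isCont_cumulative_integral:
  fixes m :: "real \<Rightarrow> real"
  assumes m: "integrable lborel m"
  shows "isCont (\<lambda>t. LINT r:{..t}|lborel. m r) a"
proof -
  note si = set_integrable_of_integrable[OF _ m]
  define F where "F t = (LINT r:{..t}|lborel. m r)" for t
  have 1: "continuous_on {a-1..a+1} (\<lambda>x. F (a-1) + integral {a-1..x} m)"
    using set_borel_integral_eq_integral(1)[OF si]
    by (intro continuous_intros indefinite_integral_continuous_1) auto
  have "continuous_on {a-1..a+1} F"
    by (rule continuous_on_cong[THEN iffD1, OF refl _ 1])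
      (simp add: F_def cumulative_integral_diff[OF m, symmetric] set_borel_integral_eq_integral(2)[OF si, symmetric])
  hence "isCont F a" by (rule continuous_on_interior) auto
  thus ?thesis unfolding F_def[abs_def] .
qed

text \<open>If \<open>F\<close> is a primitive of \<open>m\<close>, the hypothesis says that \<open>F + f\<close> and \<open>F - f\<close> are both
  nondecreasing. Their Stieltjes measures add up to the measure with density \<open>2 * m\<close>, so each is
  absolutely continuous, and a Radon--Nikodym density of the first yields one of \<open>f\<close>.\<close>
lemma dominated_increments_have_density:
  fixes f m :: "real \<Rightarrow> real"
  assumes m: "integrable lborel m" and m0: "\<And>x. 0 \<le> m x"
    and f: "\<And>s t. s \<le> t \<Longrightarrow> \<bar>f t - f s\<bar> \<le> (LINT r:{s..t}|lborel. m r)"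
  shows "\<exists>g. integrable lborel g \<and> (\<forall>s t. s \<le> t \<longrightarrow> f t - f s = (LINT r:{s..t}|lborel. g r))"
proof -
  have [measurable]: "m \<in> borel_measurable borel" using borel_measurable_integrable[OF m] by simp
  note si = set_integrable_of_integrable
  define F where "F t = (LINT r:{..t}|lborel. m r)" for t
  have F: "F t - F s = (LINT r:{s..t}|lborel. m r)" if "s \<le> t" for s t
    unfolding F_def by (rule cumulative_integral_diff[OF m that])
  have Fc: "continuous (at_right a) F" for a
    unfolding F_def[abs_def] by (rule continuous_at_imp_continuous_at_within[OF isCont_cumulative_integral[OF m]])
  have dF: "\<bar>f t - f s\<bar> \<le> F t - F s" if "s \<le> t" for s t using f[OF that] F[OF that] by simp
  have fc: "continuous (at_right a) f" for a
  proof -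
    have "((\<lambda>x. F x - F a) \<longlongrightarrow> 0) (at_right a)" using Fc[of a] by (simp add: continuous_within LIM_zero)
    hence "((\<lambda>x. f x - f a) \<longlongrightarrow> 0) (at_right a)"
      by (rule Lim_null_comparison[rotated])
        (auto simp: eventually_at_right_field intro!: exI[of _ "a+1"] dF)
    thus ?thesis by (simp add: continuous_within LIM_zero_cancel)
  qed
  define G1 where "G1 t = F t + f t" for t
  define G2 where "G2 t = F t - f t" for t
  define \<nu>1 where "\<nu>1 = interval_measure G1"
  define \<nu>2 where "\<nu>2 = interval_measure G2"
  have G1: "G1 s \<le> G1 t" "G2 s \<le> G2 t" if "s \<le> t" for s t
    using dF[OF that] by (auto simp: G1_def G2_def)
  have Gc: "continuous (at_right a) G1" "continuous (at_right a) G2" for a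
    unfolding G1_def[abs_def] G2_def[abs_def] using Fc fc by (auto intro!: continuous_intros)
  have e1: "emeasure \<nu>1 {a<..b} = ennreal (G1 b - G1 a)" "emeasure \<nu>2 {a<..b} = ennreal (G2 b - G2 a)"
    if "a \<le> b" for a b
    unfolding \<nu>1_def \<nu>2_def using that G1 Gc by (auto intro!: emeasure_interval_measure_Ioc)
  have [simp, measurable_cong]: "sets \<nu>1 = sets borel" "sets \<nu>2 = sets borel" by (auto simp: \<nu>1_def \<nu>2_def)
  \<comment> \<open>this sum turns out to be \<open>M\<close>, so that \<open>\<nu>1 \<le> M\<close>\<close>
  define N where "N = measure_of UNIV (sets borel) (\<lambda>A. emeasure \<nu>1 A + emeasure \<nu>2 A)"
  have sN[simp]: "sets N = sets borel" unfolding N_def using sets.sigma_sets_eq[of borel] by simp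
  have eN: "emeasure N A = emeasure \<nu>1 A + emeasure \<nu>2 A" if "A \<in> sets borel" for A
  proof (rule emeasure_measure_of[OF N_def])
    show "positive (sets N) (\<lambda>A. emeasure \<nu>1 A + emeasure \<nu>2 A)" by (simp add: positive_def)
    show "countably_additive (sets N) (\<lambda>A. emeasure \<nu>1 A + emeasure \<nu>2 A)"
      unfolding countably_additive_def
      by (auto simp: suminf_add[symmetric] suminf_emeasure)
  qed (use that in auto)
  define M where "M = density lborel (\<lambda>x. ennreal (2 * m x))"
  have sM[simp]: "sets M = sets borel" by (simp add: M_def)
  have eM: "emeasure M A = ennreal (2 * (LINT r:A|lborel. m r))" if [measurable]: "A \<in> sets borel" for A
  proof -
    have "emeasure M A = (\<integral>\<^sup>+ x. ennreal (2 * (indicator A x * m x)) \<partial>lborel)"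
      unfolding M_def by (subst emeasure_density) (auto intro!: nn_integral_cong simp: indicator_def)
    also have "\<dots> = ennreal (\<integral>x. 2 * (indicator A x * m x) \<partial>lborel)"
      using m0 si[OF that m] by (intro nn_integral_eq_integral) (auto simp: set_integrable_def)
    finally show ?thesis by (simp add: set_lebesgue_integral_def)
  qed
  have NM: "emeasure N {a<..b} = emeasure M {a<..b}" if "a \<le> b" for a b
    using that G1[OF that] set_integral_Ioc_Icc[OF si[OF _ m], of a b]
    by (simp add: eN eM e1 F[symmetric] ennreal_plus[symmetric] del: ennreal_plus) (simp add: G1_def G2_def)
  have "M = N"
  proof (rule measure_eqI_lessThan)
    fix x :: real
    show "emeasure M {x<..} < \<infinity>" by (simp add: eM)
    have U: "{x<..} = (\<Union>n. {x<..x+real n})"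
      using real_arch_simple[of "_ - x"] by (auto simp: le_diff_eq algebra_simps)
    have inc: "incseq (\<lambda>n. {x<..x+real n})" by (auto simp: incseq_def)
    have "emeasure M {x<..} = (SUP n. emeasure M {x<..x+real n})"
      unfolding U by (rule SUP_emeasure_incseq[symmetric]) (use inc in auto)
    also have "\<dots> = (SUP n. emeasure N {x<..x+real n})" by (simp add: NM)
    also have "\<dots> = emeasure N {x<..}" unfolding U by (rule SUP_emeasure_incseq) (use inc in auto)
    finally show "emeasure M {x<..} = emeasure N {x<..}" .
  qed auto
  have le: "emeasure \<nu>1 A \<le> emeasure M A" if "A \<in> sets borel" for A
    using eN[OF that] \<open>M = N\<close> by simp
  have ac: "absolutely_continuous lborel \<nu>1"
  proof -
    have "absolutely_continuous lborel M" unfolding M_def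
      by (intro absolutely_continuousI_density) auto
    thus ?thesis using le unfolding absolutely_continuous_def null_sets_def
      by (auto simp: subset_iff) (metis le le_zero_eq)
  qed
  obtain h where h[measurable]: "h \<in> borel_measurable lborel" and dh: "density lborel h = \<nu>1"
    using sigma_finite_measure.Radon_Nikodym[OF sigma_finite_lborel ac] by auto
  have fin: "(\<integral>\<^sup>+ x. h x \<partial>lborel) < \<infinity>"
  proof -
    have "(\<integral>\<^sup>+ x. h x \<partial>lborel) = emeasure (density lborel h) UNIV" by (subst emeasure_density) auto
    also have "\<dots> \<le> emeasure M UNIV" unfolding dh by (rule le) auto
    also have "\<dots> < \<infinity>" by (simp add: eM)
    finally show ?thesis .
  qed
  have hae: "AE x in lborel. h x = ennreal (enn2real (h x))"
    using nn_integral_PInf_AE[OF h] fin by (auto simp: less_top[symmetric])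
  define g0 where "g0 x = enn2real (h x)" for x
  have [measurable]: "g0 \<in> borel_measurable lborel" unfolding g0_def[abs_def] by measurable
  have g0i: "integrable lborel g0"
  proof (rule integrableI_nonneg)
    have "(\<integral>\<^sup>+ x. ennreal (g0 x) \<partial>lborel) = (\<integral>\<^sup>+ x. h x \<partial>lborel)"
      using hae by (intro nn_integral_cong_AE) (auto simp: g0_def)
    thus "(\<integral>\<^sup>+ x. ennreal (g0 x) \<partial>lborel) < \<infinity>" using fin by simp
  qed (auto simp: g0_def)
  have G1i: "G1 b - G1 a = (LINT r:{a..b}|lborel. g0 r)" if "a \<le> b" for a b
  proof -
    have "ennreal (G1 b - G1 a) = emeasure (density lborel h) {a<..b}" using e1[OF that] dh by simp
    also have "\<dots> = (\<integral>\<^sup>+ x. h x * indicator {a<..b} x \<partial>lborel)" by (subst emeasure_density) auto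
    also have "\<dots> = (\<integral>\<^sup>+ x. ennreal (indicator {a<..b} x * g0 x) \<partial>lborel)"
      using hae by (intro nn_integral_cong_AE) (auto simp: g0_def indicator_def)
    also have "\<dots> = ennreal (LINT r:{a<..b}|lborel. g0 r)"
      unfolding set_lebesgue_integral_def using si[OF _ g0i, of "{a<..b}"]
      by (subst nn_integral_eq_integral) (auto simp: set_integrable_def g0_def)
    finally have "G1 b - G1 a = (LINT r:{a<..b}|lborel. g0 r)"
      using G1[OF that] by (subst (asm) ennreal_inj) (auto simp: g0_def set_lebesgue_integral_def intro!: Bochner_Integration.integral_nonneg)
    thus ?thesis using set_integral_Ioc_Icc[OF si[OF _ g0i], of a b] by simp
  qed
  show ?thesis
  proof (intro exI[of _ "\<lambda>x. g0 x - m x"] conjI allI impI)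
    show "integrable lborel (\<lambda>x. g0 x - m x)" using g0i m by auto
    fix s t :: real assume "s \<le> t"
    show "f t - f s = (LINT r:{s..t}|lborel. g0 r - m r)"
      using G1i[OF \<open>s \<le> t\<close>] F[OF \<open>s \<le> t\<close>]
      by (subst set_integral_diff) (auto intro!: si g0i m simp: G1_def)
  qed
qed

section \<open>The metric speed of an absolutely continuous curve\<close>

text \<open>The curve is observed through the countably many real functions
  \<open>t \<mapsto> dist (w q) (w t)\<close> with \<open>q\<close> rational. Each is 1-Lipschitz along \<open>w\<close>, hence has a density \<open>G\<^sub>q\<close>.
  The speed is \<open>sup\<^sub>q \<bar>G\<^sub>q\<bar>\<close>: single densities bound the difference quotient of \<open>w\<close> from below, and
  letting \<open>w q\<close> tend to \<open>w s\<close> bounds \<open>dist (w s) (w t)\<close> by the integral of the supremum, so that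
  Lebesgue's theorem bounds the quotient from above.\<close>
lemma metric_speed_of_dominated_curve:
  fixes w :: "real \<Rightarrow> 'a::metric_space"
  assumes m: "integrable lborel m" and m0: "\<And>x. 0 \<le> m x"
    and w: "\<And>s t. s \<le> t \<Longrightarrow> dist (w s) (w t) \<le> (LINT r:{s..t}|lborel. m r)"
  shows "\<exists>g. integrable lborel g \<and> (\<forall>x. 0 \<le> g x \<and> g x \<le> m x) \<and>
    (\<forall>s t. s \<le> t \<longrightarrow> dist (w s) (w t) \<le> (LINT r:{s..t}|lborel. g r)) \<and>
    (AE t in lborel. ((\<lambda>s. dist (w s) (w t) / \<bar>t - s\<bar>) \<longlongrightarrow> g t) (at t))"
proof -
  note si = set_integrable_of_integrable
  have mm [measurable]: "m \<in> borel_measurable borel" using borel_measurable_integrable[OF m] by simp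
  define F where "F t = (LINT r:{..t}|lborel. m r)" for t
  have wF: "dist (w s) (w t) \<le> \<bar>F s - F t\<bar>" for s t
    using w[of s t] w[of t s] cumulative_integral_diff[OF m, of s t] cumulative_integral_diff[OF m, of t s]
    by (cases "s \<le> t") (auto simp: F_def dist_commute)
  define q :: "nat \<Rightarrow> real" where "q n = of_rat (from_nat n)" for n
  define f where "f n t = dist (w (q n)) (w t)" for n t
  have fw: "\<bar>f n t - f n s\<bar> \<le> dist (w s) (w t)" for n s t
    unfolding f_def using dist_triangle[of "w (q n)" "w t" "w s"] dist_triangle[of "w (q n)" "w s" "w t"]
    by (simp add: dist_commute)
  have "\<exists>g. integrable lborel g \<and> (\<forall>s t. s \<le> t \<longrightarrow> f n t - f n s = (LINT r:{s..t}|lborel. g r))" for n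
    by (rule dominated_increments_have_density[OF m m0]) (use fw w order_trans in blast)
  then obtain G where G: "\<And>n. integrable lborel (G n)"
     and fG: "\<And>n s t. s \<le> t \<Longrightarrow> f n t - f n s = (LINT r:{s..t}|lborel. G n r)" by metis
  have [measurable]: "G n \<in> borel_measurable borel" for n using borel_measurable_integrable[OF G[of n]] by simp
  have fG': "\<bar>LINT r:{min s t..max s t}|lborel. G n r\<bar> = \<bar>f n s - f n t\<bar>" for n s t
    using fG[of s t n] fG[of t s n] by (cases "s \<le> t") (auto simp: min_def max_def)
  have wm: "dist (w s) (w t) \<le> (LINT r:{min s t..max s t}|lborel. m r)" for s t
    using w[of s t] w[of t s] by (cases "s \<le> t") (auto simp: min_def max_def dist_commute)
  have pos: "\<forall>\<^sub>F s in at t. 0 < \<bar>t - s\<bar>" for t :: real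
    by (auto simp: eventually_at intro: exI[of _ 1])
  have LG: "AE t in lborel. \<forall>n. ((\<lambda>s. (LINT r:{min s t..max s t}|lborel. G n r) / \<bar>t - s\<bar>) \<longlongrightarrow> G n t) (at t)"
    unfolding AE_all_countable by (intro allI lebesgue_differentiation G)
  have Gm: "AE t in lborel. \<forall>n. \<bar>G n t\<bar> \<le> m t"
    using LG lebesgue_differentiation[OF m]
  proof eventually_elim
    case (elim t)
    show ?case
    proof
      fix n
      show "\<bar>G n t\<bar> \<le> m t"
      proof (rule tendsto_le[OF _ elim(2)])
        show "((\<lambda>s. \<bar>(LINT r:{min s t..max s t}|lborel. G n r) / \<bar>t - s\<bar>\<bar>) \<longlongrightarrow> \<bar>G n t\<bar>) (at t)"
          using elim(1) by (intro tendsto_intros) auto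
        show "\<forall>\<^sub>F s in at t. \<bar>(LINT r:{min s t..max s t}|lborel. G n r) / \<bar>t - s\<bar>\<bar> \<le> (LINT r:{min s t..max s t}|lborel. m r) / \<bar>t - s\<bar>"
        proof (rule always_eventually, rule allI)
          fix s
          show "\<bar>(LINT r:{min s t..max s t}|lborel. G n r) / \<bar>t - s\<bar>\<bar> \<le> (LINT r:{min s t..max s t}|lborel. m r) / \<bar>t - s\<bar>"
            unfolding abs_divide fG' using fw[of n s t] wm[of s t] by (auto intro!: divide_right_mono simp: dist_commute)
        qed
      qed simp
    qed
  qed
  \<comment> \<open>truncation by \<open>m\<close> changes nothing almost everywhere and keeps the supremum finite everywhere\<close>
  define g where "g t = (SUP n. min \<bar>G n t\<bar> (m t))" for t
  have bdd: "bdd_above (range (\<lambda>n. min \<bar>G n t\<bar> (m t)))" for t by (intro bdd_aboveI[of _ "m t"]) auto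
  have g0: "0 \<le> g t" for t
    unfolding g_def by (rule cSUP_upper2[OF bdd, of 0]) (use m0[of t] in auto)
  have gm: "g t \<le> m t" for t unfolding g_def by (rule cSUP_least) auto
  have [measurable]: "g \<in> borel_measurable borel"
    unfolding g_def[abs_def] by (rule borel_measurable_cSUP) (use bdd in auto)
  have gi: "integrable lborel g"
    by (rule Bochner_Integration.integrable_bound[OF m]) (use g0 gm m0 in \<open>auto simp: abs_of_nonneg\<close>)
  have Gg: "AE t in lborel. \<forall>n. \<bar>G n t\<bar> \<le> g t"
    using Gm
  proof eventually_elim
    case (elim t)
    show ?case
    proof
      fix n have "min \<bar>G n t\<bar> (m t) \<le> g t" unfolding g_def by (rule cSUP_upper[OF _ bdd]) auto
      thus "\<bar>G n t\<bar> \<le> g t" using elim by (simp add: min_absorb1)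
    qed
  qed
  have wg: "dist (w s) (w t) \<le> (LINT r:{s..t}|lborel. g r)" if st: "s \<le> t" for s t
  proof (rule field_le_epsilon)
    fix e :: real assume "0 < e"
    have "isCont F s" unfolding F_def[abs_def] by (rule isCont_cumulative_integral[OF m])
    then obtain d where d: "d > 0" "\<And>x. \<bar>x - s\<bar> < d \<Longrightarrow> \<bar>F x - F s\<bar> < e / 2"
      unfolding continuous_at_eps_delta using \<open>0 < e\<close> by (metis dist_real_def half_gt_zero)
    \<comment> \<open>a rational time close to \<open>s\<close>, from which \<open>w\<close> is observed\<close>
    obtain x where x: "x \<in> \<rat>" "s - d < x" "x < s" using Rats_dense_in_real[of "s - d" s] d by auto
    then obtain r where "x = of_rat r" by (auto simp: Rats_def)
    then obtain n where n: "x = q n" unfolding q_def by (metis from_nat_to_nat)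
    have "dist (w (q n)) (w s) < e / 2" using wF[of "q n" s] d(2)[of "q n"] x n by auto
    moreover have "dist (w s) (w t) \<le> dist (w (q n)) (w s) + dist (w (q n)) (w t)"
      using dist_triangle2[of "w s" "w t" "w (q n)"] by (simp add: dist_commute)
    moreover have "f n t - f n s \<le> (LINT r:{s..t}|lborel. g r)"
      unfolding fG[OF st]
    proof (rule set_integral_mono_AE[OF si si])
      show "AE r\<in>{s..t} in lborel. G n r \<le> g r"
        using Gg by eventually_elim (use abs_le_D1 in blast)
    qed (use G gi in auto)
    ultimately show "dist (w s) (w t) \<le> (LINT r:{s..t}|lborel. g r) + e"
      by (simp add: f_def)
  qed
  have lim: "AE t in lborel. ((\<lambda>s. dist (w s) (w t) / \<bar>t - s\<bar>) \<longlongrightarrow> g t) (at t)"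
    using LG Gm lebesgue_differentiation[OF gi]
  proof eventually_elim
    case (elim t)
    show ?case
    proof (rule order_tendstoI)
      fix a assume "a < g t"
      then obtain n where "a < min \<bar>G n t\<bar> (m t)" unfolding g_def using less_cSUP_iff[OF _ bdd] by auto
      hence a: "a < \<bar>G n t\<bar>" by simp
      have "((\<lambda>s. \<bar>(LINT r:{min s t..max s t}|lborel. G n r) / \<bar>t - s\<bar>\<bar>) \<longlongrightarrow> \<bar>G n t\<bar>) (at t)"
        using elim(1) by (intro tendsto_intros) auto
      from order_tendstoD(1)[OF this a]
      show "\<forall>\<^sub>F s in at t. a < dist (w s) (w t) / \<bar>t - s\<bar>"
      proof eventually_elim
        case (elim s)
        also have "\<bar>(LINT r:{min s t..max s t}|lborel. G n r) / \<bar>t - s\<bar>\<bar> \<le> dist (w s) (w t) / \<bar>t - s\<bar>"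
          unfolding abs_divide fG' using fw[of n s t] by (auto intro!: divide_right_mono simp: dist_commute)
        finally show ?case .
      qed
    next
      fix a assume "g t < a"
      from order_tendstoD(2)[OF elim(3) this]
      show "\<forall>\<^sub>F s in at t. dist (w s) (w t) / \<bar>t - s\<bar> < a"
      proof eventually_elim
        case (elim s)
        have "dist (w s) (w t) \<le> (LINT r:{min s t..max s t}|lborel. g r)"
          using wg[of s t] wg[of t s] by (cases "s \<le> t") (auto simp: min_def max_def dist_commute)
        hence "dist (w s) (w t) / \<bar>t - s\<bar> \<le> (LINT r:{min s t..max s t}|lborel. g r) / \<bar>t - s\<bar>"
          by (intro divide_right_mono) auto
        thus ?case using elim by simp
      qed
    qed
  qed
  show ?thesis using gi g0 gm wg lim by blast
qed

text \<open>A version \<open>D\<close> of the metric derivative of \<open>u\<close> that is Borel and nonnegative everywhere, together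
  with the properties of the curve that depend on it.\<close>
definition metric_speed :: "(real \<Rightarrow> 'a::metric_space) \<Rightarrow> (real \<Rightarrow> real) \<Rightarrow> bool" where
  "metric_speed u D \<longleftrightarrow> D \<in> borel_measurable borel \<and> (\<forall>t. 0 \<le> D t) \<and>
    (\<forall>R. set_integrable lborel {0..R} (\<lambda>t. (D t)\<^sup>2)) \<and>
    (\<forall>s t. 0 \<le> s \<longrightarrow> s \<le> t \<longrightarrow> dist (u s) (u t) \<le> (LINT r:{s..t}|lborel. D r)) \<and>
    (AE t in lborel. 0 < t \<longrightarrow> ((\<lambda>s. dist (u s) (u t) / \<bar>t - s\<bar>) \<longlongrightarrow> D t) (at t))"

lemma metric_speedD:
  assumes "metric_speed u D"
  shows "D \<in> borel_measurable borel" "\<And>t. 0 \<le> D t" "\<And>R. set_integrable lborel {0..R} (\<lambda>t. (D t)\<^sup>2)"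
    "\<And>s t. 0 \<le> s \<Longrightarrow> s \<le> t \<Longrightarrow> dist (u s) (u t) \<le> (LINT r:{s..t}|lborel. D r)"
    "AE t in lborel. 0 < t \<longrightarrow> ((\<lambda>s. dist (u s) (u t) / \<bar>t - s\<bar>) \<longlongrightarrow> D t) (at t)"
  using assms unfolding metric_speed_def by auto

text \<open>On each \<open>[0,N]\<close> the previous construction applies to the curve stopped outside that interval.
  The speeds for different \<open>N\<close> are limits of the same difference quotients, so they agree almost
  everywhere and can be glued along the unit intervals.\<close>
lemma AC_loc_metric_speed:
  fixes u :: "real \<Rightarrow> 'a::metric_space"
  assumes u: "AC_loc 2 {0..} u"
  shows "\<exists>D. metric_speed u D"
proof -
  define w where "w N t = u (max 0 (min (real N) t))" for N :: nat and t
  define good where "good N g \<longleftrightarrow> g \<in> borel_measurable borel \<and> integrable lborel g \<and> (\<forall>x. 0 \<le> g x) \<and> integrable lborel (\<lambda>x. (g x)\<^sup>2) \<and>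
    (\<forall>s t. s \<le> t \<longrightarrow> dist (w N s) (w N t) \<le> (LINT r:{s..t}|lborel. g r)) \<and>
    (AE t in lborel. ((\<lambda>s. dist (w N s) (w N t) / \<bar>t - s\<bar>) \<longlongrightarrow> g t) (at t))" for N g
  have ex: "\<exists>g. good N g" for N
  proof -
    have "AC 2 {0..real N} u" using u by (auto simp: AC_loc_def)
    then obtain m where m: "Lp_on 2 {0..real N} m" and
      um: "\<And>s t. \<lbrakk>0 \<le> s; s \<le> t; t \<le> real N\<rbrakk> \<Longrightarrow> dist (u s) (u t) \<le> (LINT r:{s..t}|lborel. m r)"
      unfolding AC_def by auto
    define m' where "m' x = indicator {0..real N} x * \<bar>m x\<bar>" for x
    have meas: "(\<lambda>x. indicator {0..real N} x * m x) \<in> borel_measurable borel"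
      using m by (simp add: Lp_on_def set_borel_measurable_def)
    have m'eq: "m' = (\<lambda>x. \<bar>indicator {0..real N} x * m x\<bar>)" by (auto simp: m'_def indicator_def)
    have mm[measurable]: "m' \<in> borel_measurable borel" unfolding m'eq using meas by measurable
    have m'2: "integrable lborel (\<lambda>x. (m' x)\<^sup>2)"
    proof -
      have "integrable lborel (\<lambda>r. indicator {0..real N} r *\<^sub>R (\<bar>m r\<bar> powr 2))"
        using m by (simp add: Lp_on_def set_integrable_def)
      also have "(\<lambda>r. indicator {0..real N} r *\<^sub>R (\<bar>m r\<bar> powr 2)) = (\<lambda>x. (m' x)\<^sup>2)"
        by (auto simp: m'_def indicator_def fun_eq_iff)
      finally show ?thesis .
    qed
    have m'i: "integrable lborel m'"
    proof (rule Bochner_Integration.integrable_bound)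
      show "integrable lborel (\<lambda>x. indicator {0..real N} x + (m' x)\<^sup>2)"
        by (intro Bochner_Integration.integrable_add m'2) (auto simp: integrable_real_indicator)
      show "AE x in lborel. norm (m' x) \<le> norm (indicator {0..real N} x + (m' x)\<^sup>2)"
      proof (rule AE_I2)
        fix x :: real
        have "0 \<le> (\<bar>m x\<bar> - 1)\<^sup>2" by simp
        hence "\<bar>m x\<bar> \<le> 1 + \<bar>m x\<bar>\<^sup>2" by (simp add: power2_diff)
        then show "norm (m' x) \<le> norm (indicator {0..real N} x + (m' x)\<^sup>2)"
          by (simp add: m'_def indicator_def)
      qed
    qed simp
    have m'0: "0 \<le> m' x" for x by (simp add: m'_def)
    have wm: "dist (w N s) (w N t) \<le> (LINT r:{s..t}|lborel. m' r)" if "s \<le> t" for s t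
    proof -
      define s' t' where "s' = max 0 (min (real N) s)" and "t' = max 0 (min (real N) t)"
      have st': "0 \<le> s'" "s' \<le> t'" "t' \<le> real N" using that by (auto simp: s'_def t'_def)
      have "dist (w N s) (w N t) \<le> (LINT r:{s'..t'}|lborel. m r)"
        unfolding w_def using um[OF st'] by (simp add: s'_def t'_def)
      also have "\<dots> \<le> (LINT r:{s'..t'}|lborel. m' r)"
      proof -
        have "integrable lborel (\<lambda>x. indicator {0..real N} x * m x)"
          by (rule Bochner_Integration.integrable_bound[OF m'i]) (use meas in \<open>auto simp: m'eq\<close>)
        from integrable_mult_indicator[OF _ this, of "{s'..t'}"]
        have "set_integrable lborel {s'..t'} m" unfolding set_integrable_def
          by (rule Bochner_Integration.integrable_cong[THEN iffD1, rotated -1]) (use st' in \<open>auto simp: indicator_def\<close>)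
        thus ?thesis
          by (intro set_integral_mono set_integrable_of_integrable[OF _ m'i]) (use st' in \<open>auto simp: m'_def\<close>)
      qed
      also have "\<dots> = (LINT r:{s..t}|lborel. m' r)"
      proof -
        have *: "AE x in lborel. x \<noteq> 0 \<and> x \<noteq> real N"
          using AE_lborel_singleton[of 0] AE_lborel_singleton[of "real N"] by eventually_elim auto
        show ?thesis unfolding set_lebesgue_integral_def
        proof (rule Bochner_Integration.integral_cong_AE)
          show "AE x in lborel. indicat_real {s'..t'} x *\<^sub>R m' x = indicat_real {s..t} x *\<^sub>R m' x"
            using *
          proof eventually_elim
            case (elim x)
            show ?case
            proof (cases "0 \<le> x \<and> x \<le> real N")
              case True
              hence "(x \<in> {s'..t'}) = (x \<in> {s..t})" using elim by (auto simp: s'_def t'_def)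
              thus ?thesis by (simp add: indicator_def)
            next
              case False
              hence "m' x = 0" by (simp add: m'_def)
              thus ?thesis by simp
            qed
          qed
        qed measurable
      qed
      finally show ?thesis .
    qed
    obtain g where g: "integrable lborel g" "\<And>x. 0 \<le> g x \<and> g x \<le> m' x"
      "\<And>s t. s \<le> t \<Longrightarrow> dist (w N s) (w N t) \<le> (LINT r:{s..t}|lborel. g r)"
      "AE t in lborel. ((\<lambda>s. dist (w N s) (w N t) / \<bar>t - s\<bar>) \<longlongrightarrow> g t) (at t)"
    proof -
      have "\<exists>g. integrable lborel g \<and> (\<forall>x. 0 \<le> g x \<and> g x \<le> m' x) \<and>
        (\<forall>s t. s \<le> t \<longrightarrow> dist (w N s) (w N t) \<le> (LINT r:{s..t}|lborel. g r)) \<and>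
        (AE t in lborel. ((\<lambda>s. dist (w N s) (w N t) / \<bar>t - s\<bar>) \<longlongrightarrow> g t) (at t))"
        by (rule metric_speed_of_dominated_curve[OF m'i m'0]) (rule wm)
      thus ?thesis by (elim exE conjE) (rule that, auto)
    qed
    have gb: "g \<in> borel_measurable borel" using borel_measurable_integrable[OF g(1)] by simp
    have "integrable lborel (\<lambda>x. (g x)\<^sup>2)"
      by (rule Bochner_Integration.integrable_bound[OF m'2]) (use g(2) gb in \<open>auto intro!: power_mono\<close>)
    thus ?thesis unfolding good_def using g gb by (intro exI[of _ g] conjI allI impI) auto
  qed
  obtain g where "\<And>N. good N (g N)" using ex by metis
  note gg = this[unfolded good_def]
  note gg2 = gg[THEN conjunct2] note gg3 = gg2[THEN conjunct2] note gg4 = gg3[THEN conjunct2] note gg5 = gg4[THEN conjunct2]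
  note g = gg[THEN conjunct1] gg2[THEN conjunct1] gg3[THEN conjunct1, rule_format] gg4[THEN conjunct1]
    gg5[THEN conjunct1, rule_format] gg5[THEN conjunct2]
  \<comment> \<open>for \<open>t > 0\<close> the index is an integer strictly larger than \<open>t\<close>\<close>
  define D where "D t = g (nat \<lfloor>t\<rfloor> + 1) t" for t
  have D[measurable]: "D \<in> borel_measurable borel"
    unfolding D_def[abs_def]
    by (rule measurable_compose_countable[where g="\<lambda>t. nat \<lfloor>t\<rfloor> + 1" and f="\<lambda>N t. g N t"]) (use g(1) in measurable)
  have D0: "0 \<le> D t" for t by (simp add: D_def g)
  have lim: "AE t in lborel. \<forall>N. 0 < t \<and> t < real N \<longrightarrow> ((\<lambda>s. dist (u s) (u t) / \<bar>t - s\<bar>) \<longlongrightarrow> g N t) (at t)"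
    unfolding AE_all_countable
  proof
    fix N
    show "AE t in lborel. 0 < t \<and> t < real N \<longrightarrow> ((\<lambda>s. dist (u s) (u t) / \<bar>t - s\<bar>) \<longlongrightarrow> g N t) (at t)"
      using g(6)[of N]
    proof eventually_elim
      case (elim t)
      show ?case
      proof (intro impI)
        assume t: "0 < t \<and> t < real N"
        have "\<forall>\<^sub>F s in at t. s \<in> {0<..<real N}" using t
          by (intro eventually_at_in_open') auto
        hence "\<forall>\<^sub>F s in at t. dist (w N s) (w N t) / \<bar>t - s\<bar> = dist (u s) (u t) / \<bar>t - s\<bar>"
          by eventually_elim (use t in \<open>auto simp: w_def\<close>)
        from Lim_transform_eventually[OF elim this]
        show "((\<lambda>s. dist (u s) (u t) / \<bar>t - s\<bar>) \<longlongrightarrow> g N t) (at t)" .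
      qed
    qed
  qed
  have limD: "AE t in lborel. 0 < t \<longrightarrow> ((\<lambda>s. dist (u s) (u t) / \<bar>t - s\<bar>) \<longlongrightarrow> D t) (at t)"
    using lim
  proof eventually_elim
    case (elim t)
    have "t < real (nat \<lfloor>t\<rfloor> + 1)" if "0 < t" using that by linarith
    thus ?case using elim unfolding D_def by (intro impI) (drule spec, erule mp, simp)
  qed
  have Dg: "AE t in lborel. \<forall>N. 0 < t \<and> t < real N \<longrightarrow> D t = g N t"
    using lim limD
  proof eventually_elim
    case (elim t)
    show ?case
    proof (intro allI impI)
      fix N assume "0 < t \<and> t < real N"
      with elim have "((\<lambda>s. dist (u s) (u t) / \<bar>t - s\<bar>) \<longlongrightarrow> D t) (at t)"
        "((\<lambda>s. dist (u s) (u t) / \<bar>t - s\<bar>) \<longlongrightarrow> g N t) (at t)" by auto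
      thus "D t = g N t" by (rule LIM_unique)
    qed
  qed
  have Dg': "AE t in lborel. \<forall>N. 0 \<le> t \<and> t < real N \<longrightarrow> D t = g N t"
    using Dg AE_lborel_singleton[of 0] by eventually_elim auto
  have sq: "set_integrable lborel {0..R} (\<lambda>t. (D t)\<^sup>2)" for R
  proof -
    obtain N where N: "R < real N" using reals_Archimedean2 by blast
    show ?thesis
    proof (rule set_integrable_cong_AE[THEN iffD1])
      show "set_integrable lborel {0..R} (\<lambda>t. (g N t)\<^sup>2)" by (rule set_integrable_of_integrable[OF _ g(4)]) auto
      show "AE x\<in>{0..R} in lborel. (g N x)\<^sup>2 = (D x)\<^sup>2" using Dg' by eventually_elim (use N in \<open>auto dest!: spec[of _ N]\<close>)
    qed (use g(1) in measurable)
  qed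
  have "dist (u s) (u t) \<le> (LINT r:{s..t}|lborel. D r)" if st: "0 \<le> s" "s \<le> t" for s t
  proof -
    obtain N where N: "t < real N" using reals_Archimedean2 by blast
    have "dist (u s) (u t) = dist (w N s) (w N t)" using st N by (simp add: w_def)
    also have "\<dots> \<le> (LINT r:{s..t}|lborel. g N r)" by (rule g(5)[OF st(2)])
    also have "\<dots> = (LINT r:{s..t}|lborel. D r)"
    proof (rule set_lebesgue_integral_cong_AE)
      show "AE x\<in>{s..t} in lborel. g N x = D x" using Dg' by eventually_elim (use st N in \<open>auto dest!: spec[of _ N]\<close>)
    qed (use g(1) in measurable)
    finally show ?thesis .
  qed
  thus ?thesis unfolding metric_speed_def using D D0 sq limD by blast
qed

lemma metric_speed_AC_loc:
  assumes "metric_speed u D"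
  shows "AC_loc 2 {0..} u"
  unfolding AC_loc_def
proof (intro allI impI)
  fix a b :: real assume ab: "a \<le> b \<and> {a..b} \<subseteq> {0..}"
  note D = metric_speedD[OF assms]
  have "set_integrable lborel {a..b} (\<lambda>t. (D t)\<^sup>2)"
    by (rule set_integrable_subset[OF D(3)[of b]]) (use ab in auto)
  thus "AC 2 {a..b} u"
    unfolding AC_def Lp_on_def using D(1,2,4) ab
    by (intro exI[of _ D]) (auto simp: set_borel_measurable_def)
qed

lemma metric_speed_deriv:
  assumes "metric_speed u D"
  shows "AE t in lborel. 0 < t \<longrightarrow> metric_deriv u t = D t"
  using metric_speedD(5)[OF assms]
  by eventually_elim (auto simp: metric_deriv_def intro!: tendsto_Lim)

lemma metric_speed_continuous:
  fixes u :: "real \<Rightarrow> 'a::metric_space"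
  assumes u: "metric_speed u D"
  shows "continuous_on UNIV (\<lambda>t. u (max 0 t))"
proof -
  note D = metric_speedD[OF u]
  have Di: "set_integrable lborel {0..R} D" for R
  proof -
    have "integrable lborel (\<lambda>x. indicator {0..R} x + indicator {0..R} x * (D x)\<^sup>2)"
      using D(3)[of R] by (intro Bochner_Integration.integrable_add integrable_real_indicator) (auto simp: set_integrable_def emeasure_lborel_Icc_eq)
    thus ?thesis unfolding set_integrable_def
    proof (rule Bochner_Integration.integrable_bound)
      show "AE x in lborel. norm (indicat_real {0..R} x *\<^sub>R D x) \<le> norm (indicator {0..R} x + indicator {0..R} x * (D x)\<^sup>2)"
      proof (rule AE_I2)
        fix x :: real
        have "0 \<le> (D x - 1)\<^sup>2" by simp
        hence "D x \<le> 1 + (D x)\<^sup>2" using D(2)[of x] by (simp add: power2_diff)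
        thus "norm (indicat_real {0..R} x *\<^sub>R D x) \<le> norm (indicator {0..R} x + indicator {0..R} x * (D x)\<^sup>2)"
          using D(2)[of x] by (simp add: indicator_def)
      qed
    qed (use D(1) in measurable)
  qed
  have "isCont (\<lambda>t. u (max 0 t)) a" for a
  proof -
    define R where "R = max 0 a + 1"
    define m where "m x = indicator {0..R} x * D x" for x
    have mi: "integrable lborel m" using Di[of R] by (simp add: m_def[abs_def] set_integrable_def)
    define F where "F t = (LINT r:{..t}|lborel. m r)" for t
    have Fc: "isCont F x" for x unfolding F_def[abs_def] by (rule isCont_cumulative_integral[OF mi])
    have le: "dist (u s) (u t) \<le> F t - F s" if "0 \<le> s" "s \<le> t" "t \<le> R" for s t
    proof -
      have "dist (u s) (u t) \<le> (LINT r:{s..t}|lborel. D r)" by (rule D(4)) (use that in auto)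
      also have "\<dots> = (LINT r:{s..t}|lborel. m r)"
        unfolding set_lebesgue_integral_def m_def
        by (intro Bochner_Integration.integral_cong) (use that in \<open>auto simp: indicator_def\<close>)
      also have "\<dots> = F t - F s" unfolding F_def by (rule cumulative_integral_diff[OF mi that(2), symmetric])
      finally show ?thesis .
    qed
    have bd: "dist (u (max 0 x)) (u (max 0 a)) \<le> \<bar>F (max 0 x) - F (max 0 a)\<bar>" if "x < a + 1" for x
    proof (cases "max 0 x \<le> max 0 a")
      case True
      have "dist (u (max 0 x)) (u (max 0 a)) \<le> F (max 0 a) - F (max 0 x)" by (rule le) (use True in \<open>auto simp: R_def\<close>)
      thus ?thesis by simp
    next
      case False
      have "dist (u (max 0 a)) (u (max 0 x)) \<le> F (max 0 x) - F (max 0 a)" by (rule le) (use False that in \<open>auto simp: R_def\<close>)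
      thus ?thesis by (simp add: dist_commute)
    qed
    have "isCont (\<lambda>x. F (max 0 x)) a" by (rule isCont_o2[OF _ Fc]) (intro continuous_intros)
    hence "((\<lambda>x. F (max 0 x) - F (max 0 a)) \<longlongrightarrow> 0) (at a)" by (simp add: isCont_def LIM_zero)
    hence F0: "((\<lambda>x. \<bar>F (max 0 x) - F (max 0 a)\<bar>) \<longlongrightarrow> 0) (at a)" by (rule tendsto_rabs_zero)
    have "\<forall>\<^sub>F x in at a. x < a + 1" by (auto simp: eventually_at dist_real_def intro!: exI[of _ 1])
    hence ev: "\<forall>\<^sub>F x in at a. norm (dist (u (max 0 x)) (u (max 0 a))) \<le> \<bar>F (max 0 x) - F (max 0 a)\<bar>"
      by eventually_elim (use bd in simp)
    have "((\<lambda>x. dist (u (max 0 x)) (u (max 0 a))) \<longlongrightarrow> 0) (at a)"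
      by (rule Lim_null_comparison[OF ev F0])
    thus ?thesis by (simp add: isCont_def tendsto_dist_iff[symmetric])
  qed
  thus ?thesis by (simp add: continuous_at_imp_continuous_on)
qed

section \<open>Borel measurability of the metric derivative\<close>

lemma metric_deriv_cong:
  assumes "open U" "t \<in> U" "\<And>s. s \<in> U \<Longrightarrow> u s = v s"
  shows "metric_deriv u t = metric_deriv v t"
proof -
  have ev: "\<forall>\<^sub>F s in at t. dist (u s) (u t) / \<bar>t - s\<bar> = dist (v s) (v t) / \<bar>t - s\<bar>"
    using eventually_at_in_open'[OF assms(1,2)] by eventually_elim (use assms in auto)
  have "((\<lambda>s. dist (u s) (u t) / \<bar>t - s\<bar>) \<longlongrightarrow> l) (at t) \<longleftrightarrow> ((\<lambda>s. dist (v s) (v t) / \<bar>t - s\<bar>) \<longlongrightarrow> l) (at t)" for l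
    by (rule filterlim_cong[OF refl refl ev])
  thus ?thesis unfolding metric_deriv_def Topological_Spaces.Lim_def by simp
qed

text \<open>Integrability with respect to \<open>lborel\<close> asks for Borel measurability, which almost everywhere
  equality with a Borel function does not give. Where the difference quotients converge, the limit is
  the limit along the increments \<open>1 / (n + 1)\<close>; elsewhere \<open>Lim\<close> is one fixed unspecified number. The set of
  convergence is Borel because the Cauchy condition at a given scale is a closed condition on \<open>t\<close>.\<close>
lemma metric_deriv_borel:
  fixes w :: "real \<Rightarrow> 'a::metric_space"
  assumes w: "continuous_on UNIV w"
  shows "metric_deriv w \<in> borel_measurable borel"
proof -
  define q where "q h t = dist (w (t + h)) (w t) / \<bar>h\<bar>" for h t
  have qc: "continuous_on UNIV (q h)" for h
  proof (cases "h = 0")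
    case False
    thus ?thesis unfolding q_def[abs_def] by (intro continuous_intros continuous_on_compose2[OF w]) auto
  qed (simp add: q_def[abs_def])
  have [measurable]: "q h \<in> borel_measurable borel" for h by (rule borel_measurable_continuous_onI[OF qc])
  \<comment> \<open>the Cauchy condition: increments below \<open>1 / (n + 1)\<close>, tolerance \<open>1 / (k + 1)\<close>\<close>
  define C where "C n k = {t. \<forall>h h'. 0 < \<bar>h\<bar> \<and> \<bar>h\<bar> < 1 / real (Suc n) \<and> 0 < \<bar>h'\<bar> \<and> \<bar>h'\<bar> < 1 / real (Suc n)
    \<longrightarrow> \<bar>q h t - q h' t\<bar> \<le> 1 / real (Suc k)}" for n k
  have "closed (C n k)" for n k
  proof -
    have "C n k = (\<Inter>h\<in>{h. 0 < \<bar>h\<bar> \<and> \<bar>h\<bar> < 1 / real (Suc n)}. \<Inter>h'\<in>{h. 0 < \<bar>h\<bar> \<and> \<bar>h\<bar> < 1 / real (Suc n)}.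
       {t. \<bar>q h t - q h' t\<bar> \<le> 1 / real (Suc k)})"
      unfolding C_def by auto
    also have "closed \<dots>"
      by (intro closed_INT ballI closed_Collect_le continuous_intros qc)
    finally show ?thesis .
  qed
  hence Cm[measurable]: "C n k \<in> sets borel" for n k by (rule borel_closed)
  define A where "A = (\<Inter>k. \<Union>n. C n k)"
  have [measurable]: "A \<in> sets borel" unfolding A_def by measurable
  have lim_iff: "((\<lambda>s. dist (w s) (w t) / \<bar>t - s\<bar>) \<longlongrightarrow> l) (at t) \<longleftrightarrow> ((\<lambda>h. q h t) \<longlongrightarrow> l) (at 0)" for l t
  proof -
    have eq: "(\<lambda>h. q h t) = (\<lambda>h. dist (w (t + h)) (w t) / \<bar>t - (t + h)\<bar>)" by (auto simp: q_def)
    show ?thesis unfolding eq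
      using LIM_offset_zero[of "\<lambda>s. dist (w s) (w t) / \<bar>t - s\<bar>" l t]
        LIM_offset_zero_cancel[of "\<lambda>s. dist (w s) (w t) / \<bar>t - s\<bar>" t l] by blast
  qed
  have A: "((\<lambda>h. q h t) \<longlongrightarrow> lim (\<lambda>n. q (1 / real (Suc n)) t)) (at 0)" if "t \<in> A" for t
  proof -
    have ex: "\<exists>n. \<forall>h h'. 0 < \<bar>h\<bar> \<and> \<bar>h\<bar> < 1 / real (Suc n) \<and> 0 < \<bar>h'\<bar> \<and> \<bar>h'\<bar> < 1 / real (Suc n)
      \<longrightarrow> \<bar>q h t - q h' t\<bar> < e" if "0 < e" for e
    proof -
      obtain k where k: "1 / real (Suc k) < e" using nat_approx_posE[OF \<open>0 < e\<close>] by blast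
      obtain n where "t \<in> C n k" using \<open>t \<in> A\<close> by (auto simp: A_def)
      thus ?thesis using k unfolding C_def mem_Collect_eq by (intro exI[of _ n]) (meson order_le_less_trans)
    qed
    have "Cauchy (\<lambda>n. q (1 / real (Suc n)) t)"
    proof (rule metric_CauchyI)
      fix e :: real assume "0 < e"
      obtain n where n: "\<And>h h'. 0 < \<bar>h\<bar> \<and> \<bar>h\<bar> < 1 / real (Suc n) \<and> 0 < \<bar>h'\<bar> \<and> \<bar>h'\<bar> < 1 / real (Suc n)
        \<Longrightarrow> \<bar>q h t - q h' t\<bar> < e" using ex[OF \<open>0 < e\<close>] by blast
      show "\<exists>M. \<forall>m\<ge>M. \<forall>n\<ge>M. dist (q (1 / real (Suc m)) t) (q (1 / real (Suc n)) t) < e"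
      proof (intro exI[of _ "Suc n"] allI impI)
        fix a b assume "Suc n \<le> a" "Suc n \<le> b"
        thus "dist (q (1 / real (Suc a)) t) (q (1 / real (Suc b)) t) < e"
          unfolding dist_real_def by (intro n) (auto simp: field_simps)
      qed
    qed
    hence L: "(\<lambda>n. q (1 / real (Suc n)) t) \<longlonglongrightarrow> lim (\<lambda>n. q (1 / real (Suc n)) t)"
      by (simp add: Cauchy_convergent_iff convergent_LIMSEQ_iff)
    show ?thesis
    proof (rule tendstoI)
      fix e :: real assume "0 < e"
      hence e2: "0 < e / 2" by simp
      obtain n where n: "\<And>h h'. 0 < \<bar>h\<bar> \<and> \<bar>h\<bar> < 1 / real (Suc n) \<and> 0 < \<bar>h'\<bar> \<and> \<bar>h'\<bar> < 1 / real (Suc n)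
        \<Longrightarrow> \<bar>q h t - q h' t\<bar> < e / 2" using ex[OF e2] by blast
      obtain m where m: "\<And>i. m \<le> i \<Longrightarrow> dist (q (1 / real (Suc i)) t) (lim (\<lambda>n. q (1 / real (Suc n)) t)) < e / 2"
        using metric_LIMSEQ_D[OF L e2] by blast
      define i where "i = max m (Suc n)"
      have i: "0 < \<bar>1 / real (Suc i)\<bar>" "\<bar>1 / real (Suc i)\<bar> < 1 / real (Suc n)"
        by (auto simp: i_def field_simps max_def)
      have "\<forall>\<^sub>F h in at 0. 0 < \<bar>h\<bar> \<and> \<bar>h\<bar> < 1 / real (Suc n)"
        unfolding eventually_at by (intro exI[of _ "1 / real (Suc n)"]) (auto simp: dist_real_def)
      thus "\<forall>\<^sub>F h in at 0. dist (q h t) (lim (\<lambda>n. q (1 / real (Suc n)) t)) < e"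
      proof eventually_elim
        case (elim h)
        have "\<bar>q h t - q (1 / real (Suc i)) t\<bar> < e / 2" using n[of h "1 / real (Suc i)"] elim i by blast
        moreover have "dist (q (1 / real (Suc i)) t) (lim (\<lambda>n. q (1 / real (Suc n)) t)) < e / 2" by (rule m) (simp add: i_def)
        ultimately show ?case unfolding dist_real_def by argo
      qed
    qed
  qed
  have nA: "\<not> ((\<lambda>h. q h t) \<longlongrightarrow> l) (at 0)" if "t \<notin> A" for t l
  proof
    assume l: "((\<lambda>h. q h t) \<longlongrightarrow> l) (at 0)"
    have "t \<in> (\<Union>n. C n k)" for k
    proof -
      have "0 < 1 / real (Suc k) / 2" by simp
      from tendstoD[OF l this] obtain d where d: "d > 0" "\<And>h. h \<noteq> 0 \<and> \<bar>h\<bar> < d \<Longrightarrow> \<bar>q h t - l\<bar> < 1 / real (Suc k) / 2"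
        unfolding eventually_at by (auto simp: dist_real_def)
      obtain n where n: "1 / real (Suc n) < d" using nat_approx_posE[OF d(1)] by blast
      have "\<bar>q h t - q h' t\<bar> \<le> 1 / real (Suc k)" if "0 < \<bar>h\<bar> \<and> \<bar>h\<bar> < 1 / real (Suc n) \<and> 0 < \<bar>h'\<bar> \<and> \<bar>h'\<bar> < 1 / real (Suc n)" for h h'
      proof -
        have "h \<noteq> 0 \<and> \<bar>h\<bar> < d" "h' \<noteq> 0 \<and> \<bar>h'\<bar> < d" using that n by linarith+
        hence "\<bar>q h t - l\<bar> < 1 / real (Suc k) / 2" "\<bar>q h' t - l\<bar> < 1 / real (Suc k) / 2"
          by (blast intro: d(2))+
        moreover have "\<bar>x - y\<bar> \<le> e" if "\<bar>x - l\<bar> < e / 2" "\<bar>y - l\<bar> < e / 2" for x y e :: real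
          using that by linarith
        ultimately show ?thesis by blast
      qed
      hence "t \<in> C n k" unfolding C_def by blast
      thus ?thesis by blast
    qed
    thus False using that by (auto simp: A_def)
  qed
  have "metric_deriv w t = (if t \<in> A then lim (\<lambda>n. q (1 / real (Suc n)) t) else (THE l. False))" for t
  proof (cases "t \<in> A")
    case True
    have "metric_deriv w t = lim (\<lambda>n. q (1 / real (Suc n)) t)"
      unfolding metric_deriv_def by (rule tendsto_Lim) (use A[OF True] lim_iff in auto)
    thus ?thesis using True by simp
  next
    case False
    thus ?thesis unfolding metric_deriv_def Topological_Spaces.Lim_def lim_iff using nA by simp
  qed
  hence eq: "metric_deriv w = (\<lambda>t. if t \<in> A then lim (\<lambda>n. q (1 / real (Suc n)) t) else (THE l. False))" by auto
  have [measurable]: "(\<lambda>t. lim (\<lambda>n. q (1 / real (Suc n)) t)) \<in> borel_measurable borel"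
    by (rule borel_measurable_lim_metric) measurable
  show ?thesis unfolding eq by measurable
qed

section \<open>Change of variables and reparametrized curves\<close>

lemma nn_integral_greaterThanLessThan:
  fixes f :: "real \<Rightarrow> ennreal"
  shows "(\<integral>\<^sup>+x. f x * indicator {a<..<b} x \<partial>lborel) = (\<integral>\<^sup>+x. f x * indicator {a..b} x \<partial>lborel)"
proof (rule nn_integral_cong_AE)
  have "AE x in lborel. x \<noteq> a \<and> x \<noteq> b"
    using AE_lborel_singleton[of a] AE_lborel_singleton[of b] by eventually_elim auto
  thus "AE x in lborel. f x * indicator {a<..<b} x = f x * indicator {a..b} x"
    by eventually_elim (auto simp: indicator_def)
qed

text \<open>The change of variables formula as an identity of measures, from which the versions for
  integrals, integrability and null sets all follow. It suffices to compare intervals, where it is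
  the fundamental theorem of calculus.\<close>
lemma distr_density_deriv_eq_lborel:
  fixes h k h' :: "real \<Rightarrow> real"
  assumes h: "\<And>x. (h has_real_derivative h' x) (at x)" and h'pos: "\<And>x. 0 < h' x"
    and h': "continuous_on UNIV h'" and hk: "\<And>y. h (k y) = y" and kh: "\<And>x. k (h x) = x"
  shows "distr (density lborel (\<lambda>x. ennreal (h' x))) borel h = lborel"
proof (rule lborel_eqI[symmetric])
  have mono: "h x < h y \<longleftrightarrow> x < y" for x y
    using DERIV_pos_imp_increasing[of x y h] DERIV_pos_imp_increasing[of y x h] h h'pos
    by (metis linorder_neqE_linordered_idom order_less_asym)
  have [measurable]: "h' \<in> borel_measurable borel" using h' by (rule borel_measurable_continuous_onI)
  have "continuous_on UNIV h" by (intro continuous_at_imp_continuous_on ballI DERIV_isCont[OF h])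
  hence hm[measurable]: "h \<in> borel_measurable borel" by (rule borel_measurable_continuous_onI)
  fix l u :: real assume "\<And>b. b \<in> Basis \<Longrightarrow> l \<bullet> b \<le> u \<bullet> b"
  hence lu: "l \<le> u" by simp
  hence klu: "k l \<le> k u" using mono[of "k u" "k l"] hk by (metis not_le)
  have pre: "h -` {l<..<u} = {k l<..<k u}"
    using mono[of "k l"] mono[of _ "k u"] by (auto simp: hk)
  have "emeasure (distr (density lborel (\<lambda>x. ennreal (h' x))) borel h) (box l u)
      = (\<integral>\<^sup>+x. ennreal (h' x) * indicator {k l<..<k u} x \<partial>lborel)"
    by (simp add: emeasure_distr emeasure_density pre)
  also have "\<dots> = (\<integral>\<^sup>+x. ennreal (h' x) * indicator {k l..k u} x \<partial>lborel)"
    by (rule nn_integral_greaterThanLessThan)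
  also have "\<dots> = ennreal (h (k u) - h (k l))"
    by (rule nn_integral_FTC_Icc) (use h h'pos klu in \<open>auto intro: less_imp_le\<close>)
  finally show "emeasure (distr (density lborel (\<lambda>x. ennreal (h' x))) borel h) (box l u) = (\<Prod>b\<in>Basis. (u - l) \<bullet> b)"
    by (simp add: hk)
qed simp

lemma increasing_diffeo_inverse:
  fixes h h' :: "real \<Rightarrow> real"
  assumes h: "\<And>x. (h has_real_derivative h' x) (at x)" and h'pos: "\<And>x. 0 < h' x" and surj: "surj h"
  obtains k where "\<And>y. h (k y) = y" "\<And>x. k (h x) = x"
    "\<And>y. (k has_real_derivative inverse (h' (k y))) (at y)"
proof -
  have inj: "inj h"
  proof (rule injI)
    fix x y assume "h x = h y"
    thus "x = y" using DERIV_pos_imp_increasing[of x y h] DERIV_pos_imp_increasing[of y x h] h h'pos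
      by (metis linorder_neqE_linordered_idom order_less_irrefl)
  qed
  define k where "k = inv h"
  have hk: "h (k y) = y" for y unfolding k_def by (rule surj_f_inv_f[OF surj])
  have kh: "k (h x) = x" for x unfolding k_def by (rule inv_f_f[OF inj])
  \<comment> \<open>the derivative rule for inverses needs continuity of \<open>k\<close> first\<close>
  have "isCont k (h x)" for x
    by (rule isCont_inverse_function[where d=1]) (use kh h in \<open>auto intro: DERIV_isCont\<close>)
  hence kc: "isCont k y" for y by (metis hk)
  have "(k has_real_derivative inverse (h' (k y))) (at y)" for y
    by (rule DERIV_inverse_function[where f=h and a="y-1" and b="y+1"])
      (use h h'pos[of "k y"] hk kc in auto)
  thus ?thesis using that hk kh by blast
qed

lemma integrable_lborel_substitution:
  fixes f h k h' :: "real \<Rightarrow> real"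
  assumes h: "\<And>x. (h has_real_derivative h' x) (at x)" and h'pos: "\<And>x. 0 < h' x"
    and h': "continuous_on UNIV h'" and hk: "\<And>y. h (k y) = y" and kh: "\<And>x. k (h x) = x"
    and f[measurable]: "f \<in> borel_measurable borel"
  shows "integrable lborel (\<lambda>x. h' x * f (h x)) \<longleftrightarrow> integrable lborel f"
    "(\<integral>x. h' x * f (h x) \<partial>lborel) = (\<integral>x. f x \<partial>lborel)"
proof -
  have [measurable]: "h' \<in> borel_measurable borel" using h' by (rule borel_measurable_continuous_onI)
  have "continuous_on UNIV h" by (intro continuous_at_imp_continuous_on ballI DERIV_isCont[OF h])
  hence [measurable]: "h \<in> borel_measurable borel" by (rule borel_measurable_continuous_onI)
  note eq = distr_density_deriv_eq_lborel[OF h h'pos h' hk kh]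
  have "integrable lborel f \<longleftrightarrow> integrable (distr (density lborel (\<lambda>x. ennreal (h' x))) borel h) f"
    by (simp add: eq)
  also have "\<dots> \<longleftrightarrow> integrable (density lborel (\<lambda>x. ennreal (h' x))) (\<lambda>x. f (h x))"
    by (rule integrable_distr_eq) measurable
  also have "\<dots> \<longleftrightarrow> integrable lborel (\<lambda>x. h' x * f (h x))"
    using h'pos by (subst integrable_density) (auto intro: less_imp_le)
  finally show "integrable lborel (\<lambda>x. h' x * f (h x)) \<longleftrightarrow> integrable lborel f" ..
  have "(\<integral>x. f x \<partial>lborel) = (\<integral>x. f x \<partial>(distr (density lborel (\<lambda>x. ennreal (h' x))) borel h))"
    by (simp add: eq)
  also have "\<dots> = (\<integral>x. f (h x) \<partial>(density lborel (\<lambda>x. ennreal (h' x))))"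
    by (rule integral_distr) measurable
  also have "\<dots> = (\<integral>x. h' x * f (h x) \<partial>lborel)"
    using h'pos by (subst integral_density) (auto intro: less_imp_le)
  finally show "(\<integral>x. h' x * f (h x) \<partial>lborel) = (\<integral>x. f x \<partial>lborel)" ..
qed

lemma AE_lborel_substitution:
  fixes h k h' :: "real \<Rightarrow> real"
  assumes h: "\<And>x. (h has_real_derivative h' x) (at x)" and h'pos: "\<And>x. 0 < h' x"
    and h': "continuous_on UNIV h'" and hk: "\<And>y. h (k y) = y" and kh: "\<And>x. k (h x) = x"
    and P: "AE x in lborel. P x"
  shows "AE x in lborel. P (h x)"
proof -
  have [measurable]: "h' \<in> borel_measurable borel" using h' by (rule borel_measurable_continuous_onI)
  have "continuous_on UNIV h" by (intro continuous_at_imp_continuous_on ballI DERIV_isCont[OF h])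
  hence [measurable]: "h \<in> borel_measurable borel" by (rule borel_measurable_continuous_onI)
  have "AE x in distr (density lborel (\<lambda>x. ennreal (h' x))) borel h. P x"
    unfolding distr_density_deriv_eq_lborel[OF h h'pos h' hk kh] by (rule P)
  from AE_distrD[OF _ this] have "AE x in density lborel (\<lambda>x. ennreal (h' x)). P (h x)" by simp
  thus ?thesis using h'pos by (subst (asm) AE_density) auto
qed

text \<open>The chain rule for the metric speed. The bound on \<open>S'\<close> keeps the new speed locally square
  integrable; the exceptional null set is pulled back by \<open>S\<close>, which preserves null sets.\<close>
lemma metric_speed_reparametrization:
  assumes u: "metric_speed u D"
    and S: "\<And>t. (S has_real_derivative S' t) (at t)" and S'pos: "\<And>t. 0 < S' t" and S'C: "\<And>t. S' t \<le> C"
    and S': "continuous_on UNIV S'" and Sk: "\<And>y. S (k y) = y" and kS: "\<And>x. k (S x) = x" and S0: "S 0 = 0"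
  shows "metric_speed (\<lambda>t. u (S t)) (\<lambda>t. S' t * D (S t))"
proof -
  note D = metric_speedD[OF u]
  note [measurable] = D(1)
  have [measurable]: "S' \<in> borel_measurable borel" using S' by (rule borel_measurable_continuous_onI)
  have "continuous_on UNIV S" by (intro continuous_at_imp_continuous_on ballI DERIV_isCont[OF S])
  hence [measurable]: "S \<in> borel_measurable borel" by (rule borel_measurable_continuous_onI)
  have mono: "S x < S y \<longleftrightarrow> x < y" for x y
    using DERIV_pos_imp_increasing[of x y S] DERIV_pos_imp_increasing[of y x S] S S'pos
    by (metis linorder_neqE_linordered_idom order_less_asym)
  have mono': "S x \<le> S y \<longleftrightarrow> x \<le> y" for x y using mono[of y x] by (simp add: not_less[symmetric])
  note sub = integrable_lborel_substitution[OF S S'pos S' Sk kS]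
  show ?thesis unfolding metric_speed_def
  proof (intro conjI allI impI)
    show "(\<lambda>t. S' t * D (S t)) \<in> borel_measurable borel" by measurable
    show "0 \<le> S' t * D (S t)" for t using S'pos[of t] D(2) by simp
    show "set_integrable lborel {0..R} (\<lambda>t. (S' t * D (S t))\<^sup>2)" for R
    proof -
      have "integrable lborel (\<lambda>x. indicator {0..S R} x * (D x)\<^sup>2)"
        using D(3)[of "S R"] by (simp add: set_integrable_def)
      hence "integrable lborel (\<lambda>t. S' t * (indicator {0..S R} (S t) * (D (S t))\<^sup>2))"
        by (subst sub(1)) auto
      hence i: "integrable lborel (\<lambda>t. C * (S' t * (indicator {0..S R} (S t) * (D (S t))\<^sup>2)))"
        by (rule integrable_mult_right)
      have ind: "indicator {0..S R} (S t) = (indicator {0..R} t :: real)" for t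
        using mono'[of 0 t] mono'[of t R] S0 by (simp add: indicator_def)
      show ?thesis unfolding set_integrable_def
      proof (rule Bochner_Integration.integrable_bound[OF i])
        show "AE t in lborel. norm (indicat_real {0..R} t *\<^sub>R (S' t * D (S t))\<^sup>2)
          \<le> norm (C * (S' t * (indicat_real {0..S R} (S t) * (D (S t))\<^sup>2)))"
        proof (rule AE_I2)
          fix t
          have "(S' t * D (S t))\<^sup>2 \<le> C * (S' t * (D (S t))\<^sup>2)"
          proof -
            have "(S' t * D (S t))\<^sup>2 = S' t * (S' t * (D (S t))\<^sup>2)" by (simp add: power2_eq_square)
            also have "\<dots> \<le> C * (S' t * (D (S t))\<^sup>2)"
              using S'pos[of t] S'C[of t] by (intro mult_right_mono) auto
            finally show ?thesis .
          qed
          moreover have "0 \<le> C * (S' t * (D (S t))\<^sup>2)" using S'pos[of t] S'C[of t] by auto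
          ultimately show "norm (indicat_real {0..R} t *\<^sub>R (S' t * D (S t))\<^sup>2)
            \<le> norm (C * (S' t * (indicat_real {0..S R} (S t) * (D (S t))\<^sup>2)))"
            unfolding ind by (cases "t \<in> {0..R}") auto
        qed
      qed measurable
    qed
    show "dist (u (S s)) (u (S t)) \<le> (LINT r:{s..t}|lborel. S' r * D (S r))" if "0 \<le> s" "s \<le> t" for s t
    proof -
      have "dist (u (S s)) (u (S t)) \<le> (LINT r:{S s..S t}|lborel. D r)"
        using that mono'[of 0 s] mono'[of s t] S0 by (intro D(4)) auto
      also have "\<dots> = (\<integral>r. S' r * (indicator {S s..S t} (S r) * D (S r)) \<partial>lborel)"
        unfolding set_lebesgue_integral_def by (subst sub(2)) auto
      also have "\<dots> = (LINT r:{s..t}|lborel. S' r * D (S r))"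
        unfolding set_lebesgue_integral_def
        by (intro Bochner_Integration.integral_cong) (auto simp: indicator_def mono')
      finally show ?thesis .
    qed
    have "AE t in lborel. 0 < S t \<longrightarrow> ((\<lambda>s. dist (u s) (u (S t)) / \<bar>S t - s\<bar>) \<longlongrightarrow> D (S t)) (at (S t))"
      by (rule AE_lborel_substitution[OF S S'pos S' Sk kS D(5)])
    thus "AE t in lborel. 0 < t \<longrightarrow> ((\<lambda>s. dist (u (S s)) (u (S t)) / \<bar>t - s\<bar>) \<longlongrightarrow> S' t * D (S t)) (at t)"
    proof eventually_elim
      case (elim t)
      show ?case
      proof
        assume "0 < t"
        hence "0 < S t" using mono[of 0 t] S0 by simp
        hence l: "((\<lambda>s. dist (u s) (u (S t)) / \<bar>S t - s\<bar>) \<longlongrightarrow> D (S t)) (at (S t))" using elim by simp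
        have ne: "\<forall>\<^sub>F s in at t. s \<noteq> t" by (auto simp: eventually_at intro: exI[of _ 1])
        have "filterlim S (at (S t)) (at t)"
          unfolding filterlim_at
        proof (intro conjI)
          show "\<forall>\<^sub>F s in at t. S s \<in> UNIV \<and> S s \<noteq> S t"
            using ne by eventually_elim (metis UNIV_I kS)
          show "(S \<longlongrightarrow> S t) (at t)" using DERIV_isCont[OF S] by (simp add: isCont_def)
        qed
        from filterlim_compose[OF l this]
        have 1: "((\<lambda>s. dist (u (S s)) (u (S t)) / \<bar>S t - S s\<bar>) \<longlongrightarrow> D (S t)) (at t)" .
        have "((\<lambda>s. (S s - S t) / (s - t)) \<longlongrightarrow> S' t) (at t)"
          using S[of t] by (simp add: has_field_derivative_iff)
        from tendsto_rabs[OF this]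
        have 2: "((\<lambda>s. \<bar>(S s - S t) / (s - t)\<bar>) \<longlongrightarrow> S' t) (at t)" using S'pos[of t] by simp
        have eq: "\<forall>\<^sub>F s in at t. \<bar>(S s - S t) / (s - t)\<bar> * (dist (u (S s)) (u (S t)) / \<bar>S t - S s\<bar>)
          = dist (u (S s)) (u (S t)) / \<bar>t - s\<bar>"
          using ne
        proof eventually_elim
          case (elim s)
          hence "S s \<noteq> S t" by (metis kS)
          thus ?case by (simp add: abs_divide abs_minus_commute field_simps)
        qed
        show "((\<lambda>s. dist (u (S s)) (u (S t)) / \<bar>t - s\<bar>) \<longlongrightarrow> S' t * D (S t)) (at t)"
          by (rule Lim_transform_eventually[OF tendsto_mult[OF 2 1] eq])
      qed
    qed
  qed
qed

section \<open>A weighted Hardy inequality\<close>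

lemma nn_integral_exp_tail:
  assumes "0 < c"
  shows "(\<integral>\<^sup>+t. ennreal (exp (- t / c)) * indicator {r..} t \<partial>lborel) = ennreal (c * exp (- r / c))"
proof -
  have "(\<integral>\<^sup>+t. ennreal (exp (- t / c)) * indicator {r..} t \<partial>lborel) = ennreal (0 - (- c * exp (- r / c)))"
  proof (rule nn_integral_FTC_atLeast)
    fix x show "((\<lambda>t. - c * exp (- t / c)) has_real_derivative exp (- x / c)) (at x)"
      using assms by (auto intro!: derivative_eq_intros simp: field_simps)
    have "filterlim (\<lambda>t. (- 1 / c) * t) at_bot at_top"
      using assms by (intro filterlim_tendsto_neg_mult_at_bot[OF tendsto_const _ filterlim_ident]) auto
    hence "((\<lambda>t. exp (- t / c)) \<longlongrightarrow> 0) at_top"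
      by (intro filterlim_compose[OF exp_at_bot]) simp
    from tendsto_mult_right_zero[OF this, of "-c"]
    show "((\<lambda>t. - c * exp (- t / c)) \<longlongrightarrow> 0) at_top" by simp
  qed auto
  thus ?thesis by simp
qed

text \<open>Cauchy--Schwarz for \<open>D = exp (r / (4 * \<epsilon>)) * (D * exp (- r / (4 * \<epsilon>)))\<close> on \<open>[0,t]\<close> costs a
  factor \<open>2 * \<epsilon> * exp (t / (2 * \<epsilon>))\<close>, which half of the weight \<open>exp (- t / \<epsilon>)\<close> absorbs. Exchanging the
  order of integration, the other half integrates over \<open>t \<ge> r\<close> to
  \<open>2 * \<epsilon> * exp (- r / (2 * \<epsilon>))\<close>.\<close>
lemma weighted_hardy:
  fixes D :: "real \<Rightarrow> real"
  assumes e: "0 < \<epsilon>" and D[measurable]: "D \<in> borel_measurable borel" and D0: "\<And>t. 0 \<le> D t"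
  shows "(\<integral>\<^sup>+t. (\<integral>\<^sup>+r. ennreal (D r) * indicator {0..t} r \<partial>lborel)\<^sup>2 * ennreal (exp (- t / \<epsilon>)) * indicator {0..} t \<partial>lborel)
    \<le> ennreal (4 * \<epsilon>\<^sup>2) * (\<integral>\<^sup>+r. ennreal ((D r)\<^sup>2 * exp (- r / \<epsilon>)) * indicator {0..} r \<partial>lborel)"
proof -
  define c where "c = 2 * \<epsilon>"
  have c: "0 < c" using e by (simp add: c_def)
  have CS: "(\<integral>\<^sup>+r. ennreal (D r) * indicator {0..t} r \<partial>lborel)\<^sup>2
     \<le> ennreal (c * exp (t / c)) * (\<integral>\<^sup>+r. ennreal ((D r)\<^sup>2 * exp (- r / c)) * indicator {0..t} r \<partial>lborel)"
    if "0 \<le> t" for t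
  proof -
    have half: "exp x ^ 2 = exp (2 * x)" for x :: real by (rule exp_double[symmetric])
    have a1: "2 * (r / (2 * c)) = r / c" for r using c by simp
    have sq1: "(exp (r / (2*c)))\<^sup>2 = exp (r / c)" for r
      unfolding half a1 by (rule refl)
    have sq2: "(D r * exp (- (r / (2*c))))\<^sup>2 = (D r)\<^sup>2 * exp (- (r / c))" for r
      unfolding power_mult_distrib half mult_minus_right a1 by (rule refl)
    have sq3: "D r = exp (r / (2*c)) * (D r * exp (- (r / (2*c))))" for r
      using exp_minus_inverse[of "r / (2*c)"] by (metis mult.left_commute mult.right_neutral)
    let ?f = "\<lambda>r. ennreal (exp (r / (2*c)) * indicator {0..t} r)"
    let ?g = "\<lambda>r. ennreal (D r * exp (- (r / (2*c))) * indicator {0..t} r)"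
    have "(\<integral>\<^sup>+r. ennreal (D r) * indicator {0..t} r \<partial>lborel) = (\<integral>\<^sup>+r. ?f r * ?g r \<partial>lborel)"
    proof (rule nn_integral_cong)
      fix r show "ennreal (D r) * indicator {0..t} r = ?f r * ?g r"
        by (subst ennreal_mult'[symmetric], simp, subst sq3) (simp add: indicator_def)
    qed
    hence "(\<integral>\<^sup>+r. ennreal (D r) * indicator {0..t} r \<partial>lborel)\<^sup>2 \<le> (\<integral>\<^sup>+r. (?f r)\<^sup>2 \<partial>lborel) * (\<integral>\<^sup>+r. (?g r)\<^sup>2 \<partial>lborel)"
      using Cauchy_Schwarz_nn_integral[of ?f lborel ?g] by simp
    moreover have "(\<integral>\<^sup>+r. (?f r)\<^sup>2 \<partial>lborel) \<le> ennreal (c * exp (t / c))"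
    proof -
      have "(\<integral>\<^sup>+r. (?f r)\<^sup>2 \<partial>lborel) = (\<integral>\<^sup>+r. ennreal (exp (r / c)) * indicator {0..t} r \<partial>lborel)"
      proof (rule nn_integral_cong)
        fix r show "(?f r)\<^sup>2 = ennreal (exp (r / c)) * indicator {0..t} r"
          by (cases "r \<in> {0..t}") (simp_all add: ennreal_power sq1)
      qed
      also have "\<dots> = ennreal (c * exp (t / c) - c * exp (0 / c))"
      proof (rule nn_integral_FTC_Icc)
        fix x show "((\<lambda>x. c * exp (x / c)) has_real_derivative exp (x / c)) (at x)"
          using c by (auto intro!: derivative_eq_intros)
      qed (use that in auto)
      also have "\<dots> \<le> ennreal (c * exp (t / c))" using c by (intro ennreal_leI) auto
      finally show ?thesis .
    qed
    moreover have "(\<integral>\<^sup>+r. (?g r)\<^sup>2 \<partial>lborel) = (\<integral>\<^sup>+r. ennreal ((D r)\<^sup>2 * exp (- r / c)) * indicator {0..t} r \<partial>lborel)"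
    proof (rule nn_integral_cong)
      fix r show "(?g r)\<^sup>2 = ennreal ((D r)\<^sup>2 * exp (- r / c)) * indicator {0..t} r"
        by (cases "r \<in> {0..t}") (simp_all add: ennreal_power D0 sq2)
    qed
    ultimately show ?thesis by (metis (no_types, lifting) mult_right_mono order_trans zero_le)
  qed
  have "(\<integral>\<^sup>+t. (\<integral>\<^sup>+r. ennreal (D r) * indicator {0..t} r \<partial>lborel)\<^sup>2 * ennreal (exp (- t / \<epsilon>)) * indicator {0..} t \<partial>lborel)
    \<le> (\<integral>\<^sup>+t. (\<integral>\<^sup>+r. ennreal ((D r)\<^sup>2 * exp (- r / c)) * indicator {0..} r * (ennreal (c * exp (- t / c)) * indicator {r..} t) \<partial>lborel) \<partial>lborel)"
  proof (rule nn_integral_mono)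
    fix t :: real
    show "(\<integral>\<^sup>+r. ennreal (D r) * indicator {0..t} r \<partial>lborel)\<^sup>2 * ennreal (exp (- t / \<epsilon>)) * indicator {0..} t
      \<le> (\<integral>\<^sup>+r. ennreal ((D r)\<^sup>2 * exp (- r / c)) * indicator {0..} r * (ennreal (c * exp (- t / c)) * indicator {r..} t) \<partial>lborel)"
    proof (cases "0 \<le> t")
      case True
      have "(\<integral>\<^sup>+r. ennreal (D r) * indicator {0..t} r \<partial>lborel)\<^sup>2 * ennreal (exp (- t / \<epsilon>)) * indicator {0..} t
        \<le> (ennreal (c * exp (t / c)) * (\<integral>\<^sup>+r. ennreal ((D r)\<^sup>2 * exp (- r / c)) * indicator {0..t} r \<partial>lborel)) * ennreal (exp (- t / \<epsilon>))"
        using CS[OF True] True by (simp add: mult_right_mono)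
      also have "\<dots> = (ennreal (c * exp (t / c)) * ennreal (exp (- t / \<epsilon>))) * (\<integral>\<^sup>+r. ennreal ((D r)\<^sup>2 * exp (- r / c)) * indicator {0..t} r \<partial>lborel)"
        by (simp add: mult_ac)
      also have "ennreal (c * exp (t / c)) * ennreal (exp (- t / \<epsilon>)) = ennreal (c * exp (- t / c))"
      proof -
        have "exp (t / c) * exp (- t / \<epsilon>) = exp (- t / c)"
          unfolding exp_add[symmetric] using e by (intro arg_cong[of _ _ exp]) (simp add: c_def field_simps)
        thus ?thesis using c by (simp add: ennreal_mult'[symmetric] mult.assoc)
      qed
      also have "ennreal (c * exp (- t / c)) * (\<integral>\<^sup>+r. ennreal ((D r)\<^sup>2 * exp (- r / c)) * indicator {0..t} r \<partial>lborel)
        = (\<integral>\<^sup>+r. ennreal ((D r)\<^sup>2 * exp (- r / c)) * indicator {0..} r * (ennreal (c * exp (- t / c)) * indicator {r..} t) \<partial>lborel)"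
        by (subst nn_integral_cmult[symmetric], measurable, rule nn_integral_cong) (use True in \<open>simp add: indicator_def mult.commute\<close>)
      finally show ?thesis .
    qed simp
  qed
  also have "\<dots> = (\<integral>\<^sup>+r. (\<integral>\<^sup>+t. ennreal ((D r)\<^sup>2 * exp (- r / c)) * indicator {0..} r * (ennreal (c * exp (- t / c)) * indicator {r..} t) \<partial>lborel) \<partial>lborel)"
  proof (rule lborel_pair.Fubini'[where f="\<lambda>r t. ennreal ((D r)\<^sup>2 * exp (- r / c)) * indicator {0..} r * (ennreal (c * exp (- t / c)) * indicator {r..} t)"])
    have eq: "(\<lambda>(r, t). ennreal ((D r)\<^sup>2 * exp (- r / c)) * indicator {0..} r * (ennreal (c * exp (- t / c)) * indicator {r..} t))
      = (\<lambda>x. ennreal ((D (fst x))\<^sup>2 * exp (- fst x / c)) * indicator {0..} (fst x) * (ennreal (c * exp (- snd x / c)) * indicator {0..} (snd x - fst x)))"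
      by (rule ext) (simp add: split_beta indicator_def)
    show "(\<lambda>(r, t). ennreal ((D r)\<^sup>2 * exp (- r / c)) * indicator {0..} r * (ennreal (c * exp (- t / c)) * indicator {r..} t)) \<in> borel_measurable (lborel \<Otimes>\<^sub>M lborel)"
      unfolding eq by measurable
  qed
  also have "\<dots> = (\<integral>\<^sup>+r. ennreal (4 * \<epsilon>\<^sup>2) * (ennreal ((D r)\<^sup>2 * exp (- r / \<epsilon>)) * indicator {0..} r) \<partial>lborel)"
  proof (rule nn_integral_cong)
    fix r :: real
    have "(\<integral>\<^sup>+t. ennreal ((D r)\<^sup>2 * exp (- r / c)) * indicator {0..} r * (ennreal (c * exp (- t / c)) * indicator {r..} t) \<partial>lborel)
      = ennreal ((D r)\<^sup>2 * exp (- r / c)) * indicator {0..} r * (ennreal c * (\<integral>\<^sup>+t. ennreal (exp (- t / c)) * indicator {r..} t \<partial>lborel))"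
    proof -
      have "ennreal (c * exp (- t / c)) * indicator {r..} t = ennreal c * (ennreal (exp (- t / c)) * indicator {r..} t)" for t
        using c by (simp add: ennreal_mult mult.assoc)
      thus ?thesis by (simp only:) (subst nn_integral_cmult, measurable, subst nn_integral_cmult, measurable)
    qed
    also have "\<dots> = ennreal ((D r)\<^sup>2 * exp (- r / c)) * indicator {0..} r * (ennreal c * ennreal (c * exp (- r / c)))"
      using nn_integral_exp_tail[OF c, of r] by simp
    also have "\<dots> = ennreal (4 * \<epsilon>\<^sup>2 * (D r)\<^sup>2 * (exp (- r / c) * exp (- r / c))) * indicator {0..} r"
      using c by (simp add: indicator_def ennreal_mult'[symmetric]) (simp add: c_def power2_eq_square mult_ac)
    also have "exp (- r / c) * exp (- r / c) = exp (- r / \<epsilon>)"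
      unfolding exp_add[symmetric] using e by (intro arg_cong[of _ _ exp]) (simp add: c_def field_simps)
    finally show "(\<integral>\<^sup>+t. ennreal ((D r)\<^sup>2 * exp (- r / c)) * indicator {0..} r * (ennreal (c * exp (- t / c)) * indicator {r..} t) \<partial>lborel)
      = ennreal (4 * \<epsilon>\<^sup>2) * (ennreal ((D r)\<^sup>2 * exp (- r / \<epsilon>)) * indicator {0..} r)"
      by (simp add: indicator_def ennreal_mult[symmetric] mult_ac)
  qed
  also have "\<dots> = ennreal (4 * \<epsilon>\<^sup>2) * (\<integral>\<^sup>+r. ennreal ((D r)\<^sup>2 * exp (- r / \<epsilon>)) * indicator {0..} r \<partial>lborel)"
    by (rule nn_integral_cmult) measurable
  finally show ?thesis .
qed

section \<open>The exponential weight and extended-real integrals\<close>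

lemma nn_integral_mu_weight:
  assumes [measurable]: "f \<in> borel_measurable borel"
  shows "(\<integral>\<^sup>+x. f x \<partial>mu_weight \<epsilon>) = (\<integral>\<^sup>+x. ennreal (1 / \<epsilon> * exp (- x / \<epsilon>)) * f x * indicator {0<..} x \<partial>lborel)"
proof -
  have "(\<integral>\<^sup>+x. f x \<partial>mu_weight \<epsilon>) = (\<integral>\<^sup>+x. ennreal (1 / \<epsilon> * exp (- x / \<epsilon>)) * f x \<partial>restrict_space lborel {0<..})"
    unfolding mu_weight_def by (rule nn_integral_density) (auto intro!: measurable_restrict_space1)
  thus ?thesis by (simp add: nn_integral_restrict_space)
qed

lemma AE_mu_weight:
  assumes "AE t in lborel. 0 < t \<longrightarrow> P t"
  shows "AE t in mu_weight \<epsilon>. P t"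
proof -
  have "AE t in restrict_space lborel {0<..}. P t"
    using assms by (subst AE_restrict_space_iff) auto
  thus ?thesis unfolding mu_weight_def
    by (subst AE_density) (auto intro!: measurable_restrict_space1)
qed

lemma AE_mu_weightD:
  assumes "0 < \<epsilon>" "AE t in mu_weight \<epsilon>. P t"
  shows "AE t in lborel. 0 < t \<longrightarrow> P t"
proof -
  have "AE t in restrict_space lborel {0<..}. 0 < ennreal (1 / \<epsilon> * exp (- t / \<epsilon>)) \<longrightarrow> P t"
    using assms(2) unfolding mu_weight_def by (subst (asm) AE_density) (auto intro!: measurable_restrict_space1)
  hence "AE t in restrict_space lborel {0<..}. P t" using assms(1) by (simp add: ennreal_zero_less_mult_iff)
  thus ?thesis by (subst (asm) AE_restrict_space_iff) auto
qed

lemma borel_measurable_mu_weight: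
  assumes "f \<in> borel_measurable borel"
  shows "f \<in> borel_measurable (mu_weight \<epsilon>)"
  unfolding mu_weight_def using assms by (auto intro!: measurable_restrict_space1)

lemma mu_weight_integral:
  fixes f :: "real \<Rightarrow> real"
  assumes e: "0 < \<epsilon>" and [measurable]: "f \<in> borel_measurable borel"
  shows "integrable (mu_weight \<epsilon>) f \<longleftrightarrow> integrable lborel (\<lambda>t. indicator {0<..} t * (exp (- t / \<epsilon>) * f t))"
    "(\<integral>t. f t \<partial>mu_weight \<epsilon>) = (1 / \<epsilon>) * (\<integral>t. indicator {0<..} t * (exp (- t / \<epsilon>) * f t) \<partial>lborel)"
proof -
  have eq: "(\<lambda>t. indicator {0<..} t *\<^sub>R ((1 / \<epsilon> * exp (- t / \<epsilon>)) *\<^sub>R f t)) = (\<lambda>t. (1 / \<epsilon>) * (indicator {0<..} t * (exp (- t / \<epsilon>) * f t)))"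
    by (auto simp: fun_eq_iff)
  have "integrable (mu_weight \<epsilon>) f \<longleftrightarrow> integrable (restrict_space lborel {0<..}) (\<lambda>t. (1 / \<epsilon> * exp (- t / \<epsilon>)) *\<^sub>R f t)"
    unfolding mu_weight_def using e by (intro integrable_density) (auto intro!: measurable_restrict_space1)
  also have "\<dots> \<longleftrightarrow> integrable lborel (\<lambda>t. indicator {0<..} t *\<^sub>R ((1 / \<epsilon> * exp (- t / \<epsilon>)) *\<^sub>R f t))"
    by (rule integrable_restrict_space) simp
  also have "\<dots> \<longleftrightarrow> integrable lborel (\<lambda>t. indicator {0<..} t * (exp (- t / \<epsilon>) * f t))"
    unfolding eq integrable_mult_left_iff using e by simp
  finally show "integrable (mu_weight \<epsilon>) f \<longleftrightarrow> integrable lborel (\<lambda>t. indicator {0<..} t * (exp (- t / \<epsilon>) * f t))" .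
  have "(\<integral>t. f t \<partial>mu_weight \<epsilon>) = (\<integral>t. (1 / \<epsilon> * exp (- t / \<epsilon>)) *\<^sub>R f t \<partial>restrict_space lborel {0<..})"
    unfolding mu_weight_def using e by (intro integral_density) (auto intro!: measurable_restrict_space1)
  also have "\<dots> = (\<integral>t. indicator {0<..} t *\<^sub>R ((1 / \<epsilon> * exp (- t / \<epsilon>)) *\<^sub>R f t) \<partial>lborel)"
    by (rule integral_restrict_space) simp
  also have "\<dots> = (1 / \<epsilon>) * (\<integral>t. indicator {0<..} t * (exp (- t / \<epsilon>) * f t) \<partial>lborel)"
    unfolding eq by (rule integral_mult_right_zero)
  finally show "(\<integral>t. f t \<partial>mu_weight \<epsilon>) = (1 / \<epsilon>) * (\<integral>t. indicator {0<..} t * (exp (- t / \<epsilon>) * f t) \<partial>lborel)" .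
qed

lemma ext_integral_cong_AE:
  assumes "AE x in M. f x = g x"
  shows "ext_integral M f = ext_integral M g"
proof -
  have "(\<integral>\<^sup>+ x. e2ennreal (f x) \<partial>M) = (\<integral>\<^sup>+ x. e2ennreal (g x) \<partial>M)"
    "(\<integral>\<^sup>+ x. e2ennreal (- f x) \<partial>M) = (\<integral>\<^sup>+ x. e2ennreal (- g x) \<partial>M)"
    using assms by (auto intro!: nn_integral_cong_AE)
  thus ?thesis by (simp add: ext_integral_def)
qed

lemma ext_integral_eq_integral:
  assumes "AE x in M. f x = ereal (g x)" and g: "integrable M g"
  shows "ext_integral M f = ereal (\<integral>x. g x \<partial>M)"
proof -
  have 1: "(\<integral>\<^sup>+ x. e2ennreal (f x) \<partial>M) = (\<integral>\<^sup>+ x. ennreal (g x) \<partial>M)"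
    using assms(1) by (intro nn_integral_cong_AE) (auto elim!: eventually_mono simp: ennreal.abs_eq)
  have 2: "(\<integral>\<^sup>+ x. e2ennreal (- f x) \<partial>M) = (\<integral>\<^sup>+ x. ennreal (- g x) \<partial>M)"
    using assms(1) by (intro nn_integral_cong_AE) (auto elim!: eventually_mono)
  have f1: "(\<integral>\<^sup>+ x. ennreal (g x) \<partial>M) \<noteq> \<infinity>" "(\<integral>\<^sup>+ x. ennreal (- g x) \<partial>M) \<noteq> \<infinity>"
    using g by (auto simp: real_integrable_def)
  have e: "enn2ereal a = ereal (enn2real a)" if "a \<noteq> \<infinity>" for a
    using that by (cases a) (auto simp: enn2ereal_ennreal)
  show ?thesis unfolding ext_integral_def 1 2 e[OF f1(1)] e[OF f1(2)] real_lebesgue_integral_def[OF g] by simp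
qed

text \<open>This is how a finite value of the functional turns into integrability: an extended-real
  integral can avoid \<open>\<infinity>\<close> also by having an infinite negative part, and this has to be excluded.\<close>
lemma ext_integral_finite:
  fixes f :: "'b \<Rightarrow> ereal"
  assumes [measurable]: "f \<in> borel_measurable M" and fin: "ext_integral M f \<noteq> \<infinity>"
    and neg: "(\<integral>\<^sup>+ x. e2ennreal (- f x) \<partial>M) < \<infinity>"
  shows "AE x in M. \<bar>f x\<bar> \<noteq> \<infinity>" "integrable M (\<lambda>x. real_of_ereal (f x))"
proof -
  have pos: "(\<integral>\<^sup>+ x. e2ennreal (f x) \<partial>M) < \<infinity>"
  proof (rule ccontr)
    assume "\<not> ?thesis"
    hence "(\<integral>\<^sup>+ x. e2ennreal (f x) \<partial>M) = \<infinity>" by (simp add: less_top[symmetric])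
    hence "ext_integral M f = \<infinity>" using neg unfolding ext_integral_def
      by (cases "\<integral>\<^sup>+ x. e2ennreal (- f x) \<partial>M") (auto simp: enn2ereal_ennreal)
    thus False using fin by simp
  qed
  have "AE x in M. e2ennreal (f x) \<noteq> \<infinity>" "AE x in M. e2ennreal (- f x) \<noteq> \<infinity>"
    by (rule nn_integral_PInf_AE; use pos neg in simp)+
  thus "AE x in M. \<bar>f x\<bar> \<noteq> \<infinity>"
    by eventually_elim (auto simp: e2ennreal_infty)
  show "integrable M (\<lambda>x. real_of_ereal (f x))"
  proof (rule integrableI_bounded)
    have "(\<integral>\<^sup>+ x. ennreal (norm (real_of_ereal (f x))) \<partial>M) \<le> (\<integral>\<^sup>+ x. e2ennreal (f x) + e2ennreal (- f x) \<partial>M)"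
    proof (rule nn_integral_mono)
      fix x show "ennreal (norm (real_of_ereal (f x))) \<le> e2ennreal (f x) + e2ennreal (- f x)"
      proof (cases "f x")
        case (real r)
        thus ?thesis by (cases "0 \<le> r") (auto simp: ennreal_neg)
      qed auto
    qed
    also have "\<dots> < \<infinity>" using pos neg by (subst nn_integral_add) auto
    finally show "(\<integral>\<^sup>+ x. ennreal (norm (real_of_ereal (f x))) \<partial>M) < \<infinity>" .
  qed measurable
qed

section \<open>The functional along a curve\<close>

text \<open>Condition (MT2) makes \<open>\<sigma>\<close> coarser than the metric topology: a point that is \<open>\<delta>\<close>-close to \<open>l\<close> is
  \<open>\<delta>\<close>-close to every set containing \<open>l\<close>.\<close>
lemma compatible_tendsto_imp_limitin:
  assumes "compatible \<sigma>" and x: "(x :: nat \<Rightarrow> 'a::metric_space) \<longlonglongrightarrow> l"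
  shows "limitin \<sigma> x l sequentially"
  unfolding limitin_def
proof (intro conjI allI impI)
  show "l \<in> topspace \<sigma>" using assms(1) by (simp add: compatible_def)
  fix U assume "openin \<sigma> U \<and> l \<in> U"
  then obtain V \<delta> where V: "l \<in> V" "\<delta> > 0" "\<And>y. infdist y V < \<delta> \<Longrightarrow> y \<in> U"
    using assms(1) unfolding compatible_def by metis
  have "\<forall>\<^sub>F n in sequentially. dist (x n) l < \<delta>" using x V(2) by (rule tendstoD)
  thus "\<forall>\<^sub>F n in sequentially. x n \<in> U"
    by eventually_elim (meson V infdist_le order_le_less_trans)
qed

text \<open>Metrically convergent sequences are bounded and \<open>\<sigma>\<close>-convergent, so \<open>t \<mapsto> \<phi> (w t)\<close> is lower
  semicontinuous and has closed sublevel sets.\<close>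
lemma lower_semicont_along_curve_borel:
  fixes w :: "real \<Rightarrow> 'a::metric_space"
  assumes "compatible \<sigma>" "lower_semicont \<sigma> \<phi>" and w: "continuous_on UNIV w"
  shows "(\<lambda>t. \<phi> (w t)) \<in> borel_measurable borel"
proof (rule borel_measurableI_le)
  fix y
  have "closed {t. \<phi> (w t) \<le> y}"
    unfolding closed_sequential_limits
  proof (intro allI impI)
    fix x l assume x: "(\<forall>n. x n \<in> {t. \<phi> (w t) \<le> y}) \<and> x \<longlonglongrightarrow> l"
    have "isCont w l" using w by (simp add: continuous_on_eq_continuous_at)
    hence wl: "(\<lambda>n. w (x n)) \<longlonglongrightarrow> w l" using x by (auto intro: isCont_tendsto_compose)
    have "\<phi> (w l) \<le> liminf (\<lambda>n. \<phi> (w (x n)))"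
      using assms(2) convergent_imp_bounded[OF wl] compatible_tendsto_imp_limitin[OF assms(1) wl]
      unfolding lower_semicont_def by blast
    also have "\<dots> \<le> limsup (\<lambda>n. \<phi> (w (x n)))" by (rule Liminf_le_Limsup) simp
    also have "\<dots> \<le> y" using x by (intro Limsup_bounded) auto
    finally show "l \<in> {t. \<phi> (w t) \<le> y}" by simp
  qed
  thus "{t \<in> space borel. \<phi> (w t) \<le> y} \<in> sets borel" by (simp add: borel_closed)
qed

lemma ennreal_integral_le_nn_integral:
  fixes f :: "'b \<Rightarrow> real"
  assumes "\<And>x. 0 \<le> f x"
  shows "ennreal (\<integral>x. f x \<partial>M) \<le> (\<integral>\<^sup>+x. ennreal (f x) \<partial>M)"
  by (cases "integrable M f") (use assms in \<open>auto simp: nn_integral_eq_integral not_integrable_integral_eq\<close>)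

text \<open>Coercivity with \<open>v = u 0\<close> bounds the negative part of \<open>\<phi> (u t)\<close> by a constant plus
  \<open>B * (dist (u t) (u 0))\<^sup>2\<close>; the distance is at most \<open>\<integral>\<^sub>0\<^sup>t D\<close>, whose square is integrable against the
  weight by Hardy's inequality.\<close>
lemma negative_part_finite:
  fixes u :: "real \<Rightarrow> 'a::metric_space"
  assumes u: "metric_speed u D" and co: "coercive \<phi> ustar A B" and e: "0 < \<epsilon>"
    and DE: "integrable lborel (\<lambda>t. indicator {0<..} t * (exp (- t / \<epsilon>) * (D t)\<^sup>2))"
    and Pm[measurable]: "(\<lambda>t. \<phi> (u (max 0 t))) \<in> borel_measurable borel"
  shows "(\<integral>\<^sup>+t. e2ennreal (- \<phi> (u (max 0 t))) \<partial>mu_weight \<epsilon>) < \<infinity>"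
proof -
  note D = metric_speedD[OF u]
  note [measurable] = D(1)
  define X where "X t = (\<integral>\<^sup>+r. ennreal (D r) * indicator {0..t} r \<partial>lborel)" for t
  define Q where "Q = B * (dist (u 0) ustar)\<^sup>2 + A"
  have AB: "0 \<le> A" "0 \<le> B" using co by (auto simp: coercive_def)
  hence Q0: "0 \<le> Q" by (simp add: Q_def)
  have eq: "X t = (\<integral>\<^sup>+r. ennreal (D r) * indicator {0..} (t - r) * indicator {0..} r \<partial>lborel)" for t
    unfolding X_def by (intro nn_integral_cong) (auto simp: indicator_def)
  have Xm[measurable]: "X \<in> borel_measurable borel" unfolding eq[abs_def] by measurable
  have pw: "e2ennreal (- \<phi> (u t)) \<le> ennreal B * (X t)\<^sup>2 + ennreal Q" if t: "0 < t" for t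
  proof -
    have "dist (u 0) (u t) \<le> (LINT r:{0..t}|lborel. D r)" using t by (intro D(4)) auto
    hence "ennreal (dist (u t) (u 0)) \<le> ennreal (LINT r:{0..t}|lborel. D r)" by (simp add: dist_commute ennreal_leI)
    also have "\<dots> \<le> (\<integral>\<^sup>+r. ennreal (indicator {0..t} r * D r) \<partial>lborel)"
      unfolding set_lebesgue_integral_def using D(2) ennreal_integral_le_nn_integral[of "\<lambda>r. indicator {0..t} r * D r" lborel] by simp
    also have "\<dots> = X t" unfolding X_def by (intro nn_integral_cong) (auto simp: indicator_def)
    finally have dX: "ennreal (dist (u t) (u 0)) \<le> X t" .
    have "ereal (- B * (dist (u t) (u 0))\<^sup>2 - Q) \<le> \<phi> (u t)" using co unfolding coercive_def Q_def by blast
    hence "- \<phi> (u t) \<le> - ereal (- B * (dist (u t) (u 0))\<^sup>2 - Q)" by (simp only: ereal_minus_le_minus)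
    hence "- \<phi> (u t) \<le> ereal (B * (dist (u t) (u 0))\<^sup>2 + Q)" by (simp add: algebra_simps)
    hence "e2ennreal (- \<phi> (u t)) \<le> e2ennreal (ereal (B * (dist (u t) (u 0))\<^sup>2 + Q))" by (rule e2ennreal_mono)
    also have "\<dots> = ennreal B * (ennreal (dist (u t) (u 0)))\<^sup>2 + ennreal Q"
      using AB Q0 by (simp add: ennreal_plus ennreal_mult ennreal_power)
    also have "\<dots> \<le> ennreal B * (X t)\<^sup>2 + ennreal Q"
      using dX by (intro add_mono mult_left_mono power_mono) auto
    finally show ?thesis .
  qed
  have "(\<integral>\<^sup>+t. e2ennreal (- \<phi> (u (max 0 t))) \<partial>mu_weight \<epsilon>)
    = (\<integral>\<^sup>+t. ennreal (1 / \<epsilon> * exp (- t / \<epsilon>)) * e2ennreal (- \<phi> (u (max 0 t))) * indicator {0<..} t \<partial>lborel)"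
    by (rule nn_integral_mu_weight) measurable
  also have "\<dots> \<le> (\<integral>\<^sup>+t. ennreal (B / \<epsilon>) * ((X t)\<^sup>2 * ennreal (exp (- t / \<epsilon>)) * indicator {0..} t)
      + ennreal (Q / \<epsilon>) * (ennreal (exp (- t / \<epsilon>)) * indicator {0..} t) \<partial>lborel)"
  proof (rule nn_integral_mono)
    fix t :: real
    show "ennreal (1 / \<epsilon> * exp (- t / \<epsilon>)) * e2ennreal (- \<phi> (u (max 0 t))) * indicator {0<..} t
      \<le> ennreal (B / \<epsilon>) * ((X t)\<^sup>2 * ennreal (exp (- t / \<epsilon>)) * indicator {0..} t) + ennreal (Q / \<epsilon>) * (ennreal (exp (- t / \<epsilon>)) * indicator {0..} t)"
    proof (cases "0 < t")
      case True
      have "ennreal (1 / \<epsilon> * exp (- t / \<epsilon>)) * e2ennreal (- \<phi> (u t))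
        \<le> ennreal (1 / \<epsilon> * exp (- t / \<epsilon>)) * (ennreal B * (X t)\<^sup>2 + ennreal Q)"
        using pw[OF True] by (rule mult_left_mono) simp
      also have "\<dots> = (ennreal (1 / \<epsilon>) * ennreal B) * ((X t)\<^sup>2 * ennreal (exp (- t / \<epsilon>))) + (ennreal (1 / \<epsilon>) * ennreal Q) * ennreal (exp (- t / \<epsilon>))"
        using e by (subst ennreal_mult) (simp_all add: distrib_left mult_ac)
      also have "ennreal (1 / \<epsilon>) * ennreal B = ennreal (B / \<epsilon>)" using e AB by (simp add: ennreal_mult'[symmetric])
      also have "ennreal (1 / \<epsilon>) * ennreal Q = ennreal (Q / \<epsilon>)" using e Q0 by (simp add: ennreal_mult'[symmetric])
      finally show ?thesis using True by (simp add: max_absorb2)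
    qed simp
  qed
  also have "\<dots> = ennreal (B / \<epsilon>) * (\<integral>\<^sup>+t. (X t)\<^sup>2 * ennreal (exp (- t / \<epsilon>)) * indicator {0..} t \<partial>lborel)
     + ennreal (Q / \<epsilon>) * (\<integral>\<^sup>+t. ennreal (exp (- t / \<epsilon>)) * indicator {0..} t \<partial>lborel)"
    by (subst nn_integral_add) (simp_all add: nn_integral_cmult)
  also have "\<dots> < \<infinity>"
  proof -
    have "(\<integral>\<^sup>+t. (X t)\<^sup>2 * ennreal (exp (- t / \<epsilon>)) * indicator {0..} t \<partial>lborel)
      \<le> ennreal (4 * \<epsilon>\<^sup>2) * (\<integral>\<^sup>+r. ennreal ((D r)\<^sup>2 * exp (- r / \<epsilon>)) * indicator {0..} r \<partial>lborel)"
      unfolding X_def by (rule weighted_hardy[OF e D(1,2)])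
    also have "(\<integral>\<^sup>+r. ennreal ((D r)\<^sup>2 * exp (- r / \<epsilon>)) * indicator {0..} r \<partial>lborel)
      = (\<integral>\<^sup>+t. ennreal (norm (indicator {0<..} t * (exp (- t / \<epsilon>) * (D t)\<^sup>2))) \<partial>lborel)"
    proof (rule nn_integral_cong_AE)
      show "AE t in lborel. ennreal ((D t)\<^sup>2 * exp (- t / \<epsilon>)) * indicator {0..} t = ennreal (norm (indicator {0<..} t * (exp (- t / \<epsilon>) * (D t)\<^sup>2)))"
        using AE_lborel_singleton[of 0] by eventually_elim (auto simp: indicator_def mult.commute)
    qed
    finally have H: "(\<integral>\<^sup>+t. (X t)\<^sup>2 * ennreal (exp (- t / \<epsilon>)) * indicator {0..} t \<partial>lborel)
      \<le> ennreal (4 * \<epsilon>\<^sup>2) * (\<integral>\<^sup>+t. ennreal (norm (indicator {0<..} t * (exp (- t / \<epsilon>) * (D t)\<^sup>2))) \<partial>lborel)" .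
    have "(\<integral>\<^sup>+t. ennreal (norm (indicator {0<..} t * (exp (- t / \<epsilon>) * (D t)\<^sup>2))) \<partial>lborel) < \<infinity>"
      using DE unfolding integrable_iff_bounded by blast
    hence "(\<integral>\<^sup>+t. (X t)\<^sup>2 * ennreal (exp (- t / \<epsilon>)) * indicator {0..} t \<partial>lborel) < \<infinity>"
      by (intro order_le_less_trans[OF H]) (simp add: ennreal_mult_less_top)
    moreover have "(\<integral>\<^sup>+t. ennreal (exp (- t / \<epsilon>)) * indicator {0..} t \<partial>lborel) < \<infinity>"
      using nn_integral_exp_tail[OF e, of 0] by simp
    ultimately show ?thesis by (simp add: ennreal_mult_less_top)
  qed
  finally show ?thesis .
qed

section \<open>Inner variations\<close>

lemma integrable_weighted_mult:
  fixes f c :: "real \<Rightarrow> real"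
  assumes f: "integrable lborel (\<lambda>t. indicator {0<..} t * (exp (- t / \<epsilon>) * f t))"
    and [measurable]: "f \<in> borel_measurable borel" "c \<in> borel_measurable borel"
    and c: "\<And>t. \<bar>c t\<bar> \<le> C * exp (- t / \<epsilon>)"
  shows "integrable lborel (\<lambda>t. indicator {0<..} t * (c t * f t))"
proof (rule Bochner_Integration.integrable_bound[OF integrable_mult_right[OF f, of C]])
  show "AE t in lborel. norm (indicat_real {0<..} t * (c t * f t)) \<le> norm (C * (indicat_real {0<..} t * (exp (- t / \<epsilon>) * f t)))"
  proof (rule AE_I2)
    fix t :: real
    have "0 \<le> C * exp (- t / \<epsilon>)" using c[of t] by linarith
    hence "\<bar>c t * f t\<bar> \<le> \<bar>C * exp (- t / \<epsilon>) * f t\<bar>"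
      using c[of t] unfolding abs_mult[of "c t"] abs_mult[of "C * exp (- t / \<epsilon>)"]
      by (intro mult_right_mono) auto
    thus "norm (indicat_real {0<..} t * (c t * f t)) \<le> norm (C * (indicat_real {0<..} t * (exp (- t / \<epsilon>) * f t)))"
      by (simp add: indicator_def mult.assoc)
  qed
qed measurable

text \<open>The value of the functional at the curve whose clock \<open>\<theta>\<close> satisfies
  \<open>exp (- \<theta> s / \<epsilon>) = exp (- s / \<epsilon>) - \<tau> * \<zeta> s / \<epsilon>\<close>, pulled back to the time of the original curve.
  The bounds on \<open>\<tau>\<close> keep this quantity and its derivative within a factor of the original ones, so that
  \<open>\<theta>\<close> is an increasing diffeomorphism with derivative at least \<open>1 / 3\<close>; it fixes every zero of \<open>\<zeta>\<close>
  and thus maps the positive half-line onto itself. For \<open>\<zeta> = 0\<close> the formula is the value at the curve itself.\<close>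
lemma inner_variation:
  fixes u :: "real \<Rightarrow> 'a::metric_space"
  assumes e: "0 < \<epsilon>" and u: "metric_speed u D"
    and Pm[measurable]: "\<Psi> \<in> borel_measurable borel"
    and fin: "AE t in lborel. 0 < t \<longrightarrow> \<phi> (u t) = ereal (\<Psi> t)"
    and DE: "integrable lborel (\<lambda>t. indicator {0<..} t * (exp (- t / \<epsilon>) * (D t)\<^sup>2))"
    and PE: "integrable lborel (\<lambda>t. indicator {0<..} t * (exp (- t / \<epsilon>) * \<Psi> t))"
    and d\<zeta>: "\<And>t. (\<zeta> has_real_derivative \<zeta>' t) (at t)" and z': "continuous_on UNIV \<zeta>'"
    and z0: "\<And>t. t \<le> 0 \<Longrightarrow> \<zeta> t = 0" "\<And>t. R \<le> t \<Longrightarrow> \<zeta> t = 0"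
    and b: "\<And>t. \<bar>\<tau> * \<zeta> t / \<epsilon>\<bar> \<le> exp (- t / \<epsilon>) / 2" "\<And>t. \<bar>\<tau> * \<zeta>' t\<bar> \<le> exp (- t / \<epsilon>) / 2"
  shows "\<exists>v. AC_loc 2 {0..} v \<and> (\<forall>t. \<zeta> t = 0 \<longrightarrow> v t = u t) \<and>
    (\<integral>\<^sup>+ t. ennreal ((metric_deriv v t)\<^sup>2) \<partial>mu_weight \<epsilon>) < \<infinity> \<and>
    WED \<phi> \<epsilon> v = ereal (1 / \<epsilon> * (\<integral>s. indicator {0<..} s *
      (\<epsilon> / 2 * (D s)\<^sup>2 * ((exp (- s / \<epsilon>) - \<tau> * \<zeta> s / \<epsilon>)\<^sup>2 / (exp (- s / \<epsilon>) + \<tau> * \<zeta>' s))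
        + \<Psi> s * (exp (- s / \<epsilon>) + \<tau> * \<zeta>' s)) \<partial>lborel))"
proof -
  note D = metric_speedD[OF u]
  note [measurable] = D(1)
  define E where "E s = exp (- s / \<epsilon>)" for s :: real
  \<comment> \<open>\<open>y = exp (- \<theta> / \<epsilon>)\<close> and \<open>z = y * \<theta>'\<close>; both stay within \<open>[E / 2, 3 * E / 2]\<close>\<close>
  define y where "y s = E s - \<tau> * \<zeta> s / \<epsilon>" for s
  define z where "z s = E s + \<tau> * \<zeta>' s" for s
  have E0: "0 < E s" for s by (simp add: E_def)
  have b': "\<bar>\<tau> * \<zeta> t / \<epsilon>\<bar> \<le> E t / 2" "\<bar>\<tau> * \<zeta>' t\<bar> \<le> E t / 2" for t using b[of t] by (auto simp: E_def)
  have yb: "E s / 2 \<le> y s" "y s \<le> 3 / 2 * E s" "0 < y s" for s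
    using b'(1)[of s] E0[of s] unfolding y_def abs_le_iff by linarith+
  have zb: "E s / 2 \<le> z s" "z s \<le> 3 / 2 * E s" "0 < z s" for s
    using b'(2)[of s] E0[of s] unfolding z_def abs_le_iff by linarith+
  have zc: "continuous_on UNIV \<zeta>" by (intro continuous_at_imp_continuous_on ballI DERIV_isCont[OF d\<zeta>])
  have Ec: "continuous_on UNIV E" unfolding E_def[abs_def] by (intro continuous_intros) (use e in auto)
  have ycont: "continuous_on UNIV y" unfolding y_def[abs_def] by (intro continuous_intros Ec zc) (use e in auto)
  have zcont: "continuous_on UNIV z" unfolding z_def[abs_def] by (intro continuous_intros Ec z')
  have [measurable]: "E \<in> borel_measurable borel" "y \<in> borel_measurable borel" "z \<in> borel_measurable borel"
    using Ec ycont zcont by (auto intro: borel_measurable_continuous_onI)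
  define \<theta> where "\<theta> s = - \<epsilon> * ln (y s)" for s
  define \<theta>' where "\<theta>' s = z s / y s" for s
  have dE: "(E has_real_derivative - E s / \<epsilon>) (at s)" for s
    unfolding E_def[abs_def] using e by (auto intro!: derivative_eq_intros)
  have dy: "(y has_real_derivative - z s / \<epsilon>) (at s)" for s
    unfolding y_def[abs_def] z_def using e
    by (auto intro!: derivative_eq_intros dE d\<zeta> simp: field_simps)
  have d\<theta>: "(\<theta> has_real_derivative \<theta>' s) (at s)" for s
    unfolding \<theta>_def[abs_def] \<theta>'_def using yb(3)[of s] e
    by (auto intro!: derivative_eq_intros dy simp: field_simps)
  have \<theta>'pos: "0 < \<theta>' s" for s unfolding \<theta>'_def using yb(3)[of s] zb(3)[of s] by simp
  have \<theta>'c: "continuous_on UNIV \<theta>'" unfolding \<theta>'_def[abs_def]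
    by (intro continuous_intros ycont zcont) (use yb(3) in \<open>auto simp: less_imp_neq[symmetric]\<close>)
  have \<theta>fix: "\<theta> s = s" if "\<zeta> s = 0" for s using that e by (simp add: \<theta>_def y_def E_def)
  have exp\<theta>: "exp (- \<theta> s / \<epsilon>) = y s" for s using e yb(3)[of s] by (simp add: \<theta>_def)
  \<comment> \<open>\<open>\<theta>\<close> is the identity before \<open>0\<close> and after \<open>R\<close>; in between the intermediate value theorem applies\<close>
  have "surj \<theta>"
    unfolding surj_def
  proof
    fix x :: real
    define p q where "p = min x 0" and "q = max x R"
    have "p \<le> max x 0" by (simp add: p_def)
    have pq: "\<theta> p = p" "\<theta> q = q" by (intro \<theta>fix z0; simp add: p_def q_def)+
    show "\<exists>s. x = \<theta> s"
    proof (cases "p \<le> q")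
      case True
      have "\<exists>s\<ge>p. s \<le> q \<and> \<theta> s = x"
        by (rule IVT) (use pq True in \<open>auto simp: p_def q_def intro: DERIV_isCont[OF d\<theta>]\<close>)
      thus ?thesis by auto
    next
      case False
      thus ?thesis by (auto simp: p_def q_def)
    qed
  qed
  then obtain S where \<theta>S: "\<And>t. \<theta> (S t) = t" and S\<theta>: "\<And>s. S (\<theta> s) = s"
    and dS: "\<And>t. (S has_real_derivative inverse (\<theta>' (S t))) (at t)"
    using increasing_diffeo_inverse[OF d\<theta> \<theta>'pos] by metis
  define S' where "S' t = inverse (\<theta>' (S t))" for t
  have dS: "(S has_real_derivative S' t) (at t)" for t unfolding S'_def by (rule dS)
  have S'pos: "0 < S' t" for t using \<theta>'pos by (simp add: S'_def)
  have S'C: "S' t \<le> 3" for t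
    using yb[of "S t"] zb[of "S t"] E0[of "S t"] by (simp add: S'_def \<theta>'_def field_simps)
  have Sc: "continuous_on UNIV S" by (intro continuous_at_imp_continuous_on ballI DERIV_isCont[OF dS])
  have S'c: "continuous_on UNIV S'" unfolding S'_def[abs_def]
    by (intro continuous_intros continuous_on_compose2[OF \<theta>'c Sc]) (use \<theta>'pos in \<open>auto simp: less_imp_neq[symmetric]\<close>)
  have Sm[measurable]: "S \<in> borel_measurable borel" "S' \<in> borel_measurable borel"
    using Sc S'c by (auto intro: borel_measurable_continuous_onI)
  have Sfix: "S s = s" if "\<zeta> s = 0" for s using S\<theta>[of s] \<theta>fix[OF that] by simp
  have S0: "S 0 = 0" and \<theta>0: "\<theta> 0 = 0" by (intro Sfix \<theta>fix z0; simp)+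
  have \<theta>mono: "\<theta> r < \<theta> s \<longleftrightarrow> r < s" for r s
    using DERIV_pos_imp_increasing[of r s \<theta>] DERIV_pos_imp_increasing[of s r \<theta>] d\<theta> \<theta>'pos
    by (metis linorder_neqE_linordered_idom order_less_asym)
  have Spos: "0 < S t \<longleftrightarrow> 0 < t" for t using \<theta>mono[of 0 "S t"] \<theta>0 \<theta>S by simp
  define v where "v t = u (S t)" for t
  define Dv where "Dv t = S' t * D (S t)" for t
  have v: "metric_speed v Dv" unfolding v_def[abs_def] Dv_def[abs_def]
    by (rule metric_speed_reparametrization[OF u dS S'pos S'C S'c S\<theta> \<theta>S S0])
  have [measurable]: "Dv \<in> borel_measurable borel" by (rule metric_speedD(1)[OF v])
  have mdv: "AE t in lborel. 0 < t \<longrightarrow> metric_deriv v t = Dv t" by (rule metric_speed_deriv[OF v])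
  have finv: "AE t in lborel. 0 < t \<longrightarrow> \<phi> (v t) = ereal (\<Psi> (S t))"
    using AE_lborel_substitution[OF dS S'pos S'c S\<theta> \<theta>S fin] by (simp add: Spos v_def)
  note sub = integrable_lborel_substitution[OF d\<theta> \<theta>'pos \<theta>'c \<theta>S S\<theta>]
  have S'\<theta>: "S' (\<theta> s) = y s / z s" for s by (simp add: S'_def S\<theta> \<theta>'_def)
  have ind: "indicator {0<..} (\<theta> s) = (indicator {0<..} s :: real)" for s
    using \<theta>mono[of 0 s] \<theta>0 by (simp add: indicator_def)
  have ybound: "\<bar>(y s)\<^sup>2 / z s\<bar> \<le> 9 / 2 * E s" for s
  proof -
    have "(y s)\<^sup>2 \<le> (3 / 2 * E s)\<^sup>2" using yb[of s] by (intro power_mono) auto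
    also have "\<dots> = 9 / 2 * E s * (E s / 2)" by (simp add: power2_eq_square)
    also have "\<dots> \<le> 9 / 2 * E s * z s" using zb(1)[of s] E0[of s] by (intro mult_left_mono) auto
    finally show ?thesis using zb(3)[of s] by (simp add: divide_le_eq)
  qed
  have zbound: "\<bar>z s\<bar> \<le> 3 / 2 * E s" for s using zb[of s] by simp
  have i1: "integrable lborel (\<lambda>s. indicator {0<..} s * ((y s)\<^sup>2 / z s * (D s)\<^sup>2))"
    by (rule integrable_weighted_mult[OF DE, of _ "9/2"]) (use ybound in \<open>auto simp: E_def\<close>)
  have i2: "integrable lborel (\<lambda>s. indicator {0<..} s * (z s * \<Psi> s))"
    by (rule integrable_weighted_mult[OF PE, of _ "3/2"]) (use zbound in \<open>auto simp: E_def\<close>)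
  \<comment> \<open>the kinetic weight \<open>\<theta>' * y * (1 / \<theta>')\<^sup>2\<close> equals \<open>y\<^sup>2 / z\<close>\<close>
  have eD: "\<theta>' s * (indicator {0<..} (\<theta> s) * (exp (- \<theta> s / \<epsilon>) * (Dv (\<theta> s))\<^sup>2)) = indicator {0<..} s * ((y s)\<^sup>2 / z s * (D s)\<^sup>2)" for s
    unfolding ind exp\<theta> Dv_def S'\<theta> S\<theta> \<theta>'_def using yb(3)[of s] zb(3)[of s]
    by (simp add: power2_eq_square field_simps)
  have eP: "\<theta>' s * (indicator {0<..} (\<theta> s) * (exp (- \<theta> s / \<epsilon>) * \<Psi> (S (\<theta> s)))) = indicator {0<..} s * (z s * \<Psi> s)" for s
    unfolding ind exp\<theta> S\<theta> \<theta>'_def using yb(3)[of s] by simp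
  have jD: "integrable lborel (\<lambda>t. indicator {0<..} t * (exp (- t / \<epsilon>) * (Dv t)\<^sup>2))"
    by (subst sub(1)[symmetric], measurable) (simp only: eD i1)
  have jP: "integrable lborel (\<lambda>t. indicator {0<..} t * (exp (- t / \<epsilon>) * \<Psi> (S t)))"
    by (subst sub(1)[symmetric], measurable) (simp only: eP i2)
  define G where "G t = \<epsilon> / 2 * (Dv t)\<^sup>2 + \<Psi> (S t)" for t
  have [measurable]: "G \<in> borel_measurable borel" unfolding G_def[abs_def] by measurable
  have eG: "indicator {0<..} t * (exp (- t / \<epsilon>) * G t) = \<epsilon> / 2 * (indicator {0<..} t * (exp (- t / \<epsilon>) * (Dv t)\<^sup>2)) + indicator {0<..} t * (exp (- t / \<epsilon>) * \<Psi> (S t))" for t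
    unfolding G_def by (simp add: algebra_simps)
  have jG: "integrable lborel (\<lambda>t. indicator {0<..} t * (exp (- t / \<epsilon>) * G t))"
    unfolding eG by (intro Bochner_Integration.integrable_add integrable_mult_right jD jP)
  have WG: "WED \<phi> \<epsilon> v = ereal (\<integral>t. G t \<partial>mu_weight \<epsilon>)"
    unfolding WED_def
  proof (rule ext_integral_eq_integral)
    show "AE t in mu_weight \<epsilon>. ereal (\<epsilon> / 2 * (metric_deriv v t)\<^sup>2) + \<phi> (v t) = ereal (G t)"
      by (rule AE_mu_weight) (use mdv finv in \<open>eventually_elim, auto simp: G_def\<close>)
    show "integrable (mu_weight \<epsilon>) G" using jG by (subst mu_weight_integral(1)[OF e]) auto
  qed
  have IG: "(\<integral>t. G t \<partial>mu_weight \<epsilon>) = 1 / \<epsilon> * (\<integral>s. indicator {0<..} s * (\<epsilon> / 2 * (D s)\<^sup>2 * ((y s)\<^sup>2 / z s) + \<Psi> s * z s) \<partial>lborel)"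
  proof -
    have "(\<integral>t. G t \<partial>mu_weight \<epsilon>) = 1 / \<epsilon> * (\<integral>t. indicator {0<..} t * (exp (- t / \<epsilon>) * G t) \<partial>lborel)"
      by (rule mu_weight_integral(2)[OF e]) measurable
    also have "(\<integral>t. indicator {0<..} t * (exp (- t / \<epsilon>) * G t) \<partial>lborel)
      = (\<integral>s. \<theta>' s * (indicator {0<..} (\<theta> s) * (exp (- \<theta> s / \<epsilon>) * G (\<theta> s))) \<partial>lborel)"
      by (rule sub(2)[symmetric]) measurable
    also have "\<dots> = (\<integral>s. indicator {0<..} s * (\<epsilon> / 2 * (D s)\<^sup>2 * ((y s)\<^sup>2 / z s) + \<Psi> s * z s) \<partial>lborel)"
    proof (rule Bochner_Integration.integral_cong[OF refl])
      fix s
      have "\<theta>' s * (indicator {0<..} (\<theta> s) * (exp (- \<theta> s / \<epsilon>) * G (\<theta> s)))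
        = \<epsilon> / 2 * (\<theta>' s * (indicator {0<..} (\<theta> s) * (exp (- \<theta> s / \<epsilon>) * (Dv (\<theta> s))\<^sup>2))) + \<theta>' s * (indicator {0<..} (\<theta> s) * (exp (- \<theta> s / \<epsilon>) * \<Psi> (S (\<theta> s))))"
        unfolding eG by (simp add: algebra_simps)
      also have "\<dots> = indicator {0<..} s * (\<epsilon> / 2 * (D s)\<^sup>2 * ((y s)\<^sup>2 / z s) + \<Psi> s * z s)"
        unfolding eD eP by (simp add: algebra_simps)
      finally show "\<theta>' s * (indicator {0<..} (\<theta> s) * (exp (- \<theta> s / \<epsilon>) * G (\<theta> s))) = indicator {0<..} s * (\<epsilon> / 2 * (D s)\<^sup>2 * ((y s)\<^sup>2 / z s) + \<Psi> s * z s)" .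
    qed
    finally show ?thesis .
  qed
  have mdfin: "(\<integral>\<^sup>+ t. ennreal ((metric_deriv v t)\<^sup>2) \<partial>mu_weight \<epsilon>) < \<infinity>"
  proof -
    have "AE t in mu_weight \<epsilon>. metric_deriv v t = Dv t" by (rule AE_mu_weight[OF mdv])
    hence "(\<integral>\<^sup>+ t. ennreal ((metric_deriv v t)\<^sup>2) \<partial>mu_weight \<epsilon>) = (\<integral>\<^sup>+ t. ennreal (norm ((Dv t)\<^sup>2)) \<partial>mu_weight \<epsilon>)"
      by (intro nn_integral_cong_AE) (auto elim!: eventually_mono)
    also have "\<dots> < \<infinity>"
    proof -
      have "integrable (mu_weight \<epsilon>) (\<lambda>t. (Dv t)\<^sup>2)" using jD by (subst mu_weight_integral(1)[OF e]) auto
      thus ?thesis unfolding integrable_iff_bounded by blast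
    qed
    finally show ?thesis .
  qed
  show ?thesis
  proof (intro exI[of _ v] conjI)
    show "AC_loc 2 {0..} v" by (rule metric_speed_AC_loc[OF v])
    show "\<forall>t. \<zeta> t = 0 \<longrightarrow> v t = u t" using Sfix by (auto simp: v_def)
    show "WED \<phi> \<epsilon> v = ereal (1 / \<epsilon> * (\<integral>s. indicator {0<..} s *
      (\<epsilon> / 2 * (D s)\<^sup>2 * ((exp (- s / \<epsilon>) - \<tau> * \<zeta> s / \<epsilon>)\<^sup>2 / (exp (- s / \<epsilon>) + \<tau> * \<zeta>' s))
        + \<Psi> s * (exp (- s / \<epsilon>) + \<tau> * \<zeta>' s)) \<partial>lborel))"
      unfolding WG IG y_def z_def E_def ..
  qed (rule mdfin)
qed

lemma quadratic_nonneg_imp_linear_zero: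
  fixes L K \<tau>0 :: real
  assumes "0 < \<tau>0" "0 \<le> K" and nn: "\<And>\<tau>. \<bar>\<tau>\<bar> \<le> \<tau>0 \<Longrightarrow> 0 \<le> \<tau> * L + \<tau>\<^sup>2 * K"
  shows "L = 0"
proof -
  have aux: "M \<le> 0" if M: "\<And>\<tau>. 0 < \<tau> \<Longrightarrow> \<tau> \<le> \<tau>0 \<Longrightarrow> \<tau> * M \<le> \<tau>\<^sup>2 * K" for M
  proof (rule ccontr)
    assume "\<not> M \<le> 0"
    \<comment> \<open>small enough that the quadratic term is beaten by the linear one\<close>
    define p where "p = min \<tau>0 (M / (2 * (K + 1)))"
    have p: "0 < p" "p \<le> \<tau>0" using \<open>\<not> M \<le> 0\<close> assms by (auto simp: p_def)
    have "p * M \<le> p * (p * K)" using M[OF p] by (simp add: power2_eq_square mult.assoc)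
    hence "M \<le> p * K" using p by simp
    also have "\<dots> \<le> M / (2 * (K + 1)) * K" using assms by (intro mult_right_mono) (auto simp: p_def)
    also have "\<dots> < M"
    proof -
      have "0 < M" "0 \<le> K * M" using \<open>\<not> M \<le> 0\<close> assms(2) by auto
      hence "M * K < M * (2 * (K + 1))" by (simp add: algebra_simps)
      thus ?thesis using assms(2) by (simp add: divide_less_eq)
    qed
    finally show False by simp
  qed
  have "L \<le> 0"
  proof (rule aux)
    fix \<tau> assume "0 < \<tau>" "\<tau> \<le> \<tau>0"
    thus "\<tau> * L \<le> \<tau>\<^sup>2 * K" using nn[of "- \<tau>"] by simp
  qed
  moreover have "- L \<le> 0"
  proof (rule aux)
    fix \<tau> assume "0 < \<tau>" "\<tau> \<le> \<tau>0"
    thus "\<tau> * - L \<le> \<tau>\<^sup>2 * K" using nn[of \<tau>] by simp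
  qed
  ultimately show ?thesis by simp
qed

text \<open>In the formula of \<open>inner_variation\<close> the potential part is affine in \<open>\<tau>\<close>, and the kinetic part is
  affine up to the explicit remainder \<open>(a + b)\<^sup>2 / (E + b)\<close> with \<open>a = \<tau> * \<zeta> / \<epsilon>\<close> and \<open>b = \<tau> * \<zeta>'\<close>,
  which is at most a multiple of \<open>\<tau>\<^sup>2 * E\<close>. Both signs of \<open>\<tau>\<close> being admissible, the linear term
  vanishes.\<close>
lemma first_variation_vanishes:
  fixes u :: "real \<Rightarrow> 'a::metric_space"
  assumes e: "0 < \<epsilon>" and u: "metric_speed u D"
    and Pm[measurable]: "\<Psi> \<in> borel_measurable borel"
    and fin: "AE t in lborel. 0 < t \<longrightarrow> \<phi> (u t) = ereal (\<Psi> t)"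
    and DE: "integrable lborel (\<lambda>t. indicator {0<..} t * (exp (- t / \<epsilon>) * (D t)\<^sup>2))"
    and PE: "integrable lborel (\<lambda>t. indicator {0<..} t * (exp (- t / \<epsilon>) * \<Psi> t))"
    and z: "\<And>t. (\<zeta> has_real_derivative \<zeta>' t) (at t)" and z': "continuous_on UNIV \<zeta>'"
    and z0: "\<And>t. t \<le> 0 \<Longrightarrow> \<zeta> t = 0" "\<And>t. R \<le> t \<Longrightarrow> \<zeta> t = 0"
    and b: "\<And>t. \<bar>\<zeta> t\<bar> \<le> c * exp (- t / \<epsilon>)" "\<And>t. \<bar>\<zeta>' t\<bar> \<le> c * exp (- t / \<epsilon>)"
    and minimal: "\<And>v. AC_loc 2 {0..} v \<Longrightarrow> (\<And>t. \<zeta> t = 0 \<Longrightarrow> v t = u t) \<Longrightarrow>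
      (\<integral>\<^sup>+ t. ennreal ((metric_deriv v t)\<^sup>2) \<partial>mu_weight \<epsilon>) < \<infinity> \<Longrightarrow> WED \<phi> \<epsilon> u \<le> WED \<phi> \<epsilon> v"
  shows "(\<integral>s. indicator {0<..} s * (\<epsilon> / 2 * (D s)\<^sup>2 * (- 2 * \<zeta> s / \<epsilon> - \<zeta>' s) + \<Psi> s * \<zeta>' s) \<partial>lborel) = 0"
proof -
  note [measurable] = metric_speedD(1)[OF u]
  define E where "E s = exp (- s / \<epsilon>)" for s :: real
  have E0: "0 < E s" for s by (simp add: E_def)
  have Ec: "continuous_on UNIV E" unfolding E_def[abs_def] by (intro continuous_intros) (use e in auto)
  have zc: "continuous_on UNIV \<zeta>" by (intro continuous_at_imp_continuous_on ballI DERIV_isCont[OF z])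
  have [measurable]: "E \<in> borel_measurable borel" "\<zeta> \<in> borel_measurable borel" "\<zeta>' \<in> borel_measurable borel"
    using Ec zc z' by (auto intro: borel_measurable_continuous_onI)
  have b': "\<bar>\<zeta> t\<bar> \<le> c * E t" "\<bar>\<zeta>' t\<bar> \<le> c * E t" for t using b by (auto simp: E_def)
  have c0: "0 \<le> c" using b'(1)[of 0] E0[of 0] by (smt (verit) mult_neg_pos)
  \<comment> \<open>ensures \<open>\<tau>0 * c / \<epsilon> \<le> 1 / 2\<close> and \<open>\<tau>0 * c \<le> 1 / 2\<close>, the smallness that \<open>inner_variation\<close> requires\<close>
  define \<tau>0 where "\<tau>0 = min \<epsilon> 1 / (2 * (c + 1))"
  have \<tau>0: "0 < \<tau>0" using e c0 by (simp add: \<tau>0_def)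
  have \<tau>c: "\<tau>0 * c / \<epsilon> \<le> 1 / 2" "\<tau>0 * c \<le> 1 / 2"
  proof -
    define q where "q = c / (2 * (c + 1))"
    have q: "q \<le> 1 / 2" using c0 by (simp add: q_def field_simps)
    have q': "\<tau>0 * c = min \<epsilon> 1 * q" by (simp add: \<tau>0_def q_def)
    have "0 \<le> q" using c0 by (simp add: q_def)
    hence "\<tau>0 * c \<le> \<epsilon> * q" "\<tau>0 * c \<le> 1 * q" unfolding q' by (intro mult_right_mono; simp)+
    moreover have "\<epsilon> * q \<le> \<epsilon> * (1 / 2)" using q e by (intro mult_left_mono) auto
    ultimately have "\<tau>0 * c \<le> \<epsilon> * (1 / 2)" "\<tau>0 * c \<le> 1 / 2" using q by linarith+
    thus "\<tau>0 * c / \<epsilon> \<le> 1 / 2" "\<tau>0 * c \<le> 1 / 2" using e by (auto simp: field_simps)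
  qed
  have small: "\<bar>\<tau> * \<zeta> t / \<epsilon>\<bar> \<le> E t / 2" "\<bar>\<tau> * \<zeta>' t\<bar> \<le> E t / 2" if "\<bar>\<tau>\<bar> \<le> \<tau>0" for \<tau> t
  proof -
    have "\<bar>\<tau> * \<zeta> t\<bar> \<le> \<tau>0 * (c * E t)" "\<bar>\<tau> * \<zeta>' t\<bar> \<le> \<tau>0 * (c * E t)"
      unfolding abs_mult using that b'[of t] \<tau>0 by (auto intro!: mult_mono)
    moreover have "\<tau>0 * c / \<epsilon> * E t \<le> 1 / 2 * E t" "\<tau>0 * c * E t \<le> 1 / 2 * E t"
      by (rule mult_right_mono[OF \<tau>c(1) less_imp_le[OF E0]], rule mult_right_mono[OF \<tau>c(2) less_imp_le[OF E0]])
    ultimately have 1: "\<bar>\<tau> * \<zeta> t\<bar> \<le> \<tau>0 * c * E t" "\<bar>\<tau> * \<zeta>' t\<bar> \<le> 1 / 2 * E t" 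
      and 2: "\<tau>0 * c * E t / \<epsilon> \<le> 1 / 2 * E t" by (simp_all add: mult.assoc)
    have "\<bar>\<tau> * \<zeta> t / \<epsilon>\<bar> = \<bar>\<tau> * \<zeta> t\<bar> / \<epsilon>" using e by simp
    also have "\<dots> \<le> \<tau>0 * c * E t / \<epsilon>" using 1(1) e by (intro divide_right_mono) auto
    also note 2
    finally show "\<bar>\<tau> * \<zeta> t / \<epsilon>\<bar> \<le> E t / 2" by simp
    show "\<bar>\<tau> * \<zeta>' t\<bar> \<le> E t / 2" using 1(2) by simp
  qed
  define P where "P s = \<epsilon> / 2 * (D s)\<^sup>2" for s
  define J where "J \<tau> = (\<integral>s. indicator {0<..} s * (P s * ((E s - \<tau> * \<zeta> s / \<epsilon>)\<^sup>2 / (E s + \<tau> * \<zeta>' s)) + \<Psi> s * (E s + \<tau> * \<zeta>' s)) \<partial>lborel)" for \<tau>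
  define L where "L = (\<integral>s. indicator {0<..} s * (P s * (- 2 * \<zeta> s / \<epsilon> - \<zeta>' s) + \<Psi> s * \<zeta>' s) \<partial>lborel)"
  define Q where "Q = (\<integral>s. indicator {0<..} s * (E s * P s) \<partial>lborel)"
  define K where "K = 2 * (c / \<epsilon> + c)\<^sup>2 * Q"
  have Pm'[measurable]: "P \<in> borel_measurable borel" unfolding P_def[abs_def] by measurable
  have PEi: "integrable lborel (\<lambda>t. indicator {0<..} t * (exp (- t / \<epsilon>) * P t))"
  proof -
    have "(\<lambda>t. indicator {0<..} t * (exp (- t / \<epsilon>) * P t)) = (\<lambda>t. \<epsilon> / 2 * (indicator {0<..} t * (exp (- t / \<epsilon>) * (D t)\<^sup>2)))"
      by (auto simp: P_def fun_eq_iff)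
    thus ?thesis using integrable_mult_right[OF DE, of "\<epsilon> / 2"] by simp
  qed
  have "0 \<le> E s * P s" for s using e less_imp_le[OF E0[of s]] unfolding P_def by (intro mult_nonneg_nonneg) auto
  hence Q0: "0 \<le> Q" unfolding Q_def by (intro Bochner_Integration.integral_nonneg) (simp add: indicator_def)
  have K0: "0 \<le> K" using Q0 by (simp add: K_def)
  have JJ: "J \<tau> \<le> J 0 + \<tau> * L + \<tau>\<^sup>2 * K" if \<tau>: "\<bar>\<tau>\<bar> \<le> \<tau>0" for \<tau>
  proof -
    have ap: "E s / 2 \<le> E s + \<tau> * \<zeta>' s" for s using small(2)[OF \<tau>, of s] unfolding abs_le_iff by linarith
    have ap0: "0 < E s + \<tau> * \<zeta>' s" for s using ap[of s] E0[of s] by linarith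
    have expand: "(E s - \<tau> * \<zeta> s / \<epsilon>)\<^sup>2 / (E s + \<tau> * \<zeta>' s) =
      E s + \<tau> * (- 2 * \<zeta> s / \<epsilon> - \<zeta>' s) + \<tau>\<^sup>2 * ((\<zeta> s / \<epsilon> + \<zeta>' s)\<^sup>2 / (E s + \<tau> * \<zeta>' s))" for s
    proof -
      define a where "a = \<zeta> s / \<epsilon>"
      have "(E s - \<tau> * a)\<^sup>2 = (E s + \<tau> * (- 2 * a - \<zeta>' s)) * (E s + \<tau> * \<zeta>' s) + \<tau>\<^sup>2 * (a + \<zeta>' s)\<^sup>2"
        by (simp add: power2_eq_square algebra_simps)
      hence "(E s - \<tau> * a)\<^sup>2 / (E s + \<tau> * \<zeta>' s) = E s + \<tau> * (- 2 * a - \<zeta>' s) + \<tau>\<^sup>2 * (a + \<zeta>' s)\<^sup>2 / (E s + \<tau> * \<zeta>' s)"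
        using ap0[of s] by (simp add: add_divide_distrib)
      thus ?thesis by (simp add: a_def)
    qed
    define r where "r s = (\<zeta> s / \<epsilon> + \<zeta>' s)\<^sup>2 / (E s + \<tau> * \<zeta>' s)" for s
    have rb: "\<bar>r s\<bar> \<le> 2 * (c / \<epsilon> + c)\<^sup>2 * E s" for s
    proof -
      have "\<bar>\<zeta> s / \<epsilon> + \<zeta>' s\<bar> \<le> \<bar>\<zeta> s\<bar> / \<epsilon> + \<bar>\<zeta>' s\<bar>" using e abs_triangle_ineq[of "\<zeta> s / \<epsilon>" "\<zeta>' s"] by simp
      also have "\<dots> \<le> (c * E s) / \<epsilon> + c * E s" using b'[of s] e by (intro add_mono divide_right_mono) auto
      also have "\<dots> = (c / \<epsilon> + c) * E s" by (simp add: algebra_simps)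
      finally have "\<bar>\<zeta> s / \<epsilon> + \<zeta>' s\<bar>\<^sup>2 \<le> ((c / \<epsilon> + c) * E s)\<^sup>2" by (rule power_mono) simp
      hence "(\<zeta> s / \<epsilon> + \<zeta>' s)\<^sup>2 \<le> ((c / \<epsilon> + c) * E s)\<^sup>2" by (simp only: power2_abs)
      also have "\<dots> = 2 * (c / \<epsilon> + c)\<^sup>2 * E s * (E s / 2)" by (simp add: power2_eq_square)
      also have "\<dots> \<le> 2 * (c / \<epsilon> + c)\<^sup>2 * E s * (E s + \<tau> * \<zeta>' s)" using ap[of s] E0[of s] by (intro mult_left_mono) auto
      finally show ?thesis using ap0[of s] by (simp add: r_def divide_le_eq)
    qed
    have r0: "0 \<le> r s" for s using ap0[of s] by (simp add: r_def)
    have [measurable]: "r \<in> borel_measurable borel" unfolding r_def[abs_def] by measurable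
    have i1: "integrable lborel (\<lambda>s. indicator {0<..} s * (E s * P s))" using PEi by (simp add: E_def)
    have i2: "integrable lborel (\<lambda>s. indicator {0<..} s * (E s * \<Psi> s))" using PE by (simp add: E_def)
    have i3: "integrable lborel (\<lambda>s. indicator {0<..} s * ((- 2 * \<zeta> s / \<epsilon> - \<zeta>' s) * P s))"
    proof (rule integrable_weighted_mult[OF PEi, of _ "2 * c / \<epsilon> + c"])
      fix s
      have "\<bar>- 2 * \<zeta> s / \<epsilon> - \<zeta>' s\<bar> \<le> 2 * \<bar>\<zeta> s\<bar> / \<epsilon> + \<bar>\<zeta>' s\<bar>"
        using e abs_triangle_ineq4[of "- 2 * \<zeta> s / \<epsilon>" "\<zeta>' s"] by (simp add: abs_mult)
      also have "\<dots> \<le> 2 * (c * E s) / \<epsilon> + c * E s" using b'[of s] e by (intro add_mono divide_right_mono mult_left_mono) auto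
      also have "\<dots> = (2 * c / \<epsilon> + c) * exp (- s / \<epsilon>)" by (simp add: E_def algebra_simps)
      finally show "\<bar>- 2 * \<zeta> s / \<epsilon> - \<zeta>' s\<bar> \<le> (2 * c / \<epsilon> + c) * exp (- s / \<epsilon>)" .
    qed measurable
    have i4: "integrable lborel (\<lambda>s. indicator {0<..} s * (\<zeta>' s * \<Psi> s))"
      by (rule integrable_weighted_mult[OF PE, of _ c]) (use b(2) in auto)
    have i5: "integrable lborel (\<lambda>s. indicator {0<..} s * (r s * P s))"
      by (rule integrable_weighted_mult[OF PEi, of _ "2 * (c / \<epsilon> + c)\<^sup>2"]) (use rb in \<open>auto simp: E_def\<close>)
    have L_eq: "L = (\<integral>s. indicator {0<..} s * ((- 2 * \<zeta> s / \<epsilon> - \<zeta>' s) * P s) \<partial>lborel) + (\<integral>s. indicator {0<..} s * (\<zeta>' s * \<Psi> s) \<partial>lborel)"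
    proof -
      have "L = (\<integral>s. indicator {0<..} s * ((- 2 * \<zeta> s / \<epsilon> - \<zeta>' s) * P s) + indicator {0<..} s * (\<zeta>' s * \<Psi> s) \<partial>lborel)"
        unfolding L_def by (intro Bochner_Integration.integral_cong) (auto simp: indicator_def mult.commute)
      thus ?thesis using Bochner_Integration.integral_add[OF i3 i4] by simp
    qed
    have J0: "J 0 = Q + (\<integral>s. indicator {0<..} s * (E s * \<Psi> s) \<partial>lborel)"
    proof -
      have "J 0 = (\<integral>s. indicator {0<..} s * (E s * P s) + indicator {0<..} s * (E s * \<Psi> s) \<partial>lborel)"
        unfolding J_def using E0 by (intro Bochner_Integration.integral_cong) (auto simp: indicator_def mult.commute power2_eq_square less_imp_neq[symmetric])
      thus ?thesis using Bochner_Integration.integral_add[OF i1 i2] by (simp add: Q_def)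
    qed
    have "J \<tau> = (\<integral>s. (indicator {0<..} s * (E s * P s) + indicator {0<..} s * (E s * \<Psi> s))
       + (\<tau> * (indicator {0<..} s * ((- 2 * \<zeta> s / \<epsilon> - \<zeta>' s) * P s) + indicator {0<..} s * (\<zeta>' s * \<Psi> s))
       + \<tau>\<^sup>2 * (indicator {0<..} s * (r s * P s))) \<partial>lborel)"
      unfolding J_def expand r_def[symmetric]
      by (intro Bochner_Integration.integral_cong refl) (simp add: algebra_simps)
    also have "\<dots> = J 0 + (\<tau> * L + \<tau>\<^sup>2 * (\<integral>s. indicator {0<..} s * (r s * P s) \<partial>lborel))"
      unfolding J0 Q_def L_eq using i1 i2 i3 i4 i5 by simp
    also have "(\<integral>s. indicator {0<..} s * (r s * P s) \<partial>lborel) \<le> K"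
    proof -
      have "(\<integral>s. indicator {0<..} s * (r s * P s) \<partial>lborel) \<le> (\<integral>s. 2 * (c / \<epsilon> + c)\<^sup>2 * (indicator {0<..} s * (E s * P s)) \<partial>lborel)"
      proof (rule integral_mono[OF i5 integrable_mult_right[OF i1]])
        fix s
        have "r s * P s \<le> 2 * (c / \<epsilon> + c)\<^sup>2 * E s * P s"
          using rb[of s] r0[of s] e by (intro mult_right_mono) (auto simp: P_def)
        thus "indicator {0<..} s * (r s * P s) \<le> 2 * (c / \<epsilon> + c)\<^sup>2 * (indicator {0<..} s * (E s * P s))"
          by (simp add: indicator_def mult.assoc)
      qed
      thus ?thesis by (simp add: K_def Q_def)
    qed
    finally show ?thesis by (simp add: mult_left_mono)
  qed
  have "L = 0"
  proof (rule quadratic_nonneg_imp_linear_zero[OF \<tau>0 K0])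
    fix \<tau> assume \<tau>: "\<bar>\<tau>\<bar> \<le> \<tau>0"
    obtain v where v: "AC_loc 2 {0..} v" "\<And>t. \<zeta> t = 0 \<Longrightarrow> v t = u t"
      "(\<integral>\<^sup>+ t. ennreal ((metric_deriv v t)\<^sup>2) \<partial>mu_weight \<epsilon>) < \<infinity>" "WED \<phi> \<epsilon> v = ereal (1 / \<epsilon> * J \<tau>)"
      using inner_variation[OF e u Pm fin DE PE z z' z0, of R \<tau>] small[OF \<tau>]
      unfolding J_def P_def E_def by blast
    \<comment> \<open>the vanishing variation expresses the value at \<open>u\<close> by the same formula\<close>
    obtain w where w: "\<And>t. w t = u t" "WED \<phi> \<epsilon> w = ereal (1 / \<epsilon> * J 0)"
      using inner_variation[OF e u Pm fin DE PE, of "\<lambda>_. 0" "\<lambda>_. 0" 0 0]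
      unfolding J_def P_def E_def by auto
    have "w = u" using w(1) by auto
    have "WED \<phi> \<epsilon> u \<le> WED \<phi> \<epsilon> v" by (rule minimal[OF v(1,2,3)])
    hence "1 / \<epsilon> * J 0 \<le> 1 / \<epsilon> * J \<tau>" using v(4) w(2) \<open>w = u\<close> by simp
    hence "J 0 \<le> J \<tau>" using e by (simp add: divide_le_cancel)
    thus "0 \<le> \<tau> * L + \<tau>\<^sup>2 * K" using JJ[OF \<tau>] by simp
  qed
  thus ?thesis by (simp add: L_def P_def)
qed

section \<open>Test functions and admissible curves\<close>

lemma deriv_eq_0_outside_support:
  assumes K: "closed K" "\<And>x. x \<notin> K \<Longrightarrow> \<eta> x = (0::real)" and "t \<notin> K"
  shows "deriv \<eta> t = 0"
proof -
  have "((\<lambda>_. 0) has_field_derivative 0) (at t)" by simp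
  hence "(\<eta> has_field_derivative 0) (at t)"
    by (rule has_field_derivative_transform_within_open[of _ _ _ "- K"]) (use assms in auto)
  thus ?thesis by (rule DERIV_imp_deriv)
qed

lemma test_functionE:
  assumes "test_function I \<eta>"
  obtains K where "compact K" "K \<subseteq> I" "\<And>t. t \<notin> K \<Longrightarrow> \<eta> t = 0" "\<And>t. t \<notin> K \<Longrightarrow> deriv \<eta> t = 0"
    "\<And>t. (\<eta> has_real_derivative deriv \<eta> t) (at t)" "continuous_on UNIV (deriv \<eta>)"
proof -
  obtain K where K: "compact K" "K \<subseteq> I" "\<And>t. t \<notin> K \<Longrightarrow> \<eta> t = 0"
    using assms unfolding test_function_def by auto
  have d: "(deriv ^^ n) \<eta> field_differentiable at t" for n t using assms unfolding test_function_def by auto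
  have "(\<eta> has_real_derivative deriv \<eta> t) (at t)" for t
    using d[of 0 t] by (simp add: DERIV_deriv_iff_field_differentiable)
  moreover have "isCont (deriv \<eta>) t" for t
    using field_differentiable_imp_continuous_at[OF d[of 1 t]] by simp
  hence "continuous_on UNIV (deriv \<eta>)" by (simp add: continuous_at_imp_continuous_on)
  ultimately show ?thesis using K deriv_eq_0_outside_support[OF compact_imp_closed[OF K(1)], of \<eta>] that by blast
qed

text \<open>The weight is bounded away from zero on a compact set. Bounding the test function by the weight
  itself makes all integrands of the variation integrable at once, without further reference to the
  support.\<close>
lemma compact_support_bounded_by_exp:
  fixes f :: "real \<Rightarrow> real"
  assumes "compact K" "continuous_on UNIV f" "\<And>t. t \<notin> K \<Longrightarrow> f t = 0"
  shows "\<exists>c. \<forall>t. \<bar>f t\<bar> \<le> c * exp (- t / \<epsilon>)"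
proof -
  have "continuous_on UNIV (\<lambda>t. f t * exp (t / \<epsilon>))"
  proof (cases "\<epsilon> = 0")
    case False thus ?thesis by (intro continuous_intros assms(2)) auto
  qed (use assms(2) in simp)
  hence "bounded ((\<lambda>t. f t * exp (t / \<epsilon>)) ` K)"
    by (intro compact_imp_bounded compact_continuous_image assms(1)) (rule continuous_on_subset, auto)
  then obtain c where c: "0 < c" "\<And>t. t \<in> K \<Longrightarrow> norm (f t * exp (t / \<epsilon>)) \<le> c"
    unfolding bounded_pos by auto
  have "\<bar>f t\<bar> \<le> c * exp (- t / \<epsilon>)" for t
  proof (cases "t \<in> K")
    case True
    hence "\<bar>f t\<bar> * exp (t / \<epsilon>) * exp (- (t / \<epsilon>)) \<le> c * exp (- (t / \<epsilon>))"
      using c(2)[OF True] by (intro mult_right_mono) (auto simp: abs_mult)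
    thus ?thesis by (simp add: mult.assoc exp_minus_inverse)
  qed (use assms(3) c in auto)
  thus ?thesis by blast
qed

lemma admissible_finite_horizon:
  "v \<in> admissible \<epsilon> (ereal r) ubar \<longleftrightarrow> AC_loc 2 {0..} v \<and> v 0 = ubar \<and> (\<forall>t\<ge>r. v t = v r)"
  by (simp add: admissible_def)

text \<open>For an infinite horizon this is part of admissibility. For a finite horizon the curve rests after
  \<open>T\<close>, so its speed vanishes there and local square integrability is enough.\<close>
lemma admissible_weighted_speed_integrable:
  fixes u :: "real \<Rightarrow> 'a::metric_space"
  assumes e: "0 < \<epsilon>" and T: "0 < T" and adm: "u \<in> admissible \<epsilon> T ubar" and u: "metric_speed u D"
  shows "integrable lborel (\<lambda>t. indicator {0<..} t * (exp (- t / \<epsilon>) * (D t)\<^sup>2))"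
proof (cases "T = \<infinity>")
  case True
  note [measurable] = metric_speedD(1)[OF u]
  have fin: "(\<integral>\<^sup>+ t. ennreal ((metric_deriv u t)\<^sup>2) \<partial>mu_weight \<epsilon>) < \<infinity>"
    using adm True by (simp add: admissible_def)
  have "AE t in mu_weight \<epsilon>. metric_deriv u t = D t" by (rule AE_mu_weight[OF metric_speed_deriv[OF u]])
  hence "(\<integral>\<^sup>+ t. ennreal ((metric_deriv u t)\<^sup>2) \<partial>mu_weight \<epsilon>) = (\<integral>\<^sup>+ t. ennreal (norm ((D t)\<^sup>2)) \<partial>mu_weight \<epsilon>)"
    by (intro nn_integral_cong_AE) (auto elim!: eventually_mono)
  hence "integrable (mu_weight \<epsilon>) (\<lambda>t. (D t)\<^sup>2)"
    using fin by (intro integrableI_bounded borel_measurable_mu_weight) auto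
  thus ?thesis by (subst (asm) mu_weight_integral(1)[OF e]) auto
next
  case False
  note D = metric_speedD[OF u]
  note [measurable] = D(1)
  obtain r where r: "T = ereal r" using T False by (cases T) auto
  have const: "u t = u r" if "r \<le> t" for t using adm that unfolding r admissible_finite_horizon by blast
  have r0: "0 < r" using T r by simp
  have D0: "AE t in lborel. r < t \<longrightarrow> D t = 0"
    using D(5)
  proof eventually_elim
    case (elim t)
    show ?case
    proof
      assume t: "r < t"
      hence l: "((\<lambda>s. dist (u s) (u t) / \<bar>t - s\<bar>) \<longlongrightarrow> D t) (at t)" using elim r0 by simp
      have "\<forall>\<^sub>F s in at t. s \<in> {r<..}" using t by (intro eventually_at_in_open') auto
      hence "\<forall>\<^sub>F s in at t. dist (u s) (u t) / \<bar>t - s\<bar> = 0"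
      proof eventually_elim
        case (elim s)
        have "u s = u r" "u t = u r" using elim t by (auto intro: const)
        thus ?case by simp
      qed
      from Lim_transform_eventually[OF l this] have "((\<lambda>_. 0) \<longlongrightarrow> D t) (at t)" .
      thus "D t = 0" using LIM_unique[OF _ tendsto_const] by blast
    qed
  qed
  have i: "integrable lborel (\<lambda>t. indicator {0..r} t * (D t)\<^sup>2)"
    using D(3)[of r] by (simp add: set_integrable_def)
  show ?thesis
  proof (rule Bochner_Integration.integrable_bound[OF i])
    show "AE t in lborel. norm (indicat_real {0<..} t * (exp (- t / \<epsilon>) * (D t)\<^sup>2)) \<le> norm (indicat_real {0..r} t * (D t)\<^sup>2)"
      using D0
    proof eventually_elim
      case (elim t)
      show ?case
      proof (cases "0 < t \<and> t \<le> r")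
        case True
        hence "exp (- t / \<epsilon>) * (D t)\<^sup>2 \<le> 1 * (D t)\<^sup>2" using e by (intro mult_right_mono) auto
        thus ?thesis using True by simp
      qed (use elim in \<open>auto simp: indicator_def\<close>)
    qed
  qed measurable
qed

text \<open>On \<open>(0,R)\<close> the weight is at least \<open>exp (- R / \<epsilon>)\<close> and can be dropped.\<close>
lemma set_integrable_of_weighted:
  fixes f g :: "real \<Rightarrow> real"
  assumes f: "integrable lborel (\<lambda>t. indicator {0<..} t * (exp (- t / \<epsilon>) * f t))"
    and [measurable]: "f \<in> borel_measurable borel" and e: "0 < \<epsilon>" and "0 \<le> R"
    and g: "set_borel_measurable lborel {0<..<R} g"
    and fg: "AE t in lborel. 0 < t \<and> t < R \<longrightarrow> g t = f t"
  shows "set_integrable lborel {0<..<R} g"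
  unfolding set_integrable_def
proof (rule Bochner_Integration.integrable_bound[OF integrable_mult_right[OF f, of "exp (R / \<epsilon>)"]])
  show "AE t in lborel. norm (indicat_real {0<..<R} t *\<^sub>R g t) \<le> norm (exp (R / \<epsilon>) * (indicat_real {0<..} t * (exp (- t / \<epsilon>) * f t)))"
    using fg
  proof eventually_elim
    case (elim t)
    show ?case
    proof (cases "0 < t \<and> t < R")
      case True
      hence "1 \<le> exp (R / \<epsilon> + - t / \<epsilon>)" using e by (simp add: divide_right_mono)
      hence "1 \<le> exp (R / \<epsilon>) * exp (- t / \<epsilon>)" by (simp only: exp_add)
      hence "1 * \<bar>f t\<bar> \<le> exp (R / \<epsilon>) * exp (- t / \<epsilon>) * \<bar>f t\<bar>" by (rule mult_right_mono) simp
      thus ?thesis using True elim by (simp add: abs_mult mult.assoc)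
    qed (auto simp: indicator_def)
  qed
qed (use g in \<open>simp add: set_borel_measurable_def\<close>)

section \<open>The energy identity\<close>

theorem proposition3p7:
  fixes \<sigma> :: "'a::complete_space topology"
    and \<phi> :: "'a \<Rightarrow> ereal"
    and ustar ubar :: 'a
    and A B \<epsilon> :: real
    and T :: ereal
    and u :: "real \<Rightarrow> 'a"
  assumes "compatible \<sigma>"
    and "proper_functional \<phi>"
    and "LSCC \<sigma> \<phi> ustar A B"
    and "\<epsilon> > 0"
    and "1 / (16 * \<epsilon>) \<ge> B"
    and "T > 0"
    and "u \<in> WED_minimizers \<phi> \<epsilon> T ubar"
  shows "(AE t in lborel. 0 < t \<and> ereal t < T \<longrightarrow> \<bar>energy \<phi> \<epsilon> u t\<bar> \<noteq> \<infinity>) \<and>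
    (if T = \<infinity> then W11_loc (\<lambda>t. real_of_ereal (energy \<phi> \<epsilon> u t))
     else W11 {0<..<real_of_ereal T} (\<lambda>t. real_of_ereal (energy \<phi> \<epsilon> u t))) \<and>
    has_distr_deriv {t. 0 < t \<and> ereal t < T}
      (\<lambda>t. real_of_ereal (energy \<phi> \<epsilon> u t)) (\<lambda>t. - (metric_deriv u t)\<^sup>2)"
proof -
  note e = \<open>\<epsilon> > 0\<close>
  have lsc: "lower_semicont \<sigma> \<phi>" and co: "coercive \<phi> ustar A B" using assms(3) by (auto simp: LSCC_def)
  have adm: "u \<in> admissible \<epsilon> T ubar" and min: "\<And>v. v \<in> admissible \<epsilon> T ubar \<Longrightarrow> WED \<phi> \<epsilon> u \<le> WED \<phi> \<epsilon> v"
    and inf: "(INF v\<in>admissible \<epsilon> T ubar. WED \<phi> \<epsilon> v) \<noteq> \<infinity>"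
    using assms(7) by (auto simp: WED_minimizers_def)
  \<comment> \<open>the infimum is attained at \<open>u\<close>, so its value there is not \<open>\<infinity>\<close>\<close>
  have Wfin: "WED \<phi> \<epsilon> u \<noteq> \<infinity>"
  proof
    assume "WED \<phi> \<epsilon> u = \<infinity>"
    hence "\<infinity> \<le> (INF v\<in>admissible \<epsilon> T ubar. WED \<phi> \<epsilon> v)" by (intro INF_greatest) (use min in force)
    thus False using inf by simp
  qed
  have "AC_loc 2 {0..} u" and u0: "u 0 = ubar" using adm by (auto simp: admissible_def split: if_splits)
  then obtain D where u: "metric_speed u D" using AC_loc_metric_speed by blast
  note D = metric_speedD[OF u]
  note [measurable] = D(1)
  \<comment> \<open>extended to negative times by a constant, the curve is continuous on the whole line\<close>
  define w where "w t = u (max 0 t)" for t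
  have wc: "continuous_on UNIV w" unfolding w_def[abs_def] by (rule metric_speed_continuous[OF u])
  define M where "M = metric_deriv w"
  have [measurable]: "M \<in> borel_measurable borel" unfolding M_def by (rule metric_deriv_borel[OF wc])
  have M: "metric_deriv u t = M t" if "0 < t" for t
    unfolding M_def by (rule metric_deriv_cong[of "{0<..}"]) (use that in \<open>auto simp: w_def\<close>)
  have MD: "AE t in lborel. 0 < t \<longrightarrow> M t = D t" using metric_speed_deriv[OF u] by eventually_elim (simp add: M)
  have \<phi>m[measurable]: "(\<lambda>t. \<phi> (w t)) \<in> borel_measurable borel"
    by (rule lower_semicont_along_curve_borel[OF assms(1) lsc wc])
  have DE: "integrable lborel (\<lambda>t. indicator {0<..} t * (exp (- t / \<epsilon>) * (D t)\<^sup>2))"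
    by (rule admissible_weighted_speed_integrable[OF e assms(6) adm u])
  have neg: "(\<integral>\<^sup>+t. e2ennreal (- \<phi> (w t)) \<partial>mu_weight \<epsilon>) < \<infinity>"
    unfolding w_def by (rule negative_part_finite[OF u co e DE]) (use \<phi>m in \<open>simp add: w_def\<close>)
  define f where "f t = ereal (\<epsilon> / 2 * (D t)\<^sup>2) + \<phi> (w t)" for t
  have fm[measurable]: "f \<in> borel_measurable borel" unfolding f_def[abs_def] by measurable
  have fm': "f \<in> borel_measurable (mu_weight \<epsilon>)" by (rule borel_measurable_mu_weight[OF fm])
  have "AE t in mu_weight \<epsilon>. ereal (\<epsilon> / 2 * (metric_deriv u t)\<^sup>2) + \<phi> (u t) = f t"
    by (rule AE_mu_weight) (use metric_speed_deriv[OF u] in \<open>eventually_elim, auto simp: f_def w_def\<close>)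
  hence f_fin: "ext_integral (mu_weight \<epsilon>) f \<noteq> \<infinity>"
    using Wfin ext_integral_cong_AE unfolding WED_def by metis
  have f_neg: "(\<integral>\<^sup>+t. e2ennreal (- f t) \<partial>mu_weight \<epsilon>) < \<infinity>"
  proof (rule order_le_less_trans[OF nn_integral_mono neg])
    fix t
    have "0 \<le> \<epsilon> / 2 * (D t)\<^sup>2" using e by simp
    hence "\<phi> (w t) \<le> f t" unfolding f_def by (metis add.left_neutral add_right_mono ereal_less_eq(5))
    thus "e2ennreal (- f t) \<le> e2ennreal (- \<phi> (w t))" by (intro e2ennreal_mono) simp
  qed
  \<comment> \<open>\<open>\<Psi>\<close> is the real-valued potential energy; it agrees with \<open>\<phi> (u t)\<close> for almost every \<open>t > 0\<close>\<close>
  define \<Psi> where "\<Psi> t = real_of_ereal (\<phi> (w t))" for t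
  have \<Psi>m[measurable]: "\<Psi> \<in> borel_measurable borel" unfolding \<Psi>_def[abs_def] by measurable
  have ae_w: "AE t in mu_weight \<epsilon>. \<phi> (w t) = ereal (\<Psi> t)"
    using ext_integral_finite(1)[OF fm' f_fin f_neg]
  proof eventually_elim
    case (elim t)
    thus ?case by (cases "\<phi> (w t)") (auto simp: f_def \<Psi>_def)
  qed
  have fin: "AE t in lborel. 0 < t \<longrightarrow> \<phi> (u t) = ereal (\<Psi> t)"
    using AE_mu_weightD[OF e ae_w] by eventually_elim (auto simp: w_def)
  have PE: "integrable lborel (\<lambda>t. indicator {0<..} t * (exp (- t / \<epsilon>) * \<Psi> t))"
  proof -
    have "integrable (mu_weight \<epsilon>) (\<lambda>t. (D t)\<^sup>2)" using DE by (subst mu_weight_integral(1)[OF e]) auto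
    hence "integrable (mu_weight \<epsilon>) (\<lambda>t. real_of_ereal (f t) - \<epsilon> / 2 * (D t)\<^sup>2)"
      by (intro Bochner_Integration.integrable_diff ext_integral_finite(2)[OF fm' f_fin f_neg] integrable_mult_right)
    moreover have "AE t in mu_weight \<epsilon>. real_of_ereal (f t) - \<epsilon> / 2 * (D t)\<^sup>2 = \<Psi> t"
      using ae_w by eventually_elim (simp add: f_def)
    ultimately have "integrable (mu_weight \<epsilon>) \<Psi>"
      by (subst (asm) integrable_cong_AE) (auto intro!: borel_measurable_mu_weight)
    thus ?thesis by (subst (asm) mu_weight_integral(1)[OF e]) auto
  qed
  define P where "P t = \<epsilon> / 2 * (D t)\<^sup>2" for t
  have [measurable]: "P \<in> borel_measurable borel" unfolding P_def[abs_def] by measurable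
  have EE: "integrable lborel (\<lambda>t. indicator {0<..} t * (exp (- t / \<epsilon>) * (\<Psi> t - P t)))"
  proof -
    have "(\<lambda>t. indicator {0<..} t * (exp (- t / \<epsilon>) * (\<Psi> t - P t)))
      = (\<lambda>t. indicator {0<..} t * (exp (- t / \<epsilon>) * \<Psi> t) - \<epsilon> / 2 * (indicator {0<..} t * (exp (- t / \<epsilon>) * (D t)\<^sup>2)))"
      by (auto simp: fun_eq_iff P_def algebra_simps)
    thus ?thesis using Bochner_Integration.integrable_diff[OF PE integrable_mult_right[OF DE, of "\<epsilon> / 2"]] by simp
  qed
  let ?e = "\<lambda>t. real_of_ereal (energy \<phi> \<epsilon> u t)"
  let ?g = "\<lambda>t. - (metric_deriv u t)\<^sup>2"
  have energy_w: "?e t = real_of_ereal (\<phi> (w t) - ereal (\<epsilon> / 2 * (M t)\<^sup>2))" if "0 < t" for t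
    using that by (simp add: energy_def M w_def)
  have energy_P: "AE t in lborel. 0 < t \<longrightarrow> energy \<phi> \<epsilon> u t = ereal (\<Psi> t - P t)"
    using fin MD by eventually_elim (auto simp: energy_def P_def M)
  hence eP: "AE t in lborel. 0 < t \<longrightarrow> ?e t = \<Psi> t - P t" by eventually_elim simp
  have gD: "AE t in lborel. 0 < t \<longrightarrow> ?g t = - (D t)\<^sup>2" using metric_speed_deriv[OF u] by eventually_elim simp
  have em: "set_borel_measurable lborel I ?e" "set_borel_measurable lborel I ?g" if [measurable]: "I \<in> sets borel" and I: "I \<subseteq> {0<..}" for I
  proof -
    have "(\<lambda>t. indicator I t *\<^sub>R ?e t) = (\<lambda>t. indicator I t *\<^sub>R real_of_ereal (\<phi> (w t) - ereal (\<epsilon> / 2 * (M t)\<^sup>2)))"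
      using I energy_w by (auto simp: indicator_def fun_eq_iff)
    thus "set_borel_measurable lborel I ?e" unfolding set_borel_measurable_def by simp
    have "(\<lambda>t. indicator I t *\<^sub>R ?g t) = (\<lambda>t. indicator I t *\<^sub>R (- (M t)\<^sup>2))"
      using I M by (auto simp: indicator_def fun_eq_iff)
    thus "set_borel_measurable lborel I ?g" unfolding set_borel_measurable_def by simp
  qed
  have si: "set_integrable lborel {0<..<R} ?e" "set_integrable lborel {0<..<R} ?g" if "0 \<le> R" for R
  proof -
    show "set_integrable lborel {0<..<R} ?e"
      by (rule set_integrable_of_weighted[OF EE _ e that em(1)]) (use eP in auto)
    have "integrable lborel (\<lambda>t. indicator {0<..} t * (exp (- t / \<epsilon>) * - (D t)\<^sup>2))" using DE by simp
    thus "set_integrable lborel {0<..<R} ?g"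
      by (rule set_integrable_of_weighted[OF _ _ e that em(2)]) (use gD in auto)
  qed
  have li: "loc_integrable I ?e" "loc_integrable I ?g" if I: "I \<subseteq> {0<..}" for I
  proof -
    have sub: "{a..b} \<subseteq> {0<..<max 0 (b + 1)}" if "{a..b} \<subseteq> I" for a b
      using that I by (fastforce simp: max_def)
    show "loc_integrable I ?e" unfolding loc_integrable_def
      by (intro allI impI) (rule set_integrable_subset[OF si(1) _ sub], auto)
    show "loc_integrable I ?g" unfolding loc_integrable_def
      by (intro allI impI) (rule set_integrable_subset[OF si(2) _ sub], auto)
  qed
  \<comment> \<open>subintervals are covered too, because the local Sobolev statement asks for each \<open>(0,R)\<close>\<close>
  have dd: "has_distr_deriv I ?e ?g" if I: "I \<subseteq> {t. 0 < t \<and> ereal t < T}" for I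
  proof -
    have I0: "I \<subseteq> {0<..}" using I by auto
    have "- (LINT t:I|lborel. ?e t * deriv \<eta> t) = (LINT t:I|lborel. ?g t * \<eta> t)" if "test_function I \<eta>" for \<eta>
    proof -
      obtain K where K: "compact K" "K \<subseteq> I" "\<And>t. t \<notin> K \<Longrightarrow> \<eta> t = 0" "\<And>t. t \<notin> K \<Longrightarrow> deriv \<eta> t = 0"
        "\<And>t. (\<eta> has_real_derivative deriv \<eta> t) (at t)" "continuous_on UNIV (deriv \<eta>)"
        using test_functionE[OF \<open>test_function I \<eta>\<close>] by blast
      have \<eta>c: "continuous_on UNIV \<eta>" by (intro continuous_at_imp_continuous_on ballI DERIV_isCont[OF K(5)])
      have [measurable]: "\<eta> \<in> borel_measurable borel" "deriv \<eta> \<in> borel_measurable borel"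
        using \<eta>c K(6) by (auto intro: borel_measurable_continuous_onI)
      obtain c1 where c1: "\<And>t. \<bar>\<eta> t\<bar> \<le> c1 * exp (- t / \<epsilon>)"
        using compact_support_bounded_by_exp[OF K(1) \<eta>c K(3)] by blast
      obtain c2 where c2: "\<And>t. \<bar>deriv \<eta> t\<bar> \<le> c2 * exp (- t / \<epsilon>)"
        using compact_support_bounded_by_exp[OF K(1,6,4)] by blast
      define c where "c = max c1 c2"
      have c: "\<bar>\<eta> t\<bar> \<le> c * exp (- t / \<epsilon>)" "\<bar>deriv \<eta> t\<bar> \<le> c * exp (- t / \<epsilon>)" for t
        unfolding c_def by (rule order_trans[OF c1 mult_right_mono] order_trans[OF c2 mult_right_mono]; simp)+
      obtain R where R: "\<And>t. t \<in> K \<Longrightarrow> \<bar>t\<bar> < R"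
        using compact_imp_bounded[OF K(1)] unfolding bounded_pos_less by auto
      have neg0: "\<eta> t = 0" if "t \<le> 0" for t using that K(2) I0 by (intro K(3)) auto
      have end0: "\<eta> t = 0" if "T \<le> ereal t" for t using that K(2) I by (intro K(3)) force
      have L: "(\<integral>s. indicator {0<..} s * (\<epsilon> / 2 * (D s)\<^sup>2 * (- 2 * \<eta> s / \<epsilon> - deriv \<eta> s) + \<Psi> s * deriv \<eta> s) \<partial>lborel) = 0"
      proof (rule first_variation_vanishes[OF e u \<Psi>m fin DE PE K(5,6), where R=R and c=c])
        show "\<eta> t = 0" if "t \<le> 0" for t using that by (rule neg0)
        show "\<eta> t = 0" if "R \<le> t" for t using R[of t] that by (intro K(3)) auto
        show "\<bar>\<eta> t\<bar> \<le> c * exp (- t / \<epsilon>)" "\<bar>deriv \<eta> t\<bar> \<le> c * exp (- t / \<epsilon>)" for t by (rule c)+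
        fix v assume v: "AC_loc 2 {0..} v" "\<And>t. \<eta> t = 0 \<Longrightarrow> v t = u t"
          "(\<integral>\<^sup>+ t. ennreal ((metric_deriv v t)\<^sup>2) \<partial>mu_weight \<epsilon>) < \<infinity>"
        have v0: "v 0 = ubar" using v(2)[OF neg0[of 0]] u0 by simp
        \<comment> \<open>a variation supported in \<open>(0,T)\<close> changes neither the initial value nor the rest after \<open>T\<close>\<close>
        have "v \<in> admissible \<epsilon> T ubar"
        proof (cases "T = \<infinity>")
          case True thus ?thesis using v v0 by (simp add: admissible_def)
        next
          case False
          then obtain r where r: "T = ereal r" using assms(6) by (cases T) auto
          have "v t = v r" if "r \<le> t" for t
          proof -
            have "v t = u t" "v r = u r" using that by (auto intro!: v(2) end0 simp: r)
            moreover have "u t = u r" using adm that unfolding r admissible_finite_horizon by blast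
            ultimately show ?thesis by simp
          qed
          thus ?thesis using v(1) v0 unfolding r admissible_finite_horizon by blast
        qed
        thus "WED \<phi> \<epsilon> u \<le> WED \<phi> \<epsilon> v" by (rule min)
      qed
      have j1: "integrable lborel (\<lambda>s. indicator {0<..} s * (deriv \<eta> s * (\<Psi> s - P s)))"
        by (rule integrable_weighted_mult[OF EE, of _ c]) (use c(2) in auto)
      have j2: "integrable lborel (\<lambda>s. indicator {0<..} s * (\<eta> s * (D s)\<^sup>2))"
        by (rule integrable_weighted_mult[OF DE, of _ c]) (use c(1) in auto)
      have "indicator {0<..} s * (deriv \<eta> s * (\<Psi> s - P s)) - indicator {0<..} s * (\<eta> s * (D s)\<^sup>2)
          = indicator {0<..} s * (\<epsilon> / 2 * (D s)\<^sup>2 * (- 2 * \<eta> s / \<epsilon> - deriv \<eta> s) + \<Psi> s * deriv \<eta> s)" for s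
      proof -
        have k: "\<epsilon> / 2 * (D s)\<^sup>2 * (- 2 * \<eta> s / \<epsilon> - deriv \<eta> s) = - (\<eta> s * (D s)\<^sup>2) - deriv \<eta> s * P s"
        proof -
          have h: "2 * P s / \<epsilon> = (D s)\<^sup>2" using e by (simp add: P_def)
          have "\<epsilon> / 2 * (D s)\<^sup>2 * (- 2 * \<eta> s / \<epsilon> - deriv \<eta> s) = P s * (- 2 * \<eta> s / \<epsilon> - deriv \<eta> s)"
            by (simp only: P_def)
          also have "\<dots> = - (\<eta> s * (2 * P s / \<epsilon>)) - deriv \<eta> s * P s" by (simp add: algebra_simps)
          finally show ?thesis unfolding h .
        qed
        show ?thesis unfolding k by (simp add: algebra_simps)
      qed
      hence "(\<integral>s. indicator {0<..} s * (deriv \<eta> s * (\<Psi> s - P s)) - indicator {0<..} s * (\<eta> s * (D s)\<^sup>2) \<partial>lborel) = 0"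
        using L by simp
      hence eq: "(\<integral>s. indicator {0<..} s * (deriv \<eta> s * (\<Psi> s - P s)) \<partial>lborel) = (\<integral>s. indicator {0<..} s * (\<eta> s * (D s)\<^sup>2) \<partial>lborel)"
        using Bochner_Integration.integral_diff[OF j1 j2] by simp
      have em0: "(\<lambda>t. indicator {0<..} t * ?e t) \<in> borel_measurable lborel" "(\<lambda>t. indicator {0<..} t * ?g t) \<in> borel_measurable lborel"
        using em[of "{0<..}"] by (auto simp: set_borel_measurable_def)
      \<comment> \<open>outside the support \<open>\<eta>\<close> and its derivative vanish, so the integral over \<open>I\<close> is one over the half-line\<close>
      have a: "(LINT t:I|lborel. ?e t * deriv \<eta> t) = (\<integral>s. indicator {0<..} s * (deriv \<eta> s * (\<Psi> s - P s)) \<partial>lborel)"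
      proof -
        have "(LINT t:I|lborel. ?e t * deriv \<eta> t) = (\<integral>t. (indicator {0<..} t * ?e t) * deriv \<eta> t \<partial>lborel)"
          unfolding set_lebesgue_integral_def
        proof (intro Bochner_Integration.integral_cong refl)
          fix t show "indicator I t *\<^sub>R (?e t * deriv \<eta> t) = (indicator {0<..} t * ?e t) * deriv \<eta> t"
            using K(2) I0 K(4)[of t] by (cases "t \<in> K") (auto simp: indicator_def)
        qed
        also have "\<dots> = (\<integral>s. indicator {0<..} s * (deriv \<eta> s * (\<Psi> s - P s)) \<partial>lborel)"
        proof (rule integral_cong_AE)
          show "(\<lambda>t. (indicator {0<..} t * ?e t) * deriv \<eta> t) \<in> borel_measurable lborel"
            by (intro borel_measurable_times em0(1)) simp
          show "AE t in lborel. (indicator {0<..} t * ?e t) * deriv \<eta> t = indicator {0<..} t * (deriv \<eta> t * (\<Psi> t - P t))"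
            using eP by eventually_elim (auto simp: indicator_def)
        qed measurable
        finally show ?thesis .
      qed
      have b: "(LINT t:I|lborel. ?g t * \<eta> t) = - (\<integral>s. indicator {0<..} s * (\<eta> s * (D s)\<^sup>2) \<partial>lborel)"
      proof -
        have "(LINT t:I|lborel. ?g t * \<eta> t) = (\<integral>t. (indicator {0<..} t * ?g t) * \<eta> t \<partial>lborel)"
          unfolding set_lebesgue_integral_def
        proof (intro Bochner_Integration.integral_cong refl)
          fix t show "indicator I t *\<^sub>R (?g t * \<eta> t) = (indicator {0<..} t * ?g t) * \<eta> t"
            using K(2) I0 K(3)[of t] by (cases "t \<in> K") (auto simp: indicator_def)
        qed
        also have "\<dots> = (\<integral>s. - (indicator {0<..} s * (\<eta> s * (D s)\<^sup>2)) \<partial>lborel)"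
        proof (rule integral_cong_AE)
          show "(\<lambda>t. (indicator {0<..} t * ?g t) * \<eta> t) \<in> borel_measurable lborel"
            by (intro borel_measurable_times em0(2)) simp
          show "AE t in lborel. (indicator {0<..} t * ?g t) * \<eta> t = - (indicator {0<..} t * (\<eta> t * (D t)\<^sup>2))"
            using gD by eventually_elim (auto simp: indicator_def)
        qed measurable
        finally show ?thesis by simp
      qed
      show ?thesis unfolding a b eq ..
    qed
    thus ?thesis unfolding has_distr_deriv_def using li[OF I0] by blast
  qed
  have W: "W11 {0<..<R} ?e" if "0 \<le> R" "ereal R \<le> T" for R
    unfolding W11_def
  proof (intro conjI exI[of _ ?g])
    show "has_distr_deriv {0<..<R} ?e ?g"
    proof (rule dd, safe)
      fix t assume "t \<in> {0<..<R}"
      thus "0 < t" "ereal t < T" using that(2) by (auto intro: less_le_trans[of _ "ereal R"])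
    qed
  qed (use si that in auto)
  have "AE t in lborel. 0 < t \<and> ereal t < T \<longrightarrow> \<bar>energy \<phi> \<epsilon> u t\<bar> \<noteq> \<infinity>"
    using energy_P by eventually_elim auto
  moreover have "if T = \<infinity> then W11_loc ?e else W11 {0<..<real_of_ereal T} ?e"
  proof (cases "T = \<infinity>")
    case True
    thus ?thesis using W by (auto simp: W11_loc_def)
  next
    case False
    then obtain r where "T = ereal r" using assms(6) by (cases T) auto
    thus ?thesis using W[of r] assms(6) by simp
  qed
  ultimately show ?thesis using dd[OF subset_refl] by blast
qed

end
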